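(* Let $G$ be a group with a non-elementary action by homeomorphisms on a dendrite. Then there is a canonical unitary representation $V$ of $G$ without (non-zero) invariant vectors and a non-trivial canonical element of the second bounded cohomology $\mathrm{H}^2_{\mathrm{b}}(G,V)$.
   Context: A continuum is a non-empty connected compact metrisable space. A dendrite is a locally connected continuum containing no simple closed curve. An action of a group $G$ by homeomorphisms on a dendrite $X$ is elementary if $G$ fixes a point of $X$ or preserves (setwise) a pair of points of $X$; otherwise it is non-elementary. The bounded cohomology $\mathrm{H}^\bullet_{\mathrm{b}}(G,V)$ of the (discrete) group $G$ with coefficients in a unitary representation $V$ is the cohomology of the homogeneous complex of bounded $G$-equivariant maps $G^{n+1}\to V$. *)

theory Defs
  imports "HOL-Analysis.Analysis" "HOL-Algebra.Module" "HOL-Algebra.Group_Action"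
begin

section \<open>Dendrites and group actions on them\<close>

definition continuum :: "'x topology \<Rightarrow> bool" where
  "continuum X \<longleftrightarrow>
     topspace X \<noteq> {} \<and> connected_space X \<and> compact_space X \<and> metrizable_space X"

text \<open>A simple closed curve in \<open>X\<close> is the image of an embedding of the unit circle.\<close>

definition dendrite :: "'x topology \<Rightarrow> bool" where
  "dendrite X \<longleftrightarrow>
     continuum X \<and> locally_connected_space X \<and>
     \<not> (\<exists>f. embedding_map (top_of_set (sphere (0::complex) 1)) X f)"

record ('g, 'x) action =
  act_group :: "'g monoid"
  act_space :: "'x topology"
  act_map :: "'g \<Rightarrow> 'x \<Rightarrow> 'x"

definition action_by_homeos :: "('g, 'x) action \<Rightarrow> bool" where
  "action_by_homeos A \<longleftrightarrow>
     group_action (act_group A) (topspace (act_space A)) (act_map A) \<and>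
     (\<forall>g\<in>carrier (act_group A). homeomorphic_map (act_space A) (act_space A) (act_map A g))"

definition elementary :: "('g, 'x) action \<Rightarrow> bool" where
  "elementary A \<longleftrightarrow>
     (\<exists>x\<in>topspace (act_space A). \<forall>g\<in>carrier (act_group A). act_map A g x = x) \<or>
     (\<exists>x\<in>topspace (act_space A). \<exists>y\<in>topspace (act_space A). x \<noteq> y \<and>
        (\<forall>g\<in>carrier (act_group A). act_map A g ` {x, y} = {x, y}))"

definition nonelementary_dendrite_action :: "('g, 'x) action \<Rightarrow> bool" where
  "nonelementary_dendrite_action A \<longleftrightarrow>
     dendrite (act_space A) \<and> action_by_homeos A \<and> \<not> elementary A"

text \<open>The values of \<open>\<alpha>\<close> and \<open>h\<close> outside the group and the space are unconstrained.\<close>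

definition action_iso ::
  "('g, 'x) action \<Rightarrow> ('g, 'x) action \<Rightarrow> ('g \<Rightarrow> 'g) \<Rightarrow> ('x \<Rightarrow> 'x) \<Rightarrow> bool" where
  "action_iso A B \<alpha> h \<longleftrightarrow>
     \<alpha> \<in> iso (act_group A) (act_group B) \<and>
     homeomorphic_map (act_space A) (act_space B) h \<and>
     (\<forall>g\<in>carrier (act_group A). \<forall>x\<in>topspace (act_space A).
        h (act_map A g x) = act_map B (\<alpha> g) (h x))"

section \<open>Complex Hilbert spaces and unitary representations\<close>

definition complex_field :: "complex ring" where
  "complex_field = \<lparr>carrier = UNIV, mult = (*), one = 1, zero = 0, add = (+)\<rparr>"

text \<open>The fields \<open>mult\<close> and \<open>one\<close> that the record \<open>module\<close> inherits from \<open>ring\<close> are not used.\<close>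

record 'v hilbert = "(complex, 'v) module" +
  ip :: "'v \<Rightarrow> 'v \<Rightarrow> complex"

definition hnorm :: "'v hilbert \<Rightarrow> 'v \<Rightarrow> real" where
  "hnorm V v = sqrt (Re (ip V v v))"

locale hilbert_space = module complex_field V
  for V :: "'v hilbert" (structure) +
  assumes ip_add: "\<lbrakk>u \<in> carrier V; v \<in> carrier V; w \<in> carrier V\<rbrakk>
                     \<Longrightarrow> ip V (u \<oplus> v) w = ip V u w + ip V v w"
    and ip_smult: "\<lbrakk>u \<in> carrier V; v \<in> carrier V\<rbrakk> \<Longrightarrow> ip V (a \<odot> u) v = a * ip V u v"
    and ip_commute: "\<lbrakk>u \<in> carrier V; v \<in> carrier V\<rbrakk> \<Longrightarrow> ip V v u = cnj (ip V u v)"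
    and ip_pos: "\<lbrakk>v \<in> carrier V; v \<noteq> \<zero>\<rbrakk> \<Longrightarrow> Re (ip V v v) > 0"
    and complete: "Metric_space.mcomplete (carrier V) (\<lambda>u v. hnorm V (u \<ominus> v))"

definition unitary_map :: "'v hilbert \<Rightarrow> 'w hilbert \<Rightarrow> ('v \<Rightarrow> 'w) \<Rightarrow> bool" where
  "unitary_map V W U \<longleftrightarrow>
     bij_betw U (carrier V) (carrier W) \<and>
     (\<forall>u\<in>carrier V. \<forall>v\<in>carrier V. U (u \<oplus>\<^bsub>V\<^esub> v) = U u \<oplus>\<^bsub>W\<^esub> U v) \<and>
     (\<forall>a. \<forall>v\<in>carrier V. U (a \<odot>\<^bsub>V\<^esub> v) = a \<odot>\<^bsub>W\<^esub> U v) \<and>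
     (\<forall>u\<in>carrier V. \<forall>v\<in>carrier V. ip W (U u) (U v) = ip V u v)"

definition unitary_rep :: "'g monoid \<Rightarrow> 'v hilbert \<Rightarrow> ('g \<Rightarrow> 'v \<Rightarrow> 'v) \<Rightarrow> bool" where
  "unitary_rep G V \<pi> \<longleftrightarrow>
     hilbert_space V \<and> group_action G (carrier V) \<pi> \<and>
     (\<forall>g\<in>carrier G. unitary_map V V (\<pi> g))"

definition invariant_vectors :: "'g monoid \<Rightarrow> 'v hilbert \<Rightarrow> ('g \<Rightarrow> 'v \<Rightarrow> 'v) \<Rightarrow> 'v set" where
  "invariant_vectors G V \<pi> = {v \<in> carrier V. \<forall>g\<in>carrier G. \<pi> g v = v}"

section \<open>Bounded cohomology\<close>

text \<open>\<open>G\<^sup>n\<^sup>+\<^sup>1\<close> is the set of lists of length \<open>n + 1\<close>; the cochains of degree \<open>n\<close> are functions on it,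
  normalised to be \<open>undefined\<close> elsewhere. They form an abelian group under pointwise addition,
  which is written multiplicatively as a \<open>monoid\<close> record.\<close>

definition tuples :: "'g monoid \<Rightarrow> nat \<Rightarrow> 'g list set" where
  "tuples G n = {gs. length gs = Suc n \<and> set gs \<subseteq> carrier G}"

definition bcochains ::
  "'g monoid \<Rightarrow> 'v hilbert \<Rightarrow> ('g \<Rightarrow> 'v \<Rightarrow> 'v) \<Rightarrow> nat \<Rightarrow> ('g list \<Rightarrow> 'v) monoid" where
  "bcochains G V \<pi> n =
     \<lparr>carrier = {f \<in> tuples G n \<rightarrow>\<^sub>E carrier V.
        (\<exists>C. \<forall>gs\<in>tuples G n. hnorm V (f gs) \<le> C) \<and>
        (\<forall>g\<in>carrier G. \<forall>gs\<in>tuples G n. f (map (\<lambda>x. g \<otimes>\<^bsub>G\<^esub> x) gs) = \<pi> g (f gs))},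
      mult = (\<lambda>f f'. \<lambda>gs\<in>tuples G n. f gs \<oplus>\<^bsub>V\<^esub> f' gs),
      one = (\<lambda>gs\<in>tuples G n. \<zero>\<^bsub>V\<^esub>)\<rparr>"

text \<open>\<open>take i gs @ drop (Suc i) gs\<close> omits the entry with index \<open>i\<close>.\<close>

definition bdelta :: "'g monoid \<Rightarrow> 'v hilbert \<Rightarrow> nat \<Rightarrow> ('g list \<Rightarrow> 'v) \<Rightarrow> 'g list \<Rightarrow> 'v" where
  "bdelta G V n f =
     (\<lambda>gs\<in>tuples G (Suc n). \<Oplus>\<^bsub>V\<^esub>i\<in>{..Suc n}. ((-1) ^ i) \<odot>\<^bsub>V\<^esub> f (take i gs @ drop (Suc i) gs))"

definition bcocycles ::
  "'g monoid \<Rightarrow> 'v hilbert \<Rightarrow> ('g \<Rightarrow> 'v \<Rightarrow> 'v) \<Rightarrow> nat \<Rightarrow> ('g list \<Rightarrow> 'v) set" where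
  "bcocycles G V \<pi> n = kernel (bcochains G V \<pi> n) (bcochains G V \<pi> (Suc n)) (bdelta G V n)"

definition bcoboundaries ::
  "'g monoid \<Rightarrow> 'v hilbert \<Rightarrow> ('g \<Rightarrow> 'v \<Rightarrow> 'v) \<Rightarrow> nat \<Rightarrow> ('g list \<Rightarrow> 'v) set" where
  "bcoboundaries G V \<pi> n =
     (case n of 0 \<Rightarrow> {\<one>\<^bsub>bcochains G V \<pi> 0\<^esub>}
      | Suc m \<Rightarrow> bdelta G V m ` carrier (bcochains G V \<pi> m))"

definition bounded_cohomology ::
  "'g monoid \<Rightarrow> 'v hilbert \<Rightarrow> ('g \<Rightarrow> 'v \<Rightarrow> 'v) \<Rightarrow> nat \<Rightarrow> ('g list \<Rightarrow> 'v) set monoid" where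
  "bounded_cohomology G V \<pi> n =
     (bcochains G V \<pi> n)\<lparr>carrier := bcocycles G V \<pi> n\<rparr> Mod bcoboundaries G V \<pi> n"

section \<open>Canonical classes\<close>

text \<open>Let \<open>\<alpha> : G \<rightarrow> H\<close> be a group isomorphism and \<open>U : V \<rightarrow> W\<close> a unitary map intertwining
  a representation of \<open>G\<close> on \<open>V\<close> with one of \<open>H\<close> on \<open>W\<close> along \<open>\<alpha>\<close>.
  Then \<open>f \<mapsto> U \<circ> f\<close> and \<open>f \<mapsto> f \<circ> \<alpha>\<close> identify the complexes of \<open>(G, V)\<close> and of \<open>(H, W)\<close>
  with the one of \<open>G\<close> with coefficients in \<open>W\<close> (acted upon through \<open>\<alpha>\<close>). Hence two classes, being
  sets of cochains, correspond to each other if and only if they have the same image there.\<close>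

definition classes_correspond ::
  "'g monoid \<Rightarrow> nat \<Rightarrow> ('g \<Rightarrow> 'h) \<Rightarrow> ('v \<Rightarrow> 'w) \<Rightarrow>
     ('g list \<Rightarrow> 'v) set \<Rightarrow> ('h list \<Rightarrow> 'w) set \<Rightarrow> bool" where
  "classes_correspond G n \<alpha> U c d \<longleftrightarrow>
     (\<lambda>f. \<lambda>gs\<in>tuples G n. U (f gs)) ` c = (\<lambda>f. \<lambda>gs\<in>tuples G n. f (map \<alpha> gs)) ` d"

text \<open>A choice, for every non-elementary action \<open>A\<close> on a dendrite, of a representation \<open>(V A, \<pi> A)\<close>
  and of a class \<open>c A\<close> is canonical if it is functorial with respect to isomorphisms of actions:
  each isomorphism \<open>(\<alpha>, h) : A \<rightarrow> B\<close> induces, compatibly with identities and composition, a unitary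
  equivalence \<open>U A B \<alpha> h\<close> from \<open>V A\<close> to \<open>V B\<close>, and this equivalence carries \<open>c A\<close> to \<open>c B\<close>.
  The two functoriality clauses are stated up to equality on the carriers.\<close>

definition canonical ::
  "(('g, 'x) action \<Rightarrow> 'v hilbert) \<Rightarrow> (('g, 'x) action \<Rightarrow> 'g \<Rightarrow> 'v \<Rightarrow> 'v) \<Rightarrow>
   (('g, 'x) action \<Rightarrow> ('g list \<Rightarrow> 'v) set) \<Rightarrow> bool" where
  "canonical V \<pi> c \<longleftrightarrow>
   (\<exists>U :: ('g, 'x) action \<Rightarrow> ('g, 'x) action \<Rightarrow> ('g \<Rightarrow> 'g) \<Rightarrow> ('x \<Rightarrow> 'x) \<Rightarrow> 'v \<Rightarrow> 'v.
      (\<forall>A B \<alpha> h. nonelementary_dendrite_action A \<and> nonelementary_dendrite_action B \<and>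
         action_iso A B \<alpha> h \<longrightarrow>
           unitary_map (V A) (V B) (U A B \<alpha> h) \<and>
           (\<forall>g\<in>carrier (act_group A). \<forall>v\<in>carrier (V A).
              U A B \<alpha> h (\<pi> A g v) = \<pi> B (\<alpha> g) (U A B \<alpha> h v)) \<and>
           classes_correspond (act_group A) 2 \<alpha> (U A B \<alpha> h) (c A) (c B)) \<and>
      (\<forall>A \<alpha> h. nonelementary_dendrite_action A \<and> action_iso A A \<alpha> h \<and>
         (\<forall>g\<in>carrier (act_group A). \<alpha> g = g) \<and> (\<forall>x\<in>topspace (act_space A). h x = x) \<longrightarrow>
           (\<forall>v\<in>carrier (V A). U A A \<alpha> h v = v)) \<and>
      (\<forall>A B C \<alpha> h \<beta> k \<gamma> l. nonelementary_dendrite_action A \<and>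
         nonelementary_dendrite_action B \<and> nonelementary_dendrite_action C \<and>
         action_iso A B \<alpha> h \<and> action_iso B C \<beta> k \<and> action_iso A C \<gamma> l \<and>
         (\<forall>g\<in>carrier (act_group A). \<gamma> g = \<beta> (\<alpha> g)) \<and>
         (\<forall>x\<in>topspace (act_space A). l x = k (h x)) \<longrightarrow>
           (\<forall>v\<in>carrier (V A). U A C \<gamma> l v = U B C \<beta> k (U A B \<alpha> h v))))"

end

theory Submission
  imports Defs "HOL-Probability.Discrete_Topology"
begin

text \<open>The group acts on the pairs of branches at the points of the dendrite \<open>X\<close>, and the representation is the
space of square-summable functions on the triples \<open>(b, C, C')\<close>, where \<open>C\<close> and \<open>C'\<close> are distinct
components of \<open>X - {b}\<close>. A pair of points \<open>(x, y)\<close> crosses such a triple with sign 1 if \<open>x \<in> C\<close> and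
\<open>y \<in> C'\<close>, and with sign -1 in the opposite direction. As a function of the triple, the crossing number of
\<open>(x, y)\<close> may have infinite support. Its coboundary
\<open>crossing(y, z) - crossing(x, z) + crossing(x, y)\<close>, however, is non-zero only where \<open>C\<close>, \<open>C'\<close> and
the complement of \<open>C \<union> C'\<close> contain one of the points each, and two different points \<open>b\<close> cannot
separate three points in this way (\<open>triple_determined\<close>). So at most six triples occur, and evaluating on
an orbit gives a bounded cocycle. Two base points give cocycles that differ by the coboundary of a bounded cochain,
hence the class depends on no choice and is functorial.

The rest of the proof shows that the action plays ping-pong: there are a point \<open>b\<close>, three components
\<open>C1\<close>, \<open>C2\<close>, \<open>C3\<close> of \<open>X - {b}\<close> and group elements \<open>P\<close>, \<open>Q\<close> such that \<open>P\<close> maps the complement of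
\<open>C1\<close> into \<open>C3\<close>, and \<open>Q\<close> maps the complement of \<open>D\<close> into \<open>D'\<close> for disjoint subsets \<open>D\<close>, \<open>D'\<close> of
\<open>C2\<close> (\<open>ping_pong\<close>). A finite invariant set would lie in \<open>C1 \<union> C3\<close> because of \<open>P\<close> and in \<open>C2\<close> because of
\<open>Q\<close>, so there is none. The triples at which an invariant vector takes a given non-zero value form a finite invariant set, hence
there is no non-zero invariant vector either.

Suppose that the cocycle is the coboundary of a bounded equivariant \<open>F\<close>, and look at the single triple
\<open>s = (b, C1, C3)\<close>. There the difference of crossing number and \<open>F\<close> is a cocycle, so an alternating sum of
\<open>F\<close> over four pairs \<open>(p, v)\<close>, with \<open>p\<close> in \<open>{p1, p2}\<close> and \<open>v\<close> in \<open>{v1, v2}\<close>, is the same alternating sum of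
crossing numbers. It is 1 if \<open>p1\<close> and \<open>p2\<close> are the inverses of \<open>uP\<close> and \<open>uQ\<close>, and \<open>v1 = Pv\<close>,
\<open>v2 = Qv\<close>, for words \<open>u\<close>, \<open>v\<close> in \<open>P\<close> and \<open>Q\<close>. By equivariance, the value at \<open>s\<close> of \<open>F\<close> on
\<open>(inverse of u, v)\<close> is the value of \<open>F(1, uv)\<close> at \<open>u s\<close>; when a word \<open>w = uv\<close> is cut in all possible
places, the triples \<open>u s\<close> are distinct, hence the sum of the squares of these values is bounded by the square of the
norm of \<open>F(1, w)\<close>. On average over all words of length \<open>L\<close> this sum is at least a constant times \<open>L\<close>, because
of the alternating sums (\<open>prefix_sums_unbounded\<close>). This is a contradiction.

For ping-pong one works in a minimal closed invariant set \<open>K\<close> that contains every point separating two of its points.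
Every orbit in \<open>K\<close> visits every component of \<open>X - {b}\<close> that meets \<open>K\<close>. The geometry of the dendrite
enters through medians: of three points, one separates the other two or some fourth point separates all three
(\<open>dendrite_median\<close>). This provides a point \<open>b\<close> of \<open>K\<close> with three branches that meet \<open>K\<close>. Medians come from arcs,
whose existence in a locally connected continuum is proved by refining chains of small connected open sets.\<close>

section \<open>Complementary components of a point\<close>

definition cut_comp :: "'x topology \<Rightarrow> 'x \<Rightarrow> 'x \<Rightarrow> 'x set" where
  "cut_comp X b x = connected_component_of_set (subtopology X (topspace X - {b})) x"

lemma cut_comp_subset: "cut_comp X b x \<subseteq> topspace X - {b}"
  using connected_component_of_subset_topspace[of "subtopology X (topspace X - {b})" x]
  unfolding cut_comp_def by auto

lemma cut_comp_empty: "x \<notin> topspace X - {b} \<Longrightarrow> cut_comp X b x = {}"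
  unfolding cut_comp_def connected_component_of_eq_empty by simp

lemma in_cut_comp: "x \<in> topspace X \<Longrightarrow> x \<noteq> b \<Longrightarrow> x \<in> cut_comp X b x"
  unfolding cut_comp_def by (simp add: connected_component_of_refl)

lemma cut_comp_eq: "y \<in> cut_comp X b x \<Longrightarrow> cut_comp X b y = cut_comp X b x"
  unfolding cut_comp_def by (metis connected_component_of_equiv mem_Collect_eq)

lemma cut_comp_maximal:
  assumes "connectedin X T" "x \<in> T" "b \<notin> T"
  shows "T \<subseteq> cut_comp X b x"
  unfolding cut_comp_def
  using assms connectedin_subset_topspace[OF assms(1)]
  by (intro connected_component_of_maximal) (auto simp: connectedin_subtopology)

lemma connectedin_cut_comp: "connectedin X (cut_comp X b x)"
  using connectedin_connected_component_of[of "subtopology X (topspace X - {b})" x]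
  unfolding cut_comp_def connectedin_subtopology by blast

text \<open>The direct image and the image under the inverse map are both connected and avoid the cut point, so each inclusion
is an instance of maximality.\<close>

lemma homeomorphic_map_cut_comp:
  assumes h: "homeomorphic_map X Y h" and x: "x \<in> topspace X" and b: "b \<in> topspace X"
  shows "h ` cut_comp X b x = cut_comp Y (h b) (h x)"
proof (cases "x = b")
  case True
  then show ?thesis by (simp add: cut_comp_empty)
next
  case False
  obtain k where k: "homeomorphic_maps X Y h k"
    using h homeomorphic_map_maps by blast
  have kh: "\<And>x. x \<in> topspace X \<Longrightarrow> k (h x) = x" and hk: "\<And>y. y \<in> topspace Y \<Longrightarrow> h (k y) = y"
    and hc: "continuous_map X Y h" and kc: "continuous_map Y X k"
    using k by (auto simp: homeomorphic_maps_def)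
  have hX: "\<And>x. x \<in> topspace X \<Longrightarrow> h x \<in> topspace Y" and kY: "\<And>x. x \<in> topspace Y \<Longrightarrow> k x \<in> topspace X"
    using hc kc by (auto simp: continuous_map_def)
  have "h ` cut_comp X b x \<subseteq> cut_comp Y (h b) (h x)"
  proof (rule cut_comp_maximal)
    show "connectedin Y (h ` cut_comp X b x)"
      using connectedin_continuous_map_image[OF hc connectedin_cut_comp] .
    show "h x \<in> h ` cut_comp X b x" using in_cut_comp[OF x False] by blast
    show "h b \<notin> h ` cut_comp X b x"
      using cut_comp_subset[of X b x] kh b by (smt (verit) DiffE imageE in_mono insertI1)
  qed
  moreover have "k ` cut_comp Y (h b) (h x) \<subseteq> cut_comp X b x"
  proof (rule cut_comp_maximal)
    show "connectedin X (k ` cut_comp Y (h b) (h x))"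
      using connectedin_continuous_map_image[OF kc connectedin_cut_comp] .
    have "h x \<noteq> h b" using kh x b False by metis
    then show "x \<in> k ` cut_comp Y (h b) (h x)"
      using in_cut_comp[of "h x" Y "h b"] hX[OF x] kh[OF x] by (metis image_eqI)
    show "b \<notin> k ` cut_comp Y (h b) (h x)"
    proof
      assume "b \<in> k ` cut_comp Y (h b) (h x)"
      then obtain y where y: "y \<in> cut_comp Y (h b) (h x)" "b = k y" by blast
      then have "h b = y" using hk cut_comp_subset[of Y "h b" "h x"] by auto
      then show False using y cut_comp_subset[of Y "h b" "h x"] by auto
    qed
  qed
  moreover have "cut_comp Y (h b) (h x) = h ` k ` cut_comp Y (h b) (h x)"
  proof -
    have "h (k y) = y" if "y \<in> cut_comp Y (h b) (h x)" for y
      using hk that cut_comp_subset[of Y "h b" "h x"] by blast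
    then show ?thesis by (simp add: image_image)
  qed
  ultimately show ?thesis by (metis image_mono subset_antisym)
qed

locale cut_space =
  fixes X :: "'x topology"
  assumes connected: "connected_space X" and loc_connected: "locally_connected_space X"
    and t1: "t1_space X"
begin

abbreviation comp where "comp \<equiv> cut_comp X"

lemma openin_comp: "openin X (comp b x)"
proof -
  have "openin X (topspace X - {b})"
    using t1 closedin_t1_singleton[OF t1, of b] by (cases "b \<in> topspace X") auto
  then have *: "\<And>x. x \<in> topspace X - {b} \<Longrightarrow> openin X (comp b x)"
    using loc_connected unfolding locally_connected_space_eq_open_connected_component_of cut_comp_def by simp
  show ?thesis
  proof (cases "x \<in> topspace X - {b}")
    case False
    then have "comp b x = {}" using cut_comp_empty by fast
    then show ?thesis by simp
  qed (rule *)
qed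

text \<open>If the cut point were not in the closure of the component, the component would be closed as well as open, against the
connectedness of the whole space.\<close>

lemma connectedin_insert_comp:
  assumes b: "b \<in> topspace X" and x: "x \<in> topspace X" "x \<noteq> b"
  shows "connectedin X (insert b (comp b x))"
proof (rule connectedin_intermediate_closure_of[OF connectedin_cut_comp])
  show "comp b x \<subseteq> insert b (comp b x)" by blast
  have "b \<in> X closure_of comp b x"
  proof (rule ccontr)
    assume nb: "b \<notin> X closure_of comp b x"
    have "X closure_of comp b x \<subseteq> comp b x"
    proof (rule cut_comp_maximal[OF _ _ nb])
      show "connectedin X (X closure_of comp b x)"
        by (rule connectedin_closure_of[OF connectedin_cut_comp])
      show "x \<in> X closure_of comp b x"
        using in_cut_comp[OF x] closure_of_subset[of "comp b x" X] cut_comp_subset[of X b x] by blast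
    qed
    then have "closedin X (comp b x)"
      using closure_of_subset[of "comp b x" X] cut_comp_subset[of X b x] closedin_closure_of[of X "comp b x"]
      by (metis Diff_subset order_trans subset_antisym)
    then have "comp b x = {} \<or> comp b x = topspace X"
      using connected openin_comp connected_space_clopen_in by blast
    then show False using in_cut_comp[OF x] b cut_comp_subset[of X b x] by blast
  qed
  then show "insert b (comp b x) \<subseteq> X closure_of comp b x"
    using closure_of_subset[of "comp b x" X] cut_comp_subset[of X b x] by blast
qed

text \<open>The complement is a union of connected sets through the cut point: the other components, each with the cut point
added.\<close>

lemma connectedin_compl_comp:
  assumes b: "b \<in> topspace X"
  shows "connectedin X (topspace X - comp b x)"
proof -
  let ?F = "insert {b} ((\<lambda>y. insert b (comp b y)) ` (topspace X - {b} - comp b x))"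
  have "connectedin X (\<Union>?F)"
  proof (rule connectedin_Union)
    show "connectedin X S" if "S \<in> ?F" for S
      using that b connectedin_insert_comp[OF b] connectedin_sing[of X b] by blast
    show "\<Inter>?F \<noteq> {}" by auto
  qed
  moreover have "\<Union>?F = topspace X - comp b x"
  proof
    show "\<Union>?F \<subseteq> topspace X - comp b x"
    proof
      fix z assume "z \<in> \<Union>?F"
      then consider "z = b" | y where "y \<in> topspace X - {b} - comp b x" "z \<in> comp b y" by blast
      then show "z \<in> topspace X - comp b x"
      proof cases
        case 1 then show ?thesis using b cut_comp_subset[of X b x] by blast
      next
        case 2
        then have "z \<notin> comp b x" using in_cut_comp[of y X b] cut_comp_eq[of z X b] by auto
        then show ?thesis using 2 cut_comp_subset[of X b y] by blast
      qed
    qed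
    show "topspace X - comp b x \<subseteq> \<Union>?F"
    proof
      fix z assume "z \<in> topspace X - comp b x"
      then show "z \<in> \<Union>?F" using in_cut_comp[of z X b] by (cases "z = b") auto
    qed
  qed
  ultimately show ?thesis by simp
qed

text \<open>The basic nesting property of branches, from which all the dynamics is derived: whatever lies behind \<open>b\<close> as seen
from \<open>b'\<close> is on one side of \<open>b'\<close>.\<close>

lemma compl_comp_subset:
  assumes "b \<in> topspace X" "b' \<in> topspace X" "b \<noteq> b'"
  shows "topspace X - comp b b' \<subseteq> comp b' b"
proof (rule cut_comp_maximal[OF connectedin_compl_comp])
  show "b \<in> topspace X" "b \<in> topspace X - comp b b'" using assms cut_comp_subset[of X b b'] by auto
  show "b' \<notin> topspace X - comp b b'" using in_cut_comp[of b' X b] assms by auto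
qed

lemma closedin_insert_comp:
  assumes b: "b \<in> topspace X"
  shows "closedin X (insert b (comp b x))"
proof -
  have "topspace X - insert b (comp b x) = (\<Union>y\<in>topspace X - {b} - comp b x. comp b y)"
  proof
    show "topspace X - insert b (comp b x) \<subseteq> (\<Union>y\<in>topspace X - {b} - comp b x. comp b y)"
      using in_cut_comp[of _ X b] by auto
    show "(\<Union>y\<in>topspace X - {b} - comp b x. comp b y) \<subseteq> topspace X - insert b (comp b x)"
    proof
      fix z assume "z \<in> (\<Union>y\<in>topspace X - {b} - comp b x. comp b y)"
      then obtain y where y: "y \<in> topspace X" "y \<noteq> b" "y \<notin> comp b x" "z \<in> comp b y" by blast
      have "z \<notin> comp b x" using y in_cut_comp[of y X b] cut_comp_eq[of z X b] by metis
      then show "z \<in> topspace X - insert b (comp b x)" using y(4) cut_comp_subset[of X b y] by auto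
    qed
  qed
  then have "openin X (topspace X - insert b (comp b x))"
    by (metis (no_types, lifting) openin_Union openin_comp imageE)
  then show ?thesis
    using b cut_comp_subset[of X b x] by (auto simp: closedin_def)
qed

text \<open>The three points \<open>x\<close>, \<open>y\<close>, \<open>z\<close> are told apart by \<open>b\<close> in the weak sense that \<open>z\<close> may be \<open>b\<close> itself. A second
such point \<open>b'\<close> would lie in some component at \<open>b\<close>; removing it leaves two of the three points together in a connected
set that avoids \<open>b'\<close>.\<close>

lemma separating_point_unique:
  assumes b: "b \<in> topspace X" "b' \<in> topspace X"
    and x: "x \<in> topspace X - {b, b'}" and y: "y \<in> topspace X - {b, b'}" and z: "z \<in> topspace X"
    and s: "comp b x \<noteq> comp b y" "z \<notin> comp b x" "z \<notin> comp b y"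
    and s': "comp b' x \<noteq> comp b' y" "z \<notin> comp b' x" "z \<notin> comp b' y"
  shows "b = b'"
proof (rule ccontr)
  assume ne: "b \<noteq> b'"
  have *: False
    if b': "b' \<in> comp b u" and v: "v \<in> topspace X" "v \<notin> comp b u" and zu: "z \<notin> comp b u" and zv: "z \<notin> comp b' v"
    for u v
  proof -
    have "topspace X - comp b u \<subseteq> comp b' v"
      by (rule cut_comp_maximal[OF connectedin_compl_comp[OF b(1)]]) (use v b' in auto)
    then show False using z zu zv by blast
  qed
  have "y \<notin> comp b x" "x \<notin> comp b y" using s(1) cut_comp_eq by metis+
  then have n: "b' \<notin> comp b x" "b' \<notin> comp b y"
    using *[of x y] *[of y x] x y s s' by blast+
  have "connectedin X (insert b (comp b x) \<union> insert b (comp b y))"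
    using x y b by (intro connectedin_Un connectedin_insert_comp) auto
  then have "insert b (comp b x) \<union> insert b (comp b y) \<subseteq> comp b' x"
    using n ne in_cut_comp x by (intro cut_comp_maximal) auto
  then have "y \<in> comp b' x" using in_cut_comp[of y X b] y by auto
  then show False using cut_comp_eq s'(1) by metis
qed

end

section \<open>Minimal invariant sets\<close>

context cut_space
begin

definition separates :: "'x \<Rightarrow> 'x \<Rightarrow> 'x \<Rightarrow> bool" where
  "separates z x y \<longleftrightarrow> z \<in> topspace X \<and> x \<in> topspace X - {z} \<and> y \<in> topspace X - {z} \<and> comp z x \<noteq> comp z y"

text \<open>Convexity with respect to the betweenness relation. Unlike connectedness it passes to arbitrary intersections, which
makes minimal sets easy to produce.\<close>

definition btw_convex :: "'x set \<Rightarrow> bool" where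
  "btw_convex K \<longleftrightarrow> (\<forall>x\<in>K. \<forall>y\<in>K. \<forall>z. separates z x y \<longrightarrow> z \<in> K)"

lemma separates_commute: "separates z x y \<longleftrightarrow> separates z y x"
  unfolding separates_def by auto

lemma not_separates_connectedin:
  assumes "connectedin X T" "x \<in> T" "y \<in> T" "z \<notin> T"
  shows "\<not> separates z x y"
  using cut_comp_maximal[OF assms(1,2,4)] assms(3) cut_comp_eq[of y X z x] unfolding separates_def by auto

lemma btw_convexI: "(\<And>x y z. x \<in> K \<Longrightarrow> y \<in> K \<Longrightarrow> separates z x y \<Longrightarrow> z \<in> K) \<Longrightarrow> btw_convex K"
  unfolding btw_convex_def by (intro ballI allI impI)

lemma btw_convexD:
  assumes "btw_convex K" "x \<in> K" "y \<in> K" "separates z x y"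
  shows "z \<in> K"
  by (rule assms(1)[unfolded btw_convex_def, THEN bspec, THEN bspec, THEN spec, THEN mp]) fact+

lemma connectedin_imp_btw_convex: "connectedin X T \<Longrightarrow> btw_convex T"
  by (rule btw_convexI) (use not_separates_connectedin in metis)

lemma btw_convex_Inter:
  assumes "\<And>K. K \<in> \<K> \<Longrightarrow> btw_convex K"
  shows "btw_convex (\<Inter>\<K>)"
proof (intro btw_convexI InterI)
  fix x y z K
  assume x: "x \<in> \<Inter>\<K>" and y: "y \<in> \<Inter>\<K>" and z: "separates z x y" and K: "K \<in> \<K>"
  show "z \<in> K" by (rule btw_convexD[OF assms[OF K] InterD[OF x K] InterD[OF y K] z])
qed

end

text \<open>Zorn's lemma for the reverse inclusion.\<close>

lemma Zorn_minimal:
  assumes "\<K> \<noteq> {}" and "\<And>\<C>. \<C> \<noteq> {} \<Longrightarrow> subset.chain \<K> \<C> \<Longrightarrow> \<Inter>\<C> \<in> \<K>"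
  shows "\<exists>M\<in>\<K>. \<forall>K\<in>\<K>. K \<subseteq> M \<longrightarrow> K = M"
proof -
  have "\<exists>M\<in>uminus ` \<K>. \<forall>K\<in>uminus ` \<K>. M \<subseteq> K \<longrightarrow> K = M"
  proof (rule subset_Zorn_nonempty)
    show "uminus ` \<K> \<noteq> {}" using assms(1) by simp
    fix \<C> assume C: "\<C> \<noteq> {}" "subset.chain (uminus ` \<K>) \<C>"
    then have "subset.chain \<K> (uminus ` \<C>)"
      unfolding subset_chain_def by (auto simp: image_subset_iff)
    then have "\<Inter>(uminus ` \<C>) \<in> \<K>" using assms(2) C(1) by simp
    moreover have "\<Union>\<C> = - \<Inter>(uminus ` \<C>)" by auto
    ultimately show "\<Union>\<C> \<in> uminus ` \<K>" by blast
  qed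
  then show ?thesis by auto
qed

lemma compact_space_chain_Inter:
  assumes X: "compact_space X" and "\<C> \<noteq> {}" "subset.chain \<K> \<C>"
    and "\<And>K. K \<in> \<C> \<Longrightarrow> closedin X K \<and> K \<noteq> {}"
  shows "\<Inter>\<C> \<noteq> {}"
proof -
  have "\<Inter>F \<noteq> {}" if "finite F" "F \<subseteq> \<C>" for F
  proof (cases "F = {}")
    case False
    have "subset.chain \<K> F" using that assms(3) unfolding subset_chain_def by (meson order_trans subsetD)
    then have "\<Inter>F \<in> F" using Inter_in_chain[of F \<K>] that(1) False by simp
    then show ?thesis using that assms(4) by blast
  qed auto
  then have "(\<forall>C\<in>\<C>. closedin X C) \<and> (\<forall>F. finite F \<and> F \<subseteq> \<C> \<longrightarrow> \<Inter>F \<noteq> {})"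
    using assms(4) by simp
  then show ?thesis by (rule X[unfolded compact_space_fip, THEN spec, THEN mp])
qed

locale cut_action = cut_space X for X :: "'x topology" +
  fixes G :: "'g monoid" and act :: "'g \<Rightarrow> 'x \<Rightarrow> 'x"
  assumes compact: "compact_space X"
    and group_action: "group_action G (topspace X) act"
    and homeo: "g \<in> carrier G \<Longrightarrow> homeomorphic_map X X (act g)"
begin

sublocale group_action G "topspace X" act by (rule group_action)

lemma group_G: "group G"
  using group_hom group_hom.axioms(1) by blast

lemma inv_closed: "g \<in> carrier G \<Longrightarrow> inv\<^bsub>G\<^esub> g \<in> carrier G"
  using group_G by (rule group.inv_closed)

lemma mult_closed: "g \<in> carrier G \<Longrightarrow> h \<in> carrier G \<Longrightarrow> g \<otimes>\<^bsub>G\<^esub> h \<in> carrier G"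
  using group_G group.is_monoid monoid.m_closed by metis

lemma act_closed: "g \<in> carrier G \<Longrightarrow> x \<in> topspace X \<Longrightarrow> act g x \<in> topspace X"
  by (rule element_image) auto

lemma act_mult: "g \<in> carrier G \<Longrightarrow> h \<in> carrier G \<Longrightarrow> x \<in> topspace X \<Longrightarrow> act (g \<otimes>\<^bsub>G\<^esub> h) x = act g (act h x)"
  by (rule composition_rule)

lemma act_one: "x \<in> topspace X \<Longrightarrow> act \<one>\<^bsub>G\<^esub> x = x"
  using id_eq_one by (metis restrict_apply')

lemma act_inv: "g \<in> carrier G \<Longrightarrow> x \<in> topspace X \<Longrightarrow> act (inv\<^bsub>G\<^esub> g) (act g x) = x"
  by (rule orbit_sym_aux) auto

lemma act_inv': "g \<in> carrier G \<Longrightarrow> x \<in> topspace X \<Longrightarrow> act g (act (inv\<^bsub>G\<^esub> g) x) = x"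
  using act_inv[OF inv_closed, of g x] group_G by (simp add: group.inv_inv)

lemma act_inj: "g \<in> carrier G \<Longrightarrow> x \<in> topspace X \<Longrightarrow> y \<in> topspace X \<Longrightarrow> act g x = act g y \<longleftrightarrow> x = y"
  using act_inv by metis

lemma act_comp:
  "g \<in> carrier G \<Longrightarrow> x \<in> topspace X \<Longrightarrow> b \<in> topspace X \<Longrightarrow> act g ` comp b x = comp (act g b) (act g x)"
  by (rule homeomorphic_map_cut_comp[OF homeo])

lemma image_act_eq: "g \<in> carrier G \<Longrightarrow> S \<subseteq> topspace X \<Longrightarrow> T \<subseteq> topspace X \<Longrightarrow> act g ` S = act g ` T \<longleftrightarrow> S = T"
  using inj_prop[of g] by (metis inj_on_image_eq_iff)

lemma comp_act_eq:
  assumes "g \<in> carrier G" "x \<in> topspace X" "y \<in> topspace X" "b \<in> topspace X"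
  shows "comp (act g b) (act g x) = comp (act g b) (act g y) \<longleftrightarrow> comp b x = comp b y"
proof -
  have "comp b x \<subseteq> topspace X" "comp b y \<subseteq> topspace X" using cut_comp_subset[of X b] by blast+
  then show ?thesis using assms by (simp add: act_comp[symmetric] image_act_eq)
qed

lemma separates_act:
  assumes "g \<in> carrier G" "separates z x y"
  shows "separates (act g z) (act g x) (act g y)"
  using assms(2) unfolding separates_def by (auto simp: assms(1) comp_act_eq act_closed act_inj)

definition invariant :: "'x set \<Rightarrow> bool" where
  "invariant K \<longleftrightarrow> (\<forall>g\<in>carrier G. \<forall>x\<in>K. act g x \<in> K)"

definition inv_convex :: "'x set \<Rightarrow> bool" where
  "inv_convex K \<longleftrightarrow> closedin X K \<and> btw_convex K \<and> invariant K \<and> K \<noteq> {}"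

definition minimal :: "'x set \<Rightarrow> bool" where
  "minimal K \<longleftrightarrow> inv_convex K \<and> (\<forall>L. inv_convex L \<and> L \<subseteq> K \<longrightarrow> L = K)"

lemma ex_minimal:
  assumes "topspace X \<noteq> {}"
  shows "\<exists>K. minimal K"
proof -
  have "\<exists>M\<in>Collect inv_convex. \<forall>K\<in>Collect inv_convex. K \<subseteq> M \<longrightarrow> K = M"
  proof (rule Zorn_minimal)
    have "inv_convex (topspace X)"
      using assms act_closed by (auto simp: inv_convex_def btw_convex_def invariant_def separates_def)
    then show "Collect inv_convex \<noteq> {}" by blast
    fix \<C> assume C: "\<C> \<noteq> {}" "subset.chain (Collect inv_convex) \<C>"
    then have *: "inv_convex K" if "K \<in> \<C>" for K using that by (auto simp: subset_chain_def)
    have "\<Inter>\<C> \<noteq> {}"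
      by (rule compact_space_chain_Inter[OF compact C]) (use * in \<open>simp add: inv_convex_def\<close>)
    moreover have "closedin X (\<Inter>\<C>)"
      using * C(1) by (intro closedin_Inter) (auto simp: inv_convex_def)
    moreover have "btw_convex (\<Inter>\<C>)"
      by (rule btw_convex_Inter) (use * in \<open>simp add: inv_convex_def\<close>)
    moreover have "invariant (\<Inter>\<C>)"
      unfolding invariant_def
    proof (intro ballI InterI)
      fix g x K assume "g \<in> carrier G" "x \<in> \<Inter>\<C>" "K \<in> \<C>"
      then show "act g x \<in> K" using *[of K] by (simp add: inv_convex_def invariant_def)
    qed
    ultimately show "\<Inter>\<C> \<in> Collect inv_convex" by (simp add: inv_convex_def)
  qed
  then show ?thesis unfolding minimal_def by blast
qed

lemma minimal_subset: "minimal K \<Longrightarrow> K \<subseteq> topspace X"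
  unfolding minimal_def inv_convex_def using closedin_subset by blast

lemma minimal_act: "minimal K \<Longrightarrow> g \<in> carrier G \<Longrightarrow> x \<in> K \<Longrightarrow> act g x \<in> K"
  unfolding minimal_def inv_convex_def invariant_def by simp

lemma minimal_separates: "minimal K \<Longrightarrow> x \<in> K \<Longrightarrow> y \<in> K \<Longrightarrow> separates z x y \<Longrightarrow> z \<in> K"
  unfolding minimal_def inv_convex_def using btw_convexD[of K x y z] by simp

text \<open>Otherwise the points whose orbit avoids the component would form a smaller invariant convex set: the complement of a
component is closed and connected.\<close>

lemma minimal_orbit_meets:
  assumes K: "minimal K" and y: "y \<in> K" and b: "b \<in> topspace X" and c: "c \<in> K" "c \<in> comp b x"
  shows "\<exists>g\<in>carrier G. act g y \<in> comp b x"
proof (rule ccontr)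
  assume no: "\<not> ?thesis"
  define L where "L = {z \<in> K. \<forall>g\<in>carrier G. act g z \<notin> comp b x}"
  have KX: "K \<subseteq> topspace X" using K by (rule minimal_subset)
  have "y \<in> L" using y no by (auto simp: L_def)
  moreover have "closedin X L"
  proof -
    have "closedin X {z \<in> topspace X. act g z \<in> topspace X - comp b x}" if "g \<in> carrier G" for g
      using homeo[OF that] openin_comp[of b x]
      by (intro closedin_continuous_map_preimage[of X X]) (auto simp: homeomorphic_imp_continuous_map)
    then have "closedin X (K \<inter> (\<Inter>g\<in>carrier G. {z \<in> topspace X. act g z \<in> topspace X - comp b x}))"
      using K group.is_monoid[OF group_G] monoid.one_closed
      by (intro closedin_Int closedin_Inter) (auto simp: minimal_def inv_convex_def)
    moreover have "K \<inter> (\<Inter>g\<in>carrier G. {z \<in> topspace X. act g z \<in> topspace X - comp b x}) = L"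
      using KX act_closed by (auto simp: L_def)
    ultimately show ?thesis by simp
  qed
  moreover have "btw_convex L"
  proof (rule btw_convexI)
    fix u v z assume uv: "u \<in> L" "v \<in> L" and z: "separates z u v"
    then have "z \<in> K" using minimal_separates[OF K] by (auto simp: L_def)
    moreover have "act g z \<notin> comp b x" if g: "g \<in> carrier G" for g
    proof
      assume "act g z \<in> comp b x"
      then have "\<not> separates (act g z) (act g u) (act g v)"
        using uv g KX act_closed
        by (intro not_separates_connectedin[OF connectedin_compl_comp[OF b, of x]]) (auto simp: L_def)
      then show False using separates_act[OF g z] by simp
    qed
    ultimately show "z \<in> L" by (simp add: L_def)
  qed
  moreover have "invariant L"
    unfolding invariant_def
  proof (intro ballI)
    fix g z assume g: "g \<in> carrier G" and z: "z \<in> L"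
    then have "z \<in> topspace X" using KX by (auto simp: L_def)
    then have "act h (act g z) \<notin> comp b x" if "h \<in> carrier G" for h
      using z act_mult[OF that g] mult_closed[OF that g] by (auto simp: L_def)
    then show "act g z \<in> L" using minimal_act[OF K g] z by (auto simp: L_def)
  qed
  ultimately have "inv_convex L" unfolding inv_convex_def by blast
  then have "L = K" using K unfolding minimal_def L_def by blast
  then have "act \<one>\<^bsub>G\<^esub> c \<notin> comp b x"
    using c(1) monoid.one_closed[OF group.is_monoid[OF group_G]] unfolding L_def by blast
  then show False using c KX act_one[of c] by auto
qed

end

section \<open>Ping-pong at a branch point of a minimal set\<close>

text \<open>The combinatorics of the components between which group elements move a point \<open>b\<close>. Let \<open>R i j\<close> mean
that some group element moves \<open>b\<close> into \<open>j\<close> while its inverse moves \<open>b\<close> into \<open>i\<close>. Composition of group elements composes such pairs as long as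
there is no backtracking, that is, as long as \<open>i \<noteq> l\<close> in the second assumption. The first alternative yields two
independent elements. The second one is what happens when the group fixes an end in the direction \<open>i\<close>.\<close>

lemma fold_or_star:
  assumes sym: "\<And>i j. R i j \<Longrightarrow> R j i"
    and comp: "\<And>i j k l. R i j \<Longrightarrow> R k l \<Longrightarrow> i \<noteq> l \<Longrightarrow> R k j"
    and tot: "\<And>j. j \<in> M \<Longrightarrow> \<exists>m. R m j"
    and abc: "a \<in> M" "b \<in> M" "c \<in> M" "a \<noteq> b" "a \<noteq> c" "b \<noteq> c"
  shows "(\<exists>i j k. i \<noteq> j \<and> i \<noteq> k \<and> j \<noteq> k \<and> R i j \<and> R k k) \<or> (\<exists>i. \<forall>x y. R x y \<longrightarrow> x = i \<or> y = i)"
proof (rule ccontr)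
  assume neg: "\<not> ?thesis"
  then have N: "\<And>i j k. R i j \<Longrightarrow> R k k \<Longrightarrow> i \<noteq> j \<Longrightarrow> i \<noteq> k \<Longrightarrow> j \<noteq> k \<Longrightarrow> False"
    and NS: "\<And>i. \<exists>x y. R x y \<and> x \<noteq> i \<and> y \<noteq> i" by metis+
  have "\<exists>i j. R i j \<and> i \<noteq> j"
  proof (rule ccontr)
    assume "\<not> ?thesis"
    then have d: "R a a" "R b b" using tot abc by metis+
    then show False using comp[OF d] \<open>a \<noteq> b\<close> \<open>\<not> (\<exists>i j. R i j \<and> i \<noteq> j)\<close> by metis
  qed
  then obtain i j where ij: "R i j" "i \<noteq> j" by blast
  have "\<exists>k\<in>M. k \<noteq> i \<and> k \<noteq> j" using abc by metis
  then obtain k where k: "k \<in> M" "k \<noteq> i" "k \<noteq> j" by blast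
  obtain m where m: "R m k" using tot k(1) by blast
  have "m = i \<or> m = j"
  proof (rule ccontr)
    assume mm: "\<not> ?thesis"
    have "m \<noteq> k" using N[of i j k] ij k m by metis
    have kj: "R k j" using comp[OF ij(1) sym[OF m]] mm by metis
    have "R k k" using comp[OF m kj] mm by metis
    then show False using N[of i j k] ij k by metis
  qed
  then obtain i j k where ijk: "R i j" "R i k" "i \<noteq> j" "i \<noteq> k" "j \<noteq> k"
    using ij k m sym by metis
  obtain x y where xy: "R x y" "x \<noteq> i" "y \<noteq> i" using NS by blast
  have fold: False if x: "R x x" "x \<noteq> i" for x
  proof (cases "x = j")
    case True
    then show False using N[of i k x] ijk x by metis
  next
    case False
    then show False using N[of i j x] ijk x by metis
  qed
  have ix: "R i x"
  proof (cases "y = j")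
    case True
    then show ?thesis using comp[OF sym[OF xy(1)] ijk(2)] ijk by metis
  next
    case False
    then show ?thesis using comp[OF sym[OF xy(1)] ijk(1)] by metis
  qed
  have "R x x" using comp[OF ix xy(1)] xy by metis
  then show False using fold xy by metis
qed

context cut_action
begin

text \<open>The element \<open>g\<close> pushes \<open>b\<close> out of the source component \<open>C\<close>, which contains its preimage, and into the target component
\<open>C'\<close>.\<close>

definition moves :: "'x \<Rightarrow> 'g \<Rightarrow> 'x set \<Rightarrow> 'x set \<Rightarrow> bool" where
  "moves b g C C' \<longleftrightarrow> g \<in> carrier G \<and> act g b \<noteq> b \<and> comp b (act (inv\<^bsub>G\<^esub> g) b) = C \<and> comp b (act g b) = C'"

text \<open>Everything outside the source follows \<open>b\<close>: the image of \<open>C\<close> is the component at \<open>g b\<close> that contains \<open>b\<close>, and the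
complement of that component is contained in a component at \<open>b\<close>.\<close>

lemma moves_act:
  assumes m: "moves b g C C'" and b: "b \<in> topspace X" and x: "x \<in> topspace X" "x \<notin> C"
  shows "act g x \<in> C'"
proof -
  have g: "g \<in> carrier G" "act g b \<noteq> b" using m by (simp_all add: moves_def)
  have ib: "act (inv\<^bsub>G\<^esub> g) b \<in> topspace X" using act_closed inv_closed g b by simp
  have "act g ` C = comp (act g b) b"
    using m act_comp[OF g(1) ib b] act_inv'[OF g(1) b] by (simp add: moves_def)
  moreover have "act g x \<notin> act g ` C"
  proof
    assume "act g x \<in> act g ` C"
    then obtain y where y: "y \<in> C" "act g x = act g y" by blast
    then have "y \<in> topspace X" using m cut_comp_subset[of X b] by (auto simp: moves_def)
    then show False using act_inj[OF g(1) x(1)] x(2) y by metis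
  qed
  ultimately have "act g x \<in> topspace X - comp (act g b) b" using act_closed[OF g(1) x(1)] by simp
  then show ?thesis
    using compl_comp_subset[OF act_closed[OF g(1) b] b g(2)] m by (auto simp: moves_def)
qed

lemma moves_inv:
  assumes m: "moves b g C C'" and b: "b \<in> topspace X"
  shows "moves b (inv\<^bsub>G\<^esub> g) C' C"
proof -
  have g: "g \<in> carrier G" "act g b \<noteq> b" using m by (simp_all add: moves_def)
  then have "act (inv\<^bsub>G\<^esub> g) b \<noteq> b" using act_inv' b by metis
  then show ?thesis using m g group.inv_inv[OF group_G g(1)] inv_closed by (simp add: moves_def)
qed

lemma moves_comp: "moves b g C C' \<Longrightarrow> \<exists>x. C = comp b x" "moves b g C C' \<Longrightarrow> \<exists>x. C' = comp b x"
  unfolding moves_def by blast+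

lemma comp_disjoint: "x \<in> comp b y \<Longrightarrow> x \<in> comp b z \<Longrightarrow> comp b y = comp b z"
  using cut_comp_eq by metis

lemma moves_mult:
  assumes g: "moves b g i j" and h: "moves b h k l" and il: "i \<noteq> l" and b: "b \<in> topspace X"
  shows "moves b (g \<otimes>\<^bsub>G\<^esub> h) k j"
proof -
  have G: "g \<in> carrier G" "h \<in> carrier G" using g h by (simp_all add: moves_def)
  have i: "act (inv\<^bsub>G\<^esub> g) b \<in> i" "act h b \<in> l"
    using moves_act[OF moves_inv[OF g b] b b] moves_act[OF h b b] g h cut_comp_subset[of X b]
    by (auto simp: moves_def)
  have "act h b \<notin> i" "act (inv\<^bsub>G\<^esub> g) b \<notin> l"
    using i il comp_disjoint moves_comp[OF g] moves_comp[OF h] by metis+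
  then have 1: "act (g \<otimes>\<^bsub>G\<^esub> h) b \<in> j" and 2: "act (inv\<^bsub>G\<^esub> (g \<otimes>\<^bsub>G\<^esub> h)) b \<in> k"
    using moves_act[OF g b act_closed[OF G(2) b]]
      moves_act[OF moves_inv[OF h b] b act_closed[OF inv_closed[OF G(1)] b]]
      act_mult[OF G b] act_mult[OF inv_closed[OF G(2)] inv_closed[OF G(1)] b]
      group.inv_mult_group[OF group_G G] by simp_all
  have "comp b (act (g \<otimes>\<^bsub>G\<^esub> h) b) = j" "comp b (act (inv\<^bsub>G\<^esub> (g \<otimes>\<^bsub>G\<^esub> h)) b) = k"
    using 1 2 cut_comp_eq moves_comp[OF g] moves_comp[OF h] by metis+
  moreover have "act (g \<otimes>\<^bsub>G\<^esub> h) b \<noteq> b"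
    using 1 cut_comp_subset[of X b] moves_comp[OF g] by blast
  ultimately show ?thesis using mult_closed[OF G] by (simp add: moves_def)
qed

text \<open>Suppose that the component \<open>C\<close> of \<open>x0\<close> is the source or the target of every element that moves \<open>b\<close>. The translates
\<open>g ({b} \<union> C)\<close> then point in a common direction: of any two of them, one contains the apex of the other, so that finitely many of them always
share one of their apices. By compactness their intersection meets \<open>K\<close>, and minimality forces \<open>K\<close> into it.\<close>

lemma star_confines_minimal_set:
  assumes K: "minimal K" and b: "b \<in> K" and x0: "x0 \<in> topspace X" "x0 \<noteq> b"
    and star: "\<And>g C C'. moves b g C C' \<Longrightarrow> C = comp b x0 \<or> C' = comp b x0"
  shows "K \<subseteq> insert b (comp b x0)"
proof -
  have KX: "K \<subseteq> topspace X" using K by (rule minimal_subset)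
  then have bX: "b \<in> topspace X" using b by blast
  define D where "D g = insert (act g b) (comp (act g b) (act g x0))" for g
  have D_conn: "connectedin X (D g)" if "g \<in> carrier G" for g
    unfolding D_def using that x0 bX by (intro connectedin_insert_comp) (simp_all add: act_closed act_inj)
  have D_closed: "closedin X (D g)" if "g \<in> carrier G" for g
    unfolding D_def using that bX by (intro closedin_insert_comp) (simp add: act_closed)
  have D_act: "act g y \<in> D (g \<otimes>\<^bsub>G\<^esub> h)" if "g \<in> carrier G" "h \<in> carrier G" "y \<in> D h" for g h y
  proof -
    have "act g ` D h = D (g \<otimes>\<^bsub>G\<^esub> h)"
      unfolding D_def using that(1,2) bX x0 by (simp add: act_mult act_comp act_closed)
    then show ?thesis using that(3) by blast
  qed
  have D_self: "act g b \<in> D g" for g by (simp add: D_def)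
  have D_pair: "act g' b \<in> D g \<or> act g b \<in> D g'" if g: "g \<in> carrier G" "g' \<in> carrier G" for g g'
  proof -
    define h where "h = inv\<^bsub>G\<^esub> g \<otimes>\<^bsub>G\<^esub> g'"
    have h: "h \<in> carrier G" unfolding h_def using g mult_closed inv_closed by simp
    have gh: "g \<otimes>\<^bsub>G\<^esub> h = g'" and g'h: "g' \<otimes>\<^bsub>G\<^esub> inv\<^bsub>G\<^esub> h = g"
      using g group_G by (simp_all add: h_def group.inv_solve_left group.inv_mult_group group.inv_inv
          group.is_monoid monoid.m_assoc[symmetric] group.r_inv monoid.l_one)
    have ghb: "act g (act h b) = act g' b" "act g' (act (inv\<^bsub>G\<^esub> h) b) = act g b"
      using gh g'h act_mult[OF g(1) h bX] act_mult[OF g(2) inv_closed[OF h] bX] by simp_all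
    show ?thesis
    proof (cases "act h b = b")
      case True
      then show ?thesis using ghb D_self[of g] by simp
    next
      case False
      then have "moves b h (comp b (act (inv\<^bsub>G\<^esub> h) b)) (comp b (act h b))"
        using h by (simp add: moves_def)
      from star[OF this] show ?thesis
      proof
        assume *: "comp b (act (inv\<^bsub>G\<^esub> h) b) = comp b x0"
        have "act (inv\<^bsub>G\<^esub> h) b \<noteq> b" using False act_inv'[OF h bX] by metis
        then have "act (inv\<^bsub>G\<^esub> h) b \<in> comp b x0"
          using in_cut_comp[OF act_closed[OF inv_closed[OF h] bX]] * by metis
        then have "act g' (act (inv\<^bsub>G\<^esub> h) b) \<in> act g' ` comp b x0" by blast
        then show ?thesis using ghb act_comp[OF g(2) x0(1) bX] by (simp add: D_def)
      next
        assume *: "comp b (act h b) = comp b x0"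
        then have "act h b \<in> comp b x0"
          using in_cut_comp[OF act_closed[OF h bX]] False by metis
        then have "act g (act h b) \<in> act g ` comp b x0" by blast
        then show ?thesis using ghb act_comp[OF g(1) x0(1) bX] by (simp add: D_def)
      qed
    qed
  qed
  have fin: "\<exists>g\<in>F. \<forall>h\<in>F. act g b \<in> D h" if "finite F" "F \<noteq> {}" "F \<subseteq> carrier G" for F
    using that
  proof (induction F rule: finite_ne_induct)
    case (singleton n)
    then show ?case using D_self by simp
  next
    case (insert n F)
    then obtain g where g: "g \<in> F" "\<And>h. h \<in> F \<Longrightarrow> act g b \<in> D h" by auto
    show ?case
    proof (cases "\<forall>h\<in>F. act n b \<in> D h")
      case True
      then show ?thesis using D_self by simp
    next
      case False
      then obtain k where k: "k \<in> F" "act n b \<notin> D k" by blast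
      have G: "k \<in> carrier G" "n \<in> carrier G" using k insert.prems by auto
      have ne: "act k b \<noteq> act n b" using k(2) D_self by metis
      have "act k b \<in> D n" using D_pair[OF G] k(2) by blast
      then have kn: "act k b \<in> comp (act n b) (act n x0)" using ne by (simp add: D_def)
      \<comment> \<open>the set of \<open>k\<close> avoids the new apex, so it is contained in the new set\<close>
      have "D k \<subseteq> comp (act n b) (act k b)"
        by (rule cut_comp_maximal[OF D_conn[OF G(1)] D_self k(2)])
      then have "D k \<subseteq> D n" using cut_comp_eq[OF kn] by (auto simp: D_def)
      then have "act g b \<in> D n" using g(2)[OF k(1)] by blast
      then show ?thesis using g by auto
    qed
  qed
  define Y where "Y = \<Inter>((\<lambda>g. K \<inter> D g) ` carrier G)"
  have one: "\<one>\<^bsub>G\<^esub> \<in> carrier G" using monoid.one_closed[OF group.is_monoid[OF group_G]] .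
  have Kc: "closedin X K" "btw_convex K" using K by (simp_all add: minimal_def inv_convex_def)
  have cl: "\<forall>C\<in>(\<lambda>g. K \<inter> D g) ` carrier G. closedin X C"
    using D_closed Kc(1) by (simp add: closedin_Int)
  have "Y \<noteq> {}"
    unfolding Y_def
  proof (rule compact[unfolded compact_space_fip, THEN spec, THEN mp], intro conjI allI impI)
    fix F assume "finite F \<and> F \<subseteq> (\<lambda>g. K \<inter> D g) ` carrier G"
    then obtain H where H: "finite H" "H \<subseteq> carrier G" "F = (\<lambda>g. K \<inter> D g) ` H"
      using finite_subset_image by metis
    show "\<Inter>F \<noteq> {}"
    proof (cases "H = {}")
      case True
      then show ?thesis using H(3) by simp
    next
      case False
      then obtain g where g: "g \<in> H" "\<forall>h\<in>H. act g b \<in> D h" using fin H by metis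
      then have "act g b \<in> \<Inter>F" using H minimal_act[OF K _ b] by auto
      then show ?thesis by blast
    qed
  qed (rule cl)
  moreover have "closedin X Y"
    unfolding Y_def using one cl by (intro closedin_Inter) auto
  moreover have "btw_convex Y"
    unfolding Y_def
  proof (rule btw_convex_Inter)
    fix C assume "C \<in> (\<lambda>g. K \<inter> D g) ` carrier G"
    then obtain g where g: "g \<in> carrier G" "C = K \<inter> D g" by blast
    show "btw_convex C"
    proof (rule btw_convexI)
      fix x y z assume xyz: "x \<in> C" "y \<in> C" "separates z x y"
      show "z \<in> C"
        using btw_convexD[OF Kc(2) _ _ xyz(3)] xyz(1,2)
          btw_convexD[OF connectedin_imp_btw_convex[OF D_conn[OF g(1)]] _ _ xyz(3)] g(2) by simp
    qed
  qed
  moreover have "invariant Y"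
    unfolding invariant_def Y_def
  proof (intro ballI InterI)
    fix g y C assume g: "g \<in> carrier G" and y: "y \<in> \<Inter> ((\<lambda>g. K \<inter> D g) ` carrier G)"
      and "C \<in> (\<lambda>g. K \<inter> D g) ` carrier G"
    then obtain h where h: "h \<in> carrier G" "C = K \<inter> D h" by blast
    have k: "inv\<^bsub>G\<^esub> g \<otimes>\<^bsub>G\<^esub> h \<in> carrier G" using g h mult_closed inv_closed by simp
    then have "y \<in> K \<inter> D (inv\<^bsub>G\<^esub> g \<otimes>\<^bsub>G\<^esub> h)" using y by (meson InterE imageI)
    then have y: "y \<in> K" "y \<in> D (inv\<^bsub>G\<^esub> g \<otimes>\<^bsub>G\<^esub> h)" by simp_all
    have "g \<otimes>\<^bsub>G\<^esub> (inv\<^bsub>G\<^esub> g \<otimes>\<^bsub>G\<^esub> h) = h"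
      using g h group_G inv_closed
      by (simp add: group.is_monoid monoid.m_assoc[symmetric] group.r_inv monoid.l_one)
    then have "act g y \<in> D h" using D_act[OF g k y(2)] by simp
    then show "act g y \<in> C" using h(2) minimal_act[OF K g y(1)] by simp
  qed
  ultimately have "inv_convex Y" by (simp add: inv_convex_def)
  moreover have "Y \<subseteq> K" unfolding Y_def using one by auto
  ultimately have "Y = K" using K by (simp add: minimal_def)
  moreover have "Y \<subseteq> D \<one>\<^bsub>G\<^esub>" unfolding Y_def using one by auto
  ultimately show ?thesis using bX x0 by (simp add: D_def act_one)
qed

definition plays_ping_pong :: "'x \<Rightarrow> 'x \<Rightarrow> 'x \<Rightarrow> 'x \<Rightarrow> 'g \<Rightarrow> 'g \<Rightarrow> 'x set \<Rightarrow> 'x set \<Rightarrow> bool" where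
  "plays_ping_pong b c1 c2 c3 P Q D D' \<longleftrightarrow> b \<in> topspace X \<and> {c1, c2, c3} \<subseteq> topspace X - {b} \<and>
     comp b c1 \<noteq> comp b c2 \<and> comp b c1 \<noteq> comp b c3 \<and> comp b c2 \<noteq> comp b c3 \<and>
     P \<in> carrier G \<and> Q \<in> carrier G \<and> (\<forall>x\<in>topspace X - comp b c1. act P x \<in> comp b c3) \<and>
     (\<forall>x\<in>topspace X - D. act Q x \<in> D') \<and> D \<subseteq> comp b c2 \<and> D' \<subseteq> comp b c2 \<and> D \<inter> D' = {}"

text \<open>In the first case of \<open>fold_or_star\<close>, \<open>P\<close> moves \<open>b\<close> from \<open>C1\<close> to \<open>C3\<close> and \<open>t\<close> folds the complement of
\<open>C2\<close> into \<open>C2\<close>; then \<open>Q\<close> is the conjugate of \<open>P\<close> by \<open>t\<close>, and \<open>D\<close>, \<open>D'\<close> are the images of \<open>C1\<close>, \<open>C3\<close> under \<open>t\<close>. The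
second case is excluded, as \<open>K\<close> meets more than one component.\<close>

theorem ping_pong:
  assumes K: "minimal K" and b: "b \<in> K" and x: "x1 \<in> K - {b}" "x2 \<in> K - {b}" "x3 \<in> K - {b}"
    and ne: "comp b x1 \<noteq> comp b x2" "comp b x1 \<noteq> comp b x3" "comp b x2 \<noteq> comp b x3"
  obtains c1 c2 c3 P Q D D' where "plays_ping_pong b c1 c2 c3 P Q D D'"
proof -
  have KX: "K \<subseteq> topspace X" using K by (rule minimal_subset)
  then have bX: "b \<in> topspace X" using b by blast
  define R where "R C C' \<longleftrightarrow> (\<exists>g. moves b g C C')" for C C'
  define M where "M = comp b ` (K - {b})"
  have "(\<exists>i j k. i \<noteq> j \<and> i \<noteq> k \<and> j \<noteq> k \<and> R i j \<and> R k k) \<or> (\<exists>i. \<forall>x y. R x y \<longrightarrow> x = i \<or> y = i)"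
  proof (rule fold_or_star[where M=M])
    show "R i j \<Longrightarrow> R j i" for i j unfolding R_def using moves_inv[OF _ bX] by blast
    show "R i j \<Longrightarrow> R k l \<Longrightarrow> i \<noteq> l \<Longrightarrow> R k j" for i j k l
      unfolding R_def using moves_mult[OF _ _ _ bX] by blast
    show "comp b x1 \<in> M" "comp b x2 \<in> M" "comp b x3 \<in> M" using x by (simp_all add: M_def)
    fix j assume "j \<in> M"
    then obtain y where y: "y \<in> K" "y \<noteq> b" "j = comp b y" by (auto simp: M_def)
    then obtain g where g: "g \<in> carrier G" "act g b \<in> comp b y"
      using minimal_orbit_meets[OF K b bX y(1), of y] in_cut_comp[of y X b] KX by blast
    then have "moves b g (comp b (act (inv\<^bsub>G\<^esub> g) b)) j"
      using y(3) cut_comp_eq[OF g(2)] cut_comp_subset[of X b y] by (auto simp: moves_def)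
    then show "\<exists>m. R m j" unfolding R_def by blast
  qed (use ne in auto)
  then show thesis
  proof
    assume "\<exists>i. \<forall>x y. R x y \<longrightarrow> x = i \<or> y = i"
    then obtain i where i: "\<And>g C C'. moves b g C C' \<Longrightarrow> C = i \<or> C' = i" unfolding R_def by blast
    have *: False if "x \<in> K - {b}" "y \<in> K - {b}" "comp b x \<noteq> comp b y" "i = comp b x" for x y
    proof -
      have "K \<subseteq> insert b (comp b x)"
        by (rule star_confines_minimal_set[OF K b]) (use that i KX in auto)
      then have "y \<in> comp b x" using that by blast
      then show False using that cut_comp_eq by metis
    qed
    obtain g where g: "g \<in> carrier G" "act g b \<in> comp b x1"
      using minimal_orbit_meets[OF K b bX, of x1 x1] in_cut_comp[of x1 X b] x KX by blast
    have gb: "act g b \<noteq> b" using g cut_comp_subset[of X b x1] by auto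
    then have gib: "act (inv\<^bsub>G\<^esub> g) b \<noteq> b" using act_inv'[OF g(1) bX] by metis
    have "moves b g (comp b (act (inv\<^bsub>G\<^esub> g) b)) (comp b (act g b))"
      using g gb by (simp add: moves_def)
    from i[OF this] obtain y where y: "y \<in> K - {b}" "i = comp b y"
      using gb gib minimal_act[OF K g(1) b] minimal_act[OF K inv_closed[OF g(1)] b] by blast
    show thesis using *[OF y(1) x(1)] *[OF y(1) x(2)] y(2) ne(1) by metis
  next
    assume "\<exists>i j k. i \<noteq> j \<and> i \<noteq> k \<and> j \<noteq> k \<and> R i j \<and> R k k"
    then obtain C1 C2 C3 P t where C: "C1 \<noteq> C3" "C1 \<noteq> C2" "C3 \<noteq> C2"
      and P: "moves b P C1 C3" and t: "moves b t C2 C2"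
      unfolding R_def by blast
    have G: "P \<in> carrier G" "t \<in> carrier G" "inv\<^bsub>G\<^esub> t \<in> carrier G"
      using P t inv_closed by (simp_all add: moves_def)
    define c1 where "c1 = act (inv\<^bsub>G\<^esub> P) b"
    define c2 where "c2 = act t b"
    define c3 where "c3 = act P b"
    have ccomp: "comp b c1 = C1" "comp b c2 = C2" "comp b c3 = C3"
      using P t by (simp_all add: moves_def c1_def c2_def c3_def)
    have cX: "c1 \<in> topspace X - {b}" "c2 \<in> topspace X - {b}" "c3 \<in> topspace X - {b}"
      using P t moves_inv[OF P bX] act_closed[OF _ bX] by (auto simp: moves_def c1_def c2_def c3_def)
    have CX: "C1 \<subseteq> topspace X" "C2 \<subseteq> topspace X" "C3 \<subseteq> topspace X"
      using cut_comp_subset[of X b] ccomp by blast+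
    have disj: "C1 \<inter> C3 = {}" "C1 \<inter> C2 = {}" "C3 \<inter> C2 = {}"
      using C ccomp comp_disjoint by blast+
    have P': "act P x \<in> C3" if "x \<in> topspace X - C1" for x
      using moves_act[OF P bX] that by blast
    have t': "act t x \<in> C2" if "x \<in> topspace X - C2" for x
      using moves_act[OF t bX] that by blast
    have "plays_ping_pong b c1 c2 c3 P (t \<otimes>\<^bsub>G\<^esub> (P \<otimes>\<^bsub>G\<^esub> inv\<^bsub>G\<^esub> t)) (act t ` C1) (act t ` C3)"
      unfolding plays_ping_pong_def ccomp
    proof (intro conjI ballI)
      show "t \<otimes>\<^bsub>G\<^esub> (P \<otimes>\<^bsub>G\<^esub> inv\<^bsub>G\<^esub> t) \<in> carrier G" using G mult_closed by simp
      show "act t ` C1 \<subseteq> C2" "act t ` C3 \<subseteq> C2" using t' disj CX by blast+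
      show "act t ` C1 \<inter> act t ` C3 = {}"
      proof -
        have "act t ` C1 \<inter> act t ` C3 = act t ` (C1 \<inter> C3)"
          using inj_on_image_Int[OF inj_prop[OF G(2)] CX(1,3)] by simp
        then show ?thesis using disj by simp
      qed
      fix x assume x: "x \<in> topspace X - act t ` C1"
      define y where "y = act (inv\<^bsub>G\<^esub> t) x"
      have y: "y \<in> topspace X" "act t y = x" using x act_closed[OF G(3)] act_inv'[OF G(2)] by (simp_all add: y_def)
      then have "y \<notin> C1" using x by blast
      then have "act P y \<in> C3" using P' y by blast
      moreover have "act (t \<otimes>\<^bsub>G\<^esub> (P \<otimes>\<^bsub>G\<^esub> inv\<^bsub>G\<^esub> t)) x = act t (act P y)"
        using x G mult_closed by (simp add: act_mult y_def act_closed)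
      ultimately show "act (t \<otimes>\<^bsub>G\<^esub> (P \<otimes>\<^bsub>G\<^esub> inv\<^bsub>G\<^esub> t)) x \<in> act t ` C3" by simp
    qed (use bX cX C G P' in auto)
    then show thesis by (rule that)
  qed
qed

end

section \<open>Branch points of a minimal set\<close>

context cut_action
begin

lemma few_points_elementary:
  assumes S: "S \<subseteq> topspace X" "S \<noteq> {}" and inv: "invariant S"
    and few: "\<And>x y z. x \<in> S \<Longrightarrow> y \<in> S \<Longrightarrow> z \<in> S \<Longrightarrow> x = y \<or> x = z \<or> y = z"
  shows "(\<exists>x\<in>topspace X. \<forall>g\<in>carrier G. act g x = x) \<or>
     (\<exists>x\<in>topspace X. \<exists>y\<in>topspace X. x \<noteq> y \<and> (\<forall>g\<in>carrier G. act g ` {x, y} = {x, y}))"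
proof -
  have mem: "act g x \<in> S" if "g \<in> carrier G" "x \<in> S" for g x
    using inv that by (simp add: invariant_def)
  obtain x where x: "x \<in> S" using S(2) by blast
  show ?thesis
  proof (cases "S = {x}")
    case True
    then have "act g x = x" if "g \<in> carrier G" for g using mem[OF that x] by simp
    then show ?thesis using x S(1) by blast
  next
    case False
    then obtain y where y: "y \<in> S" "x \<noteq> y" using x by blast
    then have Sxy: "S = {x, y}" using few[OF x y(1)] x by blast
    have "act g ` {x, y} = {x, y}" if g: "g \<in> carrier G" for g
    proof -
      have "act g x \<noteq> act g y" using act_inj[OF g, of x y] x y S(1) by blast
      then show ?thesis using mem[OF g x] mem[OF g y(1)] unfolding Sxy by auto
    qed
    then show ?thesis using x y S(1) by blast
  qed
qed

text \<open>The end points of \<open>K\<close>: removing one of them does not separate \<open>K\<close>.\<close>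

definition extreme :: "'x set \<Rightarrow> 'x set" where
  "extreme K = {e \<in> K. \<forall>x\<in>K - {e}. \<forall>y\<in>K - {e}. comp e x = comp e y}"

text \<open>Seen from \<open>a\<close>, the set \<open>B e\<close> consists of the points of \<open>K\<close> behind \<open>e\<close>, together with \<open>e\<close>. A minimal closed set that
contains \<open>B e\<close> for each of its points \<open>e\<close> is a single point, and nothing lies behind that point.\<close>

lemma extreme_nonempty:
  assumes K: "closedin X K" and a: "a \<in> K" "K \<noteq> {a}"
  shows "extreme K \<noteq> {}"
proof -
  have KX: "K \<subseteq> topspace X" using K closedin_subset by blast
  define B where "B e = K - comp e a" for e
  define \<F> where "\<F> = {F. closedin X F \<and> F \<subseteq> K - {a} \<and> F \<noteq> {} \<and> (\<forall>e\<in>F. B e \<subseteq> F)}"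
  have mono: "comp e a \<subseteq> comp e' a" if "e \<in> K" "e \<noteq> a" "e' \<in> B e" for e e'
  proof (cases "e' = e")
    case False
    show ?thesis
      by (rule cut_comp_maximal[OF connectedin_cut_comp])
        (use that in_cut_comp[of a X e] a KX in \<open>auto simp: B_def\<close>)
  qed simp
  have B_in: "B e \<in> \<F>" if e: "e \<in> K" "e \<noteq> a" for e
  proof -
    have "closedin X (B e)" unfolding B_def using K openin_comp by (rule closedin_diff)
    moreover have "a \<in> comp e a" using in_cut_comp[of a X e] a KX e by blast
    moreover have "e \<in> B e" using e cut_comp_subset[of X e a] by (auto simp: B_def)
    moreover have "B e' \<subseteq> B e" if "e' \<in> B e" for e' using mono[OF e that] by (auto simp: B_def)
    ultimately show ?thesis by (auto simp: \<F>_def B_def)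
  qed
  have "\<exists>M\<in>\<F>. \<forall>F\<in>\<F>. F \<subseteq> M \<longrightarrow> F = M"
  proof (rule Zorn_minimal)
    show "\<F> \<noteq> {}" using B_in a by blast
    fix \<C> assume C: "\<C> \<noteq> {}" "subset.chain \<F> \<C>"
    then have *: "F \<in> \<F>" if "F \<in> \<C>" for F using that by (auto simp: subset_chain_def)
    have "\<Inter>\<C> \<noteq> {}"
      by (rule compact_space_chain_Inter[OF compact C]) (use * in \<open>simp add: \<F>_def\<close>)
    moreover have "closedin X (\<Inter>\<C>)"
      using * C(1) by (intro closedin_Inter) (auto simp: \<F>_def)
    moreover have "\<Inter>\<C> \<subseteq> K - {a}" using * C(1) unfolding \<F>_def by blast
    moreover have "B e \<subseteq> \<Inter>\<C>" if "e \<in> \<Inter>\<C>" for e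
    proof (rule Inter_greatest)
      fix F assume "F \<in> \<C>"
      then show "B e \<subseteq> F" using *[of F] that by (simp add: \<F>_def)
    qed
    ultimately show "\<Inter>\<C> \<in> \<F>" by (simp add: \<F>_def)
  qed
  then obtain M where M: "M \<in> \<F>" and min: "\<And>F. F \<in> \<F> \<Longrightarrow> F \<subseteq> M \<Longrightarrow> F = M" by blast
  then have MB: "B e = M" if "e \<in> M" for e
    using that B_in[of e] by (simp add: \<F>_def subset_iff)
  obtain e where e: "e \<in> M" using M by (auto simp: \<F>_def)
  have eK: "e \<in> K" "e \<noteq> a" using M e by (auto simp: \<F>_def)
  have "M = {e}"
  proof (rule ccontr)
    assume "M \<noteq> {e}"
    then obtain e' where e': "e' \<in> M" "e' \<noteq> e" using e by blast
    have "insert e (comp e a) \<subseteq> comp e' a"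
    proof (rule cut_comp_maximal[OF connectedin_insert_comp])
      show "e' \<notin> insert e (comp e a)" using e' MB[OF e] by (auto simp: B_def)
      show "a \<in> insert e (comp e a)" using in_cut_comp[of a X e] a KX eK by blast
    qed (use eK a KX in auto)
    then have "e \<notin> B e'" by (auto simp: B_def)
    then show False using MB[OF e'(1)] e by simp
  qed
  then have "K - {e} \<subseteq> comp e a" using MB[OF e] by (auto simp: B_def)
  then have "comp e x = comp e a" if "x \<in> K - {e}" for x using cut_comp_eq[of x X e a] that by blast
  then have "e \<in> extreme K" using eK by (simp add: extreme_def)
  then show ?thesis by blast
qed

text \<open>The set of end points of \<open>K\<close> is invariant and non-empty, so it has at least three elements, as the action is
non-elementary. No end point separates the other two; hence they have a median, which is a branch point.\<close>

lemma ex_branching: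
  assumes K: "minimal K"
    and median: "\<And>x y z. x \<in> topspace X \<Longrightarrow> y \<in> topspace X \<Longrightarrow> z \<in> topspace X \<Longrightarrow> x \<noteq> y \<Longrightarrow> x \<noteq> z \<Longrightarrow> y \<noteq> z \<Longrightarrow>
      separates x y z \<or> separates y x z \<or> separates z x y \<or> (\<exists>m. separates m x y \<and> separates m x z \<and> separates m y z)"
    and nofix1: "\<not> (\<exists>x\<in>topspace X. \<forall>g\<in>carrier G. act g x = x)"
    and nofix2: "\<not> (\<exists>x\<in>topspace X. \<exists>y\<in>topspace X. x \<noteq> y \<and> (\<forall>g\<in>carrier G. act g ` {x, y} = {x, y}))"
  obtains b x1 x2 x3 where "b \<in> K" "x1 \<in> K - {b}" "x2 \<in> K - {b}" "x3 \<in> K - {b}"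
    "comp b x1 \<noteq> comp b x2" "comp b x1 \<noteq> comp b x3" "comp b x2 \<noteq> comp b x3"
proof -
  have KX: "K \<subseteq> topspace X" using K by (rule minimal_subset)
  have Kp: "closedin X K" "K \<noteq> {}" "invariant K" using K by (simp_all add: minimal_def inv_convex_def)
  have "\<exists>x y z. x \<in> extreme K \<and> y \<in> extreme K \<and> z \<in> extreme K \<and> x \<noteq> y \<and> x \<noteq> z \<and> y \<noteq> z"
  proof (rule ccontr)
    assume neg: "\<not> ?thesis"
    have "\<exists>S\<subseteq>topspace X. S \<noteq> {} \<and> invariant S \<and> (\<forall>x\<in>S. \<forall>y\<in>S. \<forall>z\<in>S. x = y \<or> x = z \<or> y = z)"
    proof (cases "\<exists>a. K = {a}")
      case True
      then show ?thesis using Kp KX by auto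
    next
      case False
      have inv: "invariant (extreme K)"
        unfolding invariant_def
      proof (intro ballI)
        fix g e assume g: "g \<in> carrier G" and e: "e \<in> extreme K"
        have eK: "e \<in> K" "e \<in> topspace X" using e KX by (auto simp: extreme_def)
        have "comp (act g e) x = comp (act g e) y" if xy: "x \<in> K - {act g e}" "y \<in> K - {act g e}" for x y
        proof -
          have pull: "act (inv\<^bsub>G\<^esub> g) u \<in> K - {e} \<and> act g (act (inv\<^bsub>G\<^esub> g) u) = u" if "u \<in> K - {act g e}" for u
          proof -
            have u: "u \<in> topspace X" "u \<in> K" "u \<noteq> act g e" using that KX by auto
            then show ?thesis using minimal_act[OF K inv_closed[OF g] u(2)] act_inv'[OF g u(1)] by auto
          qed
          have "comp e (act (inv\<^bsub>G\<^esub> g) x) = comp e (act (inv\<^bsub>G\<^esub> g) y)"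
            using e pull[OF xy(1)] pull[OF xy(2)] unfolding extreme_def by blast
          then show ?thesis
            using comp_act_eq[OF g _ _ eK(2), of "act (inv\<^bsub>G\<^esub> g) x" "act (inv\<^bsub>G\<^esub> g) y"]
              pull[OF xy(1)] pull[OF xy(2)] KX by auto
        qed
        then show "act g e \<in> extreme K" using minimal_act[OF K g eK(1)] unfolding extreme_def by blast
      qed
      obtain a where "a \<in> K" using Kp(2) by blast
      then have "extreme K \<noteq> {}" using extreme_nonempty[OF Kp(1)] False by blast
      moreover have "extreme K \<subseteq> topspace X" using KX by (auto simp: extreme_def)
      ultimately show ?thesis using inv neg by blast
    qed
    then obtain S where S: "S \<subseteq> topspace X" "S \<noteq> {}" "invariant S"
      and few: "\<forall>x\<in>S. \<forall>y\<in>S. \<forall>z\<in>S. x = y \<or> x = z \<or> y = z" by (elim exE conjE)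
    have few': "x = y \<or> x = z \<or> y = z" if "x \<in> S" "y \<in> S" "z \<in> S" for x y z
      by (rule few[THEN bspec, THEN bspec, THEN bspec]) (rule that)+
    show False using few_points_elementary[OF S few'] nofix1 nofix2 by simp
  qed
  then obtain x y z where e: "x \<in> extreme K" "y \<in> extreme K" "z \<in> extreme K"
    and ne: "x \<noteq> y" "x \<noteq> z" "y \<noteq> z" by blast
  have xK: "x \<in> K" "y \<in> K" "z \<in> K" using e by (auto simp: extreme_def)
  have no: "\<not> separates p q r" if "p \<in> extreme K" "q \<in> K" "r \<in> K" for p q r
    using that unfolding extreme_def separates_def by blast
  obtain m where m: "separates m x y" "separates m x z" "separates m y z"
    using median[of x y z] xK KX ne no[OF e(1)] no[OF e(2)] no[OF e(3)] by blast
  show thesis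
  proof (rule that[of m x y z])
    show "m \<in> K" by (rule minimal_separates[OF K xK(1,2) m(1)])
  qed (use m xK in \<open>auto simp: separates_def\<close>)
qed

end

section \<open>Paths in locally connected complete spaces\<close>

lemma small_connected_nhd:
  fixes S :: "'a::metric_space set"
  assumes S: "closed S" "locally_connected_space (top_of_set S)"
    and V: "openin (top_of_set S) V" and a: "a \<in> V" and e: "e > 0"
  obtains W where "openin (top_of_set S) W" "connected W" "closure W \<subseteq> V" "a \<in> W"
    "\<forall>x\<in>W. \<forall>y\<in>W. dist x y \<le> e"
proof -
  obtain T where T: "open T" "V = S \<inter> T" using V by (auto simp: openin_open)
  then obtain d where d: "d > 0" "cball a d \<subseteq> T" using a open_contains_cball by blast
  define d' where "d' = min d (e/2)"
  have "openin (top_of_set S) (S \<inter> ball a d')" by auto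
  moreover have "a \<in> S \<inter> ball a d'" using a T d e by (auto simp: d'_def)
  ultimately obtain W where W: "openin (top_of_set S) W" "connectedin (top_of_set S) W" "a \<in> W" "W \<subseteq> S \<inter> ball a d'"
    using S(2) unfolding locally_connected_space by meson
  have "closure W \<subseteq> S \<inter> cball a d'"
    using W(4) S(1) by (intro closure_minimal) auto
  moreover have "cball a d' \<subseteq> cball a d" by (auto simp: d'_def)
  ultimately have "closure W \<subseteq> V" using T d by blast
  moreover have "\<forall>x\<in>W. \<forall>y\<in>W. dist x y \<le> e"
  proof (intro ballI)
    fix x y assume "x \<in> W" "y \<in> W"
    then have "dist a x < e/2" "dist a y < e/2" using W(4) by (auto simp: d'_def)
    then show "dist x y \<le> e" using dist_triangle3[of x y a] by linarith
  qed
  moreover have "connected W" using W(2) by (simp add: connectedin_subtopology)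
  ultimately show thesis using that[of W] W by simp
qed

definition chain_in :: "'a::metric_space set \<Rightarrow> real \<Rightarrow> (nat \<Rightarrow> 'a set) \<Rightarrow> nat \<Rightarrow> (nat \<Rightarrow> 'a) \<Rightarrow> (nat \<Rightarrow> 'a set) \<Rightarrow> bool" where
  "chain_in S e V m P W \<longleftrightarrow> (\<forall>i<m. openin (top_of_set S) (W i) \<and> connected (W i) \<and> closure (W i) \<subseteq> V i \<and>
     P i \<in> W i \<and> P (Suc i) \<in> W i \<and> (\<forall>x\<in>W i. \<forall>y\<in>W i. dist x y \<le> e))"

text \<open>Being joined by a chain of small connected open sets is an equivalence relation with open classes. The chain may be
prolonged to any length by repeating its last point, so that all links of a chain can later be refined into the same
number of pieces.\<close>

lemma small_connected_chain:
  fixes S :: "'a::metric_space set"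
  assumes S: "closed S" "locally_connected_space (top_of_set S)"
    and V: "openin (top_of_set S) V" "connected V" and pq: "p \<in> V" "q \<in> V" and e: "e > 0"
  shows "\<exists>n. \<forall>m\<ge>n. \<exists>P W. P 0 = p \<and> P m = q \<and> chain_in S e (\<lambda>_. V) m P W"
proof -
  define good where "good W \<longleftrightarrow> openin (top_of_set S) W \<and> connected W \<and> closure W \<subseteq> V \<and> (\<forall>x\<in>W. \<forall>y\<in>W. dist x y \<le> e)" for W
  define step where "step x y \<longleftrightarrow> (\<exists>W. good W \<and> x \<in> W \<and> y \<in> W)" for x y
  have nhd: "\<exists>W. good W \<and> a \<in> W" if "a \<in> V" for a
    using small_connected_nhd[OF S V(1) that e] unfolding good_def by metis
  have "step\<^sup>*\<^sup>* p q"
  proof (rule connected_equivalence_relation[OF V(2) pq])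
    show "step\<^sup>*\<^sup>* y x" if "step\<^sup>*\<^sup>* x y" for x y
      using that by (rule sympD[OF symp_rtranclp, rotated]) (auto simp: symp_def step_def)
    show "step\<^sup>*\<^sup>* x z" if "step\<^sup>*\<^sup>* x y" "step\<^sup>*\<^sup>* y z" for x y z
      using that by (rule rtranclp_trans)
    fix a assume a: "a \<in> V"
    then obtain W where W: "good W" "a \<in> W" using nhd by blast
    have "W \<subseteq> V" using W(1) closure_subset[of W] unfolding good_def by blast
    then have "openin (top_of_set V) W"
      using W(1) V(1) unfolding good_def by (meson openin_imp_subset openin_subset_trans)
    moreover have "step\<^sup>*\<^sup>* a x" if "x \<in> W" for x
      using W that by (intro r_into_rtranclp) (auto simp: step_def)
    ultimately show "\<exists>T. openin (top_of_set V) T \<and> a \<in> T \<and> (\<forall>x\<in>T. step\<^sup>*\<^sup>* a x)"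
      using W(2) by blast
  qed
  then obtain n where "(step ^^ n) p q" using rtranclp_imp_relpowp by metis
  then obtain P where P: "P 0 = p" "P n = q" "\<And>i. i < n \<Longrightarrow> step (P i) (P (Suc i))"
    by (auto simp: relpowp_fun_conv)
  then have "\<forall>i. \<exists>W. i < n \<longrightarrow> good W \<and> P i \<in> W \<and> P (Suc i) \<in> W" unfolding step_def by blast
  then obtain W where W: "\<And>i. i < n \<Longrightarrow> good (W i) \<and> P i \<in> W i \<and> P (Suc i) \<in> W i" by metis
  obtain Wq where Wq: "good Wq" "q \<in> Wq" using nhd pq(2) by blast
  show ?thesis
  proof (intro exI[of _ n] allI impI)
    fix m assume m: "m \<ge> n"
    define P' where "P' i = (if i \<le> n then P i else q)" for i
    define W' where "W' i = (if i < n then W i else Wq)" for i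
    have "good (W' i) \<and> P' i \<in> W' i \<and> P' (Suc i) \<in> W' i" for i
      using W[of i] Wq P(2) by (cases "i = n") (auto simp: P'_def W'_def)
    moreover have "P' 0 = p" "P' m = q" using P m by (auto simp: P'_def)
    ultimately show "\<exists>P W. P 0 = p \<and> P m = q \<and> chain_in S e (\<lambda>_. V) m P W"
      unfolding good_def chain_in_def by (intro exI[of _ P'] exI[of _ W']) simp
  qed
qed

text \<open>Each link of a chain is replaced by a chain of \<open>k\<close> smaller links inside it, with the same \<open>k\<close> for all links, so that
the link \<open>j\<close> of the new chain refines the link \<open>j div k\<close> of the old one.\<close>

lemma chain_refine:
  fixes S :: "'a::metric_space set"
  assumes S: "closed S" "locally_connected_space (top_of_set S)"
    and N: "(N::nat) > 0" and W: "\<And>i. i < N \<Longrightarrow> openin (top_of_set S) (W i) \<and> connected (W i) \<and> P i \<in> W i \<and> P (Suc i) \<in> W i"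
    and e: "e > 0"
  shows "\<exists>k P' W'. k > 0 \<and> (\<forall>i\<le>N. P' (i * k) = P i) \<and> chain_in S e (\<lambda>j. W (j div k)) (N * k) P' W'"
proof -
  define ch where "ch i m Q U \<longleftrightarrow> Q 0 = P i \<and> Q m = P (Suc i) \<and> chain_in S e (\<lambda>_. W i) m Q U" for i m Q U
  have "\<exists>n. \<forall>m\<ge>n. \<exists>Q U. ch i m Q U" if "i < N" for i
    unfolding ch_def using small_connected_chain[OF S _ _ _ _ e, of "W i" "P i" "P (Suc i)"] W[OF that] by blast
  then obtain n where n: "\<And>i m. i < N \<Longrightarrow> m \<ge> n i \<Longrightarrow> \<exists>Q U. ch i m Q U" by metis
  define k where "k = Suc (Max (n ` {..<N}))"
  have "n i \<le> k" if "i < N" for i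
    unfolding k_def using Max_ge[of "n ` {..<N}" "n i"] that by (intro le_SucI) simp
  then have "\<forall>i. \<exists>Q U. i < N \<longrightarrow> ch i k Q U" using n by blast
  then obtain Q U where QU: "\<And>i. i < N \<Longrightarrow> ch i k (Q i) (U i)" by metis
  have k: "k > 0" by (simp add: k_def)
  define P' where "P' j = (if j = N * k then P N else Q (j div k) (j mod k))" for j
  define W' where "W' j = U (j div k) (j mod k)" for j
  have P'k: "P' (i * k) = P i" if "i \<le> N" for i
    using that k QU[of i] by (auto simp: P'_def ch_def)
  have "openin (top_of_set S) (W' j) \<and> connected (W' j) \<and>
     P' j \<in> W' j \<and> P' (Suc j) \<in> W' j \<and> closure (W' j) \<subseteq> W (j div k) \<and> (\<forall>x\<in>W' j. \<forall>y\<in>W' j. dist x y \<le> e)"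
    if j: "j < N * k" for j
  proof -
    define i l where "i = j div k" and "l = j mod k"
    have i: "i < N" using j k by (simp add: i_def less_mult_imp_div_less)
    have l: "l < k" using k by (simp add: l_def)
    have jil: "j = i * k + l" by (simp add: i_def l_def)
    have ch: "ch i k (Q i) (U i)" by (rule QU[OF i])
    have Pj: "P' j = Q i l" using j by (simp add: P'_def i_def l_def)
    have PS: "P' (Suc j) = Q i (Suc l)"
    proof (cases "Suc l = k")
      case True
      then have "Suc j = Suc i * k" by (simp add: jil)
      then have "P' (Suc j) = P (Suc i)" using P'k[of "Suc i"] i by (metis Suc_leI)
      then show ?thesis using ch True by (simp add: ch_def)
    next
      case False
      then have "Suc l < k" using l by simp
      moreover have Sj: "Suc j = Suc l + k * i" by (simp add: jil)
      ultimately have "Suc j div k = i" "Suc j mod k = Suc l"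
        unfolding Sj by (simp_all only: div_mult_self2[OF less_imp_neq[OF k, symmetric]] mod_mult_self2 div_less mod_less add_0_right add_0)
      moreover have "Suc j \<noteq> N * k"
      proof
        assume "Suc j = N * k"
        then have "Suc j mod k = 0" by simp
        then show False using \<open>Suc j mod k = Suc l\<close> by simp
      qed
      ultimately show ?thesis by (simp add: P'_def)
    qed
    show ?thesis unfolding Pj PS W'_def i_def[symmetric] l_def[symmetric] using ch l unfolding ch_def chain_in_def by blast
  qed
  then show ?thesis using k P'k unfolding chain_in_def by blast
qed

text \<open>Refining chains over and over, and running through the points of the \<open>n\<close>-th chain at constant speed, gives step functions that converge
uniformly. The limit is continuous because consecutive points of the \<open>n\<close>-th chain are in a set of diameter at most
\<open>(1/2)^n\<close>.\<close>

lemma locally_connected_imp_path: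
  fixes S :: "'a::complete_space set"
  assumes S: "closed S" "locally_connected_space (top_of_set S)"
    and V: "openin (top_of_set S) V" "connected V" and pq: "p \<in> V" "q \<in> V"
  shows "\<exists>f. path f \<and> path_image f \<subseteq> V \<and> pathstart f = p \<and> pathfinish f = q"
proof -
  define ok :: "nat \<Rightarrow> nat \<times> (nat \<Rightarrow> 'a) \<times> (nat \<Rightarrow> 'a set) \<Rightarrow> bool"
    where "ok n s = (case s of (N, P, W) \<Rightarrow> N > 0 \<and> P 0 = p \<and> P N = q \<and>
      chain_in S ((1/2)^n) (\<lambda>_. V) N P W)" for n s
  define refines :: "nat \<times> (nat \<Rightarrow> 'a) \<times> (nat \<Rightarrow> 'a set) \<Rightarrow> nat \<times> (nat \<Rightarrow> 'a) \<times> (nat \<Rightarrow> 'a set) \<Rightarrow> bool"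
    where "refines s s' = (case (s, s') of ((N, P, W), (N', P', W')) \<Rightarrow> \<exists>k>0. N' = N * k \<and>
      (\<forall>i\<le>N. P' (i * k) = P i) \<and> (\<forall>j<N'. W' j \<subseteq> W (j div k)))" for s s'
  have "\<exists>s. ok 0 s"
  proof -
    obtain n where "\<forall>m\<ge>n. \<exists>P W. P 0 = p \<and> P m = q \<and> chain_in S 1 (\<lambda>_. V) m P W"
      using small_connected_chain[OF S V pq, of 1] by auto
    from this[rule_format, of "Suc n"] obtain P W where "ok 0 (Suc n, P, W)"
      unfolding ok_def by auto
    then show ?thesis by blast
  qed
  moreover have "\<exists>s'. ok (Suc n) s' \<and> refines s s'" if s: "ok n s" for s n
  proof -
    obtain N P W where NPW: "s = (N, P, W)" by (cases s) auto
    have N: "N > 0" "P 0 = p" "P N = q"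
      and W: "\<And>i. i < N \<Longrightarrow> openin (top_of_set S) (W i) \<and> connected (W i) \<and> P i \<in> W i \<and> P (Suc i) \<in> W i"
      and WV: "\<And>i. i < N \<Longrightarrow> closure (W i) \<subseteq> V"
      using s by (simp_all add: ok_def chain_in_def NPW)
    obtain k P' W' where k: "k > 0" "\<forall>i\<le>N. P' (i * k) = P i"
      and W': "chain_in S ((1/2)^Suc n) (\<lambda>j. W (j div k)) (N * k) P' W'"
      using chain_refine[where W=W and P=P, OF S N(1) W, of "(1/2)^Suc n"] by auto
    have sub: "closure (W' j) \<subseteq> V \<and> W' j \<subseteq> W (j div k)" if "j < N * k" for j
    proof -
      have "j div k < N" using that by (simp add: less_mult_imp_div_less)
      then show ?thesis using W' that WV[of "j div k"] closure_subset unfolding chain_in_def by (meson order_trans)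
    qed
    have "P' 0 = p" "P' (N * k) = q" using k(2)[rule_format, of 0] k(2)[rule_format, of N] N by simp_all
    then have "ok (Suc n) (N * k, P', W')" using N k W' sub by (simp add: ok_def chain_in_def)
    moreover have "refines s (N * k, P', W')"
      unfolding refines_def NPW prod.case using k sub by (intro exI[of _ k]) simp
    ultimately show ?thesis by blast
  qed
  ultimately obtain s where s: "\<And>n. ok n (s n)" "\<And>n. refines (s n) (s (Suc n))"
    using dependent_nat_choice[of ok "\<lambda>_. refines"] by blast
  define N where "N n = fst (s n)" for n
  define P where "P n = fst (snd (s n))" for n
  define W where "W n = snd (snd (s n))" for n
  have NP: "N n > 0" "P n 0 = p" "P n (N n) = q" for n
    using s(1)[of n] by (auto simp: ok_def N_def P_def split: prod.splits)
  have WV: "closure (W n i) \<subseteq> V" and PW: "P n i \<in> W n i" "P n (Suc i) \<in> W n i"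
    and Wd: "\<And>x y. x \<in> W n i \<Longrightarrow> y \<in> W n i \<Longrightarrow> dist x y \<le> (1/2)^n" if "i < N n" for n i
    using s(1)[of n] that by (auto simp: ok_def chain_in_def N_def P_def W_def split: prod.splits)
  have ref: "\<exists>k>0. N (Suc n) = N n * k \<and> (\<forall>i\<le>N n. P (Suc n) (i * k) = P n i) \<and> (\<forall>j<N (Suc n). W (Suc n) j \<subseteq> W n (j div k))" for n
    using s(2)[of n] by (auto simp: refines_def N_def P_def W_def split: prod.splits)
  define c where "c n t = nat \<lfloor>t * real (N n)\<rfloor>" for n and t :: real
  define g where "g n t = P n (c n t)" for n t
  have c_less: "c n t < N n" if "0 \<le> t" "t < 1" for n t
  proof -
    have "t * real (N n) < real (N n)" using that NP(1)[of n] by simp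
    then have "\<lfloor>t * real (N n)\<rfloor> < int (N n)" by (simp add: floor_less_iff)
    then show ?thesis using that by (simp add: c_def nat_less_iff)
  qed
  have g0: "g n 0 = p" and g1: "g n 1 = q" for n using NP[of n] by (simp_all add: g_def c_def)
  have Wdec: "W (Suc n) (c (Suc n) t) \<subseteq> W n (c n t)" if t: "0 \<le> t" "t < 1" for n t
  proof -
    obtain k where k: "k > 0" "N (Suc n) = N n * k" "\<forall>j<N (Suc n). W (Suc n) j \<subseteq> W n (j div k)"
      using ref[of n] by blast
    have "\<lfloor>t * real (N n)\<rfloor> = \<lfloor>(t * real (N (Suc n))) / real k\<rfloor>" using k by simp
    also have "\<dots> = \<lfloor>t * real (N (Suc n))\<rfloor> div int k"
      using floor_divide_real_eq_div[of "int k" "t * real (N (Suc n))"] by simp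
    finally have "c n t = c (Suc n) t div k" using t by (simp add: c_def nat_div_distrib)
    then show ?thesis using k(3) c_less[OF t, of "Suc n"] by simp
  qed
  have gW: "g n t \<in> W n (c n t)" if "0 \<le> t" "t < 1" for n t
    unfolding g_def using PW(1)[OF c_less[OF that]] .
  have Wmono: "W m (c m t) \<subseteq> W n (c n t)" if "0 \<le> t" "t < 1" "n \<le> m" for n m t
    using that(3) by (induction rule: dec_induct) (use Wdec[OF that(1,2)] in auto)
  have gd: "dist (g m t) (g n t) \<le> (1/2)^n" if t: "0 \<le> t" "t \<le> 1" and "n \<le> m" for n m t
  proof (cases "t = 1")
    case True
    then show ?thesis by (simp add: g1)
  next
    case False
    then have t: "0 \<le> t" "t < 1" using t by auto
    show ?thesis using Wd[OF c_less[OF t]] gW[OF t] Wmono[OF t \<open>n \<le> m\<close>] by blast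
  qed
  have small: "\<exists>n. (1/2::real)^n < e" if "e > 0" for e using real_arch_pow_inv[OF that] by simp
  have "convergent (\<lambda>n. g n t)" if t: "0 \<le> t" "t \<le> 1" for t
  proof (rule Cauchy_convergent, rule metric_CauchyI)
    fix e :: real assume "e > 0"
    then obtain n where n: "(1/2::real)^n < e/2" using small[of "e/2"] by auto
    have "dist (g m t) (g m' t) < e" if "m \<ge> n" "m' \<ge> n" for m m'
      using gd[OF t that(1)] gd[OF t that(2)] n dist_triangle2[of "g m t" "g m' t" "g n t"] by linarith
    then show "\<exists>M. \<forall>m\<ge>M. \<forall>m'\<ge>M. dist (g m t) (g m' t) < e" by blast
  qed
  then obtain f where f: "\<And>t. 0 \<le> t \<Longrightarrow> t \<le> 1 \<Longrightarrow> (\<lambda>n. g n t) \<longlonglongrightarrow> f t" unfolding convergent_def by metis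
  have fd: "dist (f t) (g n t) \<le> (1/2)^n" if t: "0 \<le> t" "t \<le> 1" for n t
  proof (rule tendsto_upperbound)
    show "(\<lambda>m. dist (g m t) (g n t)) \<longlonglongrightarrow> dist (f t) (g n t)"
      using f[OF t] by (intro tendsto_intros)
    show "\<forall>\<^sub>F m in sequentially. dist (g m t) (g n t) \<le> (1/2)^n"
      using gd[OF t] by (auto simp: eventually_sequentially)
  qed simp
  have f0: "f 0 = p" using f[of 0] LIMSEQ_unique[OF _ tendsto_const, of "\<lambda>n. g n 0"] by (simp add: g0 LIMSEQ_const_iff)
  have f1: "f 1 = q" using f[of 1] by (simp add: g1 LIMSEQ_const_iff)
  have near: "dist (g n t) (g n u) \<le> (1/2)^n" if "0 \<le> t" "t \<le> u" "u \<le> 1" "u - t < 1 / real (N n)" for n t u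
  proof -
    have NN: "real (N n) > 0" using NP by simp
    have tu: "t * real (N n) \<le> u * real (N n)" using that NN by simp
    have "(u - t) * real (N n) < 1" using that(4) NN by (simp add: field_simps)
    then have "u * real (N n) < t * real (N n) + 1" by (simp add: algebra_simps)
    then have "\<lfloor>u * real (N n)\<rfloor> \<le> \<lfloor>t * real (N n)\<rfloor> + 1" by linarith
    moreover have "\<lfloor>t * real (N n)\<rfloor> \<le> \<lfloor>u * real (N n)\<rfloor>" using tu by (rule floor_mono)
    moreover have "0 \<le> \<lfloor>t * real (N n)\<rfloor>" using that NN by simp
    ultimately consider "c n u = c n t" | "c n u = Suc (c n t)" unfolding c_def by linarith
    then show ?thesis
    proof cases
      case 1
      then show ?thesis by (simp add: g_def)
    next
      case 2
      then have "t \<noteq> 1" using that by (metis antisym n_not_Suc_n)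
      then have "c n t < N n" using that by (intro c_less) auto
      then show ?thesis using Wd PW 2 by (simp add: g_def)
    qed
  qed
  have "uniformly_continuous_on {0..1} f"
    unfolding uniformly_continuous_on_def
  proof (intro allI impI)
    fix e :: real assume "e > 0"
    then obtain n where n: "(1/2::real)^n < e/3" using small[of "e/3"] by auto
    have le: "dist (f u) (f t) < e" if "0 \<le> t" "t \<le> u" "u \<le> 1" "u - t < 1 / real (N n)" for t u
    proof -
      have "dist (f t) (g n t) \<le> (1/2)^n" "dist (f u) (g n u) \<le> (1/2)^n" using fd that by auto
      moreover have "dist (g n t) (g n u) \<le> (1/2)^n" by (rule near[OF that])
      ultimately show ?thesis
        using n dist_triangle2[of "f u" "f t" "g n u"] dist_triangle2[of "f t" "g n u" "g n t"]
          dist_commute[of "g n u" "g n t"] dist_commute[of "f u" "g n u"] dist_commute[of "f t" "g n u"] by linarith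
    qed
    show "\<exists>d>0. \<forall>t\<in>{0..1}. \<forall>u\<in>{0..1}. dist u t < d \<longrightarrow> dist (f u) (f t) < e"
    proof (intro exI[of _ "1 / real (N n)"] conjI ballI impI)
      fix t u :: real assume tu: "t \<in> {0..1}" "u \<in> {0..1}" "dist u t < 1 / real (N n)"
      show "dist (f u) (f t) < e"
      proof (cases "t \<le> u")
        case True
        then show ?thesis using le[of t u] tu by (simp add: dist_real_def)
      next
        case False
        then show ?thesis using le[of u t] tu by (simp add: dist_real_def dist_commute)
      qed
    qed (use NP in simp)
  qed
  then have "path f" unfolding path_def by (rule uniformly_continuous_imp_continuous)
  moreover have "path_image f \<subseteq> V"
  proof
    fix y assume "y \<in> path_image f"
    then obtain t where t: "0 \<le> t" "t \<le> 1" "y = f t" by (auto simp: path_image_def)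
    show "y \<in> V"
    proof (cases "t = 1")
      case True
      then show ?thesis using t f1 pq by simp
    next
      case False
      then have t1: "0 \<le> t" "t < 1" using t by auto
      have "g n t \<in> closure (W 0 (c 0 t))" for n
        using subsetD[OF Wmono[OF t1 le0] gW[OF t1]] closure_subset by (rule subsetD[rotated])
      then have "f t \<in> closure (W 0 (c 0 t))"
        by (intro Lim_in_closed_set[OF closed_closure _ _ f[OF t(1,2)]]) simp_all
      then show ?thesis using WV[OF c_less[OF t1]] t by blast
    qed
  qed
  ultimately show ?thesis using f0 f1 by (auto simp: pathstart_def pathfinish_def)
qed

section \<open>Arcs and medians in the absence of simple closed curves\<close>

text \<open>The part of \<open>g\<close> around \<open>m\<close> up to the first points of \<open>h\<close> on either side closes up with a part of \<open>h\<close>.\<close>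

lemma two_arcs_simple_closed_curve:
  fixes g h :: "real \<Rightarrow> 'a::real_normed_vector"
  assumes g: "arc g" and h: "arc h" and ends: "pathstart h = pathstart g" "pathfinish h = pathfinish g"
    and m: "m \<in> path_image g" "m \<notin> path_image h"
  obtains \<gamma> where "simple_path \<gamma>" "pathfinish \<gamma> = pathstart \<gamma>" "path_image \<gamma> \<subseteq> path_image g \<union> path_image h"
proof -
  obtain t0 where t0: "t0 \<in> {0..1}" "g t0 = m" using m(1) by (auto simp: path_image_def)
  define T where "T = {0..1} \<inter> g -` path_image h"
  have gc: "continuous_on {0..1} g" using g by (simp add: arc_def path_def)
  have ginj: "inj_on g {0..1}" using g by (simp add: arc_def)
  have "closed (path_image h)" using h by (simp add: arc_imp_path compact_path_image compact_imp_closed)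
  then have T: "closed T" unfolding T_def using gc by (intro continuous_closed_preimage) auto
  have T01: "0 \<in> T" "1 \<in> T"
    using ends pathstart_in_path_image[of h] pathfinish_in_path_image[of h]
    by (simp_all add: T_def pathstart_def pathfinish_def)
  have t0T: "t0 \<notin> T" using m t0 by (auto simp: T_def)
  define t1 where "t1 = Sup (T \<inter> {0..t0})"
  define t2 where "t2 = Inf (T \<inter> {t0..1})"
  have c1: "compact (T \<inter> {0..t0})" "compact (T \<inter> {t0..1})" using T by (auto intro: closed_Int_compact)
  have n1: "T \<inter> {0..t0} \<noteq> {}" "T \<inter> {t0..1} \<noteq> {}" using T01 t0 by auto
  have t1: "t1 \<in> T \<inter> {0..t0}"
    unfolding t1_def using n1 c1 by (intro closed_contains_Sup) (auto simp: compact_imp_closed bounded_imp_bdd_above compact_imp_bounded)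
  have t2: "t2 \<in> T \<inter> {t0..1}"
    unfolding t2_def using n1 c1 by (intro closed_contains_Inf) (auto simp: compact_imp_closed bounded_imp_bdd_below compact_imp_bounded)
  have lt: "t1 < t0" "t0 < t2" using t1 t2 t0T by (auto simp: less_le)
  have gap: "t \<notin> T" if "t1 < t" "t < t2" for t
  proof
    assume tT: "t \<in> T"
    show False
    proof (cases "t \<le> t0")
      case True
      then have "t \<in> T \<inter> {0..t0}" using tT by (auto simp: T_def)
      then have "t \<le> t1" unfolding t1_def using c1
        by (intro cSup_upper) (auto simp: bounded_imp_bdd_above compact_imp_bounded)
      then show False using that by simp
    next
      case False
      then have "t \<in> T \<inter> {t0..1}" using tT by (auto simp: T_def)
      then have "t2 \<le> t" unfolding t2_def using c1
        by (intro cInf_lower) (auto simp: bounded_imp_bdd_below compact_imp_bounded)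
      then show False using that by simp
    qed
  qed
  have tt: "t1 \<in> {0..1}" "t2 \<in> {0..1}" using t1 t2 by (auto simp: T_def)
  obtain u where u: "u \<in> {0..1}" "h u = g t2" using t2 by (auto simp: T_def path_image_def)
  obtain v where v: "v \<in> {0..1}" "h v = g t1" using t1 by (auto simp: T_def path_image_def)
  have "g t1 \<noteq> g t2" using ginj tt lt by (metis inj_onD less_trans less_irrefl)
  then have uv: "u \<noteq> v" using u v by auto
  define \<gamma> where "\<gamma> = subpath t1 t2 g +++ subpath u v h"
  have pg: "path_image (subpath t1 t2 g) = g ` {t1..t2}" using lt by (simp add: path_image_subpath)
  have ph: "path_image (subpath u v h) \<subseteq> path_image h"
    by (rule path_image_subpath_subset[OF u(1) v(1)])
  have "simple_path \<gamma>"
    unfolding \<gamma>_def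
  proof (rule simple_path_join_loop)
    show "arc (subpath t1 t2 g)" "arc (subpath u v h)"
      using arc_subpath_arc[OF g tt] arc_subpath_arc[OF h u(1) v(1) uv] lt by simp_all
    show "path_image (subpath t1 t2 g) \<inter> path_image (subpath u v h) \<subseteq> {pathstart (subpath t1 t2 g), pathstart (subpath u v h)}"
    proof
      fix y assume y: "y \<in> path_image (subpath t1 t2 g) \<inter> path_image (subpath u v h)"
      then obtain t where t: "t \<in> {t1..t2}" "y = g t" unfolding pg by blast
      then have "t \<in> T" using y ph tt by (auto simp: T_def)
      then have "t = t1 \<or> t = t2" using gap[of t] t by fastforce
      then show "y \<in> {pathstart (subpath t1 t2 g), pathstart (subpath u v h)}" using t u by auto
    qed
  qed (use u v in auto)
  moreover have "pathfinish \<gamma> = pathstart \<gamma>" using v by (simp add: \<gamma>_def)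
  moreover have "path_image \<gamma> \<subseteq> path_image g \<union> path_image h"
    unfolding \<gamma>_def using path_image_subpath_subset[OF tt] ph
    by (intro order_trans[OF path_image_join_subset]) blast
  ultimately show thesis using that by blast
qed

locale dendrite_set =
  fixes S :: "'a::{complete_space,real_normed_vector} set"
  assumes compact_S: "compact S" and connected_S: "connected S"
    and loc_S: "locally_connected_space (top_of_set S)"
    and no_loop: "\<And>\<gamma>. simple_path \<gamma> \<Longrightarrow> pathfinish \<gamma> = pathstart \<gamma> \<Longrightarrow> path_image \<gamma> \<subseteq> S \<Longrightarrow> False"
begin

sublocale cut_space "top_of_set S"
proof
  show "connected_space (top_of_set S)" using connected_S by (simp add: connected_space_subtopology)
  show "t1_space (top_of_set S)" by (simp add: Hausdorff_imp_t1_space Hausdorff_space_subtopology)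
qed (rule loc_S)

lemma arc_in_open:
  assumes "openin (top_of_set S) U" "connected U" "x \<in> U" "y \<in> U" "x \<noteq> y"
  obtains g where "arc g" "path_image g \<subseteq> U" "pathstart g = x" "pathfinish g = y"
proof -
  have "path_connected U"
    unfolding path_connected_def
    using locally_connected_imp_path[OF compact_imp_closed[OF compact_S] loc_S assms(1,2)] by blast
  then show thesis using that assms(3-5) unfolding path_connected_arcwise by blast
qed

text \<open>If the ends of an arc stayed together after the removal of an inner point \<open>m\<close>, then they would be joined by an arc that
avoids \<open>m\<close>, and the two arcs would contain a simple closed curve.\<close>

lemma separates_arc:
  assumes g: "arc g" "path_image g \<subseteq> S" and m: "m \<in> path_image g" "m \<noteq> pathstart g" "m \<noteq> pathfinish g"
  shows "separates m (pathstart g) (pathfinish g)"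
proof -
  define x y where "x = pathstart g" and "y = pathfinish g"
  have xy: "x \<in> S" "y \<in> S" "x \<noteq> y" "m \<in> S"
    using g m arc_distinct_ends[OF g(1)] pathstart_in_path_image[of g] pathfinish_in_path_image[of g]
    by (auto simp: x_def y_def)
  have "comp m x \<noteq> comp m y"
  proof
    assume eq: "comp m x = comp m y"
    have "x \<in> comp m x" "y \<in> comp m x"
      using in_cut_comp[of x "top_of_set S" m] in_cut_comp[of y "top_of_set S" m] xy m eq by (auto simp: x_def y_def)
    moreover have "connected (comp m x)"
      using connectedin_cut_comp[of "top_of_set S" m x] by (simp add: connectedin_subtopology)
    ultimately obtain h where h: "arc h" "path_image h \<subseteq> comp m x" "pathstart h = x" "pathfinish h = y"
      using arc_in_open[OF openin_comp _ _ _ xy(3)] by metis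
    have "m \<notin> path_image h" "path_image h \<subseteq> S" using h(2) cut_comp_subset[of "top_of_set S" m x] by auto
    then obtain \<gamma> where "simple_path \<gamma>" "pathfinish \<gamma> = pathstart \<gamma>" "path_image \<gamma> \<subseteq> path_image g \<union> path_image h"
      using two_arcs_simple_closed_curve[OF g(1) h(1) _ _ m(1)] h(3,4) unfolding x_def y_def by blast
    then show False using no_loop g(2) \<open>path_image h \<subseteq> S\<close> by blast
  qed
  then show ?thesis using xy m unfolding separates_def x_def y_def by auto
qed

text \<open>The median is the point at which an arc from \<open>z\<close> first meets the arc from \<open>x\<close> to \<open>y\<close>; it may be \<open>x\<close>, \<open>y\<close> or \<open>z\<close>.\<close>

lemma median:
  assumes xyz: "x \<in> S" "y \<in> S" "z \<in> S" "x \<noteq> y" "x \<noteq> z" "y \<noteq> z"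
  shows "separates x y z \<or> separates y x z \<or> separates z x y \<or> (\<exists>m. separates m x y \<and> separates m x z \<and> separates m y z)"
proof -
  have open_S: "openin (top_of_set S) S" by simp
  obtain g where g: "arc g" "path_image g \<subseteq> S" "pathstart g = x" "pathfinish g = y"
    using arc_in_open[OF open_S connected_S xyz(1,2,4)] .
  show ?thesis
  proof (cases "z \<in> path_image g")
    case True
    then show ?thesis using separates_arc[OF g(1,2)] g(3,4) xyz by blast
  next
    case False
    obtain k where k: "arc k" "path_image k \<subseteq> S" "pathstart k = z" "pathfinish k = x"
      using arc_in_open[OF open_S connected_S xyz(3,1)] xyz(5) by metis
    define T where "T = {0..1} \<inter> k -` path_image g"
    have "closed (path_image g)" using g by (simp add: arc_imp_path compact_path_image compact_imp_closed)
    then have T: "closed T"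
      unfolding T_def using k(1) by (intro continuous_closed_preimage) (auto simp: arc_def path_def)
    have "1 \<in> T" using k(4) g(3) pathstart_in_path_image[of g] by (simp add: T_def pathfinish_def)
    define s where "s = Inf T"
    have bT: "bdd_below T" by (rule bdd_belowI[of _ 0]) (simp add: T_def)
    have s: "s \<in> T" unfolding s_def using \<open>1 \<in> T\<close> T bT by (intro closed_contains_Inf) auto
    have smin: "s \<le> t" if "t \<in> T" for t unfolding s_def using that bT by (rule cInf_lower)
    have s01: "s \<in> {0..1}" using s by (simp add: T_def)
    have "s \<noteq> 0" using s False k(3) by (auto simp: T_def pathstart_def)
    define m where "m = k s"
    have mg: "m \<in> path_image g" using s by (simp add: T_def m_def)
    define k' where "k' = subpath 0 s k"
    have k': "arc k'" "path_image k' \<subseteq> S" "pathstart k' = z" "pathfinish k' = m"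
      using arc_subpath_arc[OF k(1) _ s01, of 0] \<open>s \<noteq> 0\<close> path_image_subpath_subset[of 0 s k] k(2,3) s01
      by (auto simp: k'_def m_def pathstart_def pathfinish_def subpath_def)
    have meet: "path_image k' \<inter> path_image g \<subseteq> {m}"
    proof
      fix w assume w: "w \<in> path_image k' \<inter> path_image g"
      then obtain t where t: "t \<in> {0..s}" "w = k t"
        using s01 by (auto simp: k'_def path_image_subpath)
      then have "t \<in> T" using w s01 by (auto simp: T_def)
      then have "t = s" using smin[of t] t by simp
      then show "w \<in> {m}" using t by (simp add: m_def)
    qed
    have mz: "m \<noteq> z" using mg False by auto
    have through: "separates m z e" if h: "arc h" "path_image h \<subseteq> path_image g" "pathstart h = m" "pathfinish h = e" for h e
    proof -
      have me: "m \<noteq> e" using arc_distinct_ends[OF h(1)] h by simp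
      have "arc (k' +++ h)"
        using k' h meet by (intro arc_join) auto
      moreover have im: "path_image (k' +++ h) = path_image k' \<union> path_image h"
        using k' h by (intro path_image_join) simp
      moreover have "m \<in> path_image h" using h(3) pathstart_in_path_image[of h] by simp
      ultimately show ?thesis
        using separates_arc[of "k' +++ h" m] k' h g(2) mz me by auto
    qed
    obtain r where r: "r \<in> {0..1}" "g r = m" using mg by (auto simp: path_image_def)
    have tox: "separates m z x" if "m \<noteq> x"
    proof (rule through)
      have "r \<noteq> 0" using that r g(3) by (auto simp: pathstart_def)
      then show "arc (subpath r 0 g)" using arc_subpath_arc[OF g(1) r(1), of 0] by simp
      show "path_image (subpath r 0 g) \<subseteq> path_image g" using r by (intro path_image_subpath_subset) auto
      show "pathstart (subpath r 0 g) = m" "pathfinish (subpath r 0 g) = x"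
        using r g(3)[unfolded pathstart_def] by simp_all
    qed
    have toy: "separates m z y" if "m \<noteq> y"
    proof (rule through)
      have "r \<noteq> 1" using that r g(4) by (auto simp: pathfinish_def)
      then show "arc (subpath r 1 g)" using arc_subpath_arc[OF g(1) r(1), of 1] by simp
      show "path_image (subpath r 1 g) \<subseteq> path_image g" using r by (intro path_image_subpath_subset) auto
      show "pathstart (subpath r 1 g) = m" "pathfinish (subpath r 1 g) = y"
        using r g(4)[unfolded pathfinish_def] by simp_all
    qed
    show ?thesis
    proof (cases "m = x \<or> m = y")
      case True
      then show ?thesis using tox toy xyz(4) separates_commute by blast
    next
      case False
      then have "separates m x y" using separates_arc[OF g(1,2) mg] g(3,4) by auto
      then show ?thesis using tox toy False separates_commute by blast
    qed
  qed
qed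

end

section \<open>Medians in dendrites\<close>

text \<open>The Kuratowski embedding into the bounded functions on the discrete copy of the space. It places a dendrite in a
complete normed space, where the theory of arcs is at hand.\<close>

lemma compact_metric_embedding:
  assumes "compact_space X" "metrizable_space X" "topspace X \<noteq> {}"
  obtains e :: "'x \<Rightarrow> ('x discrete \<Rightarrow>\<^sub>C real)" and S where "homeomorphic_map X (top_of_set S) e"
proof -
  obtain M d where Md: "Metric_space M d" and X: "X = Metric_space.mtopology M d"
    using assms(2) unfolding metrizable_space_def by blast
  interpret Metric_space M d by (rule Md)
  have M: "M \<noteq> {}" "topspace X = M" using assms(3) X by auto
  obtain x0 where x0: "x0 \<in> M" using M by blast
  define F where "F x p = (if of_discrete p \<in> M then d x (of_discrete p) - d x0 (of_discrete p) else 0)" for x p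
  define e :: "'x \<Rightarrow> ('x discrete \<Rightarrow>\<^sub>C real)" where "e x = Bcontfun (F x)" for x
  have e: "apply_bcontfun (e x) = F x" if x: "x \<in> M" for x
  proof -
    have "F x \<in> bcontfun"
    proof (rule bcontfun_normI)
      show "norm (F x p) \<le> d x x0" for p
        using triangle[OF x x0, of "of_discrete p"] triangle[OF x0 x, of "of_discrete p"] commute[of x x0]
        by (auto simp: F_def)
    qed (simp add: continuous_on_open_vimage open_discrete)
    then show ?thesis by (simp add: e_def Bcontfun_inverse)
  qed
  have lip: "dist (e x) (e y) \<le> d x y" if "x \<in> M" "y \<in> M" for x y
  proof (rule dist_bound)
    show "dist (apply_bcontfun (e x) p) (apply_bcontfun (e y) p) \<le> d x y" for p
      using triangle[OF that, of "of_discrete p"] triangle[OF that(2,1), of "of_discrete p"] commute[of x y] e that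
      by (auto simp: dist_real_def F_def)
  qed
  have inj: "inj_on e M"
  proof (rule inj_onI)
    fix x y assume xy: "x \<in> M" "y \<in> M" "e x = e y"
    then have "F x (discrete y) = F y (discrete y)" using e by metis
    then show "x = y" using xy by (simp add: F_def discrete_inverse)
  qed
  have "homeomorphic_map X (top_of_set (e ` M)) e"
  proof (rule continuous_imp_homeomorphic_map)
    have "continuous_map mtopology euclidean e"
    proof -
      have "continuous_map (mtopology_of (metric (M, d))) (mtopology_of euclidean_metric) e"
        by (rule Lipschitz_continuous_imp_continuous_map)
          (auto simp: Lipschitz_continuous_map_def lip intro!: exI[of _ 1])
      then show ?thesis by (simp add: mtopology_of_def)
    qed
    then show "continuous_map X (top_of_set (e ` M)) e"
      using M X by (auto simp: continuous_map_in_subtopology)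
    show "Hausdorff_space (top_of_set (e ` M))" by (simp add: Hausdorff_space_subtopology)
    show "e ` topspace X = topspace (top_of_set (e ` M))" using M by simp
    show "inj_on e (topspace X)" using inj M by simp
  qed (rule assms(1))
  then show thesis by (rule that)
qed

context cut_space
begin

lemma separates_homeomorphic:
  assumes h: "homeomorphic_map X Y h" and Y: "cut_space Y"
    and xyz: "z \<in> topspace X" "x \<in> topspace X" "y \<in> topspace X"
  shows "cut_space.separates Y (h z) (h x) (h y) \<longleftrightarrow> separates z x y"
proof -
  have inj: "inj_on h (topspace X)" and im: "h ` topspace X = topspace Y"
    using h by (auto simp: homeomorphic_eq_everything_map)
  have "cut_comp Y (h z) (h x) = cut_comp Y (h z) (h y) \<longleftrightarrow> comp z x = comp z y"
  proof -
    have "comp z x \<subseteq> topspace X" "comp z y \<subseteq> topspace X" using cut_comp_subset[of X z] by blast+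
    then show ?thesis
      unfolding homeomorphic_map_cut_comp[OF h xyz(2,1), symmetric]
        homeomorphic_map_cut_comp[OF h xyz(3,1), symmetric] using inj_on_image_eq_iff[OF inj] by blast
  qed
  moreover have "h x \<in> topspace Y - {h z} \<longleftrightarrow> x \<in> topspace X - {z}"
    "h y \<in> topspace Y - {h z} \<longleftrightarrow> y \<in> topspace X - {z}"
    using xyz im inj by (auto simp: inj_on_eq_iff)
  moreover have "h z \<in> topspace Y" using xyz im by blast
  ultimately show ?thesis unfolding separates_def cut_space.separates_def[OF Y] using xyz by simp
qed

end

lemma dendrite_cut_space: "dendrite X \<Longrightarrow> cut_space X"
  by (simp add: cut_space_def dendrite_def continuum_def metrizable_imp_t1_space)

lemma dendrite_median:
  fixes X :: "'x topology"
  assumes X: "dendrite X" and xyz: "x \<in> topspace X" "y \<in> topspace X" "z \<in> topspace X" "x \<noteq> y" "x \<noteq> z" "y \<noteq> z"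
  shows "cut_space.separates X x y z \<or> cut_space.separates X y x z \<or> cut_space.separates X z x y \<or>
    (\<exists>m. cut_space.separates X m x y \<and> cut_space.separates X m x z \<and> cut_space.separates X m y z)"
proof -
  have cX: "compact_space X" "metrizable_space X" "topspace X \<noteq> {}" "connected_space X" "locally_connected_space X"
    using X by (auto simp: dendrite_def continuum_def)
  obtain e :: "'x \<Rightarrow> ('x discrete \<Rightarrow>\<^sub>C real)" and S where e: "homeomorphic_map X (top_of_set S) e"
    using compact_metric_embedding[OF cX(1,2,3)] .
  have hs: "X homeomorphic_space top_of_set S" using e homeomorphic_map_imp_homeomorphic_space by blast
  have im: "e ` topspace X = S" and inj: "inj_on e (topspace X)"
    using e by (auto simp: homeomorphic_eq_everything_map)
  have S: "dendrite_set S"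
  proof
    show "compact S"
      using cX(1) homeomorphic_compact_space[OF hs] compactin_subspace[of euclidean S] by simp
    show "connected S"
      using cX(4) homeomorphic_connected_space[OF hs] by (simp add: connectedin_def flip: connectedin_iff_connected)
    show "locally_connected_space (top_of_set S)"
      using cX(5) homeomorphic_locally_connected_space[OF hs] by simp
    fix \<gamma> :: "real \<Rightarrow> ('x discrete \<Rightarrow>\<^sub>C real)"
    assume \<gamma>: "simple_path \<gamma>" "pathfinish \<gamma> = pathstart \<gamma>" "path_image \<gamma> \<subseteq> S"
    have "sphere (0::complex) 1 homeomorphic path_image \<gamma>"
      using homeomorphic_simple_path_image_circle[OF \<gamma>(1,2), of 1 0] homeomorphic_sym by auto
    then obtain f g where "homeomorphism (sphere (0::complex) 1) (path_image \<gamma>) f g"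
      unfolding homeomorphic_def by blast
    then have "homeomorphic_maps (top_of_set (sphere (0::complex) 1)) (top_of_set (path_image \<gamma>)) f g"
      unfolding homeomorphism_def homeomorphic_maps_def by auto
    then have f: "homeomorphic_map (top_of_set (sphere (0::complex) 1)) (top_of_set (path_image \<gamma>)) f"
      unfolding homeomorphic_map_maps by blast
    then have "homeomorphic_map (top_of_set (sphere (0::complex) 1)) (subtopology (top_of_set S) (path_image \<gamma>)) f"
      using \<gamma>(3) by (simp add: subtopology_subtopology Int_absorb1)
    then have "embedding_map (top_of_set (sphere (0::complex) 1)) (top_of_set S) f"
      unfolding embedding_map_def using homeomorphic_imp_surjective_map[OF f] by simp
    moreover obtain k where k: "homeomorphic_map (top_of_set S) X k"
      using hs homeomorphic_space homeomorphic_space_sym by blast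
    then have "embedding_map (top_of_set S) X k" using surjective_embedding_map by blast
    ultimately have "embedding_map (top_of_set (sphere (0::complex) 1)) X (k \<circ> f)"
      by (rule embedding_map_compose)
    then show False using X unfolding dendrite_def by blast
  qed
  interpret S: dendrite_set S by (rule S)
  interpret X: cut_space X using X by (rule dendrite_cut_space)
  have tr: "S.separates (e p) (e q) (e r) \<longleftrightarrow> X.separates p q r" if "p \<in> topspace X" "q \<in> topspace X" "r \<in> topspace X" for p q r
    by (rule X.separates_homeomorphic[OF e S.cut_space_axioms that])
  have "S.separates (e x) (e y) (e z) \<or> S.separates (e y) (e x) (e z) \<or> S.separates (e z) (e x) (e y) \<or>
    (\<exists>m. S.separates m (e x) (e y) \<and> S.separates m (e x) (e z) \<and> S.separates m (e y) (e z))"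
    using xyz im inj by (intro S.median) (auto simp: inj_on_eq_iff)
  moreover have "\<exists>m. X.separates m x y \<and> X.separates m x z \<and> X.separates m y z"
    if m: "S.separates m (e x) (e y) \<and> S.separates m (e x) (e z) \<and> S.separates m (e y) (e z)" for m
  proof -
    have "m \<in> S" using m by (simp add: S.separates_def)
    then obtain p where "p \<in> topspace X" "m = e p" using im by blast
    then show ?thesis using m tr xyz by blast
  qed
  ultimately show ?thesis using tr xyz by blast
qed

section \<open>Spaces of square-summable functions\<close>

definition square_summable :: "('s \<Rightarrow> complex) \<Rightarrow> bool" where
  "square_summable v \<longleftrightarrow> (\<lambda>s. (cmod (v s))\<^sup>2) summable_on UNIV"

definition l2norm :: "('s \<Rightarrow> complex) \<Rightarrow> real" where
  "l2norm v = sqrt (\<Sum>\<^sub>\<infinity>s. (cmod (v s))\<^sup>2)"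

lemma square_summable_boundI:
  assumes "C \<ge> 0" and "\<And>F. finite F \<Longrightarrow> (\<Sum>s\<in>F. (cmod (v s))\<^sup>2) \<le> C\<^sup>2"
  shows "square_summable v" "l2norm v \<le> C"
proof -
  show s: "square_summable v"
    unfolding square_summable_def
    by (rule nonneg_bdd_above_summable_on) (auto intro!: bdd_aboveI[of _ "C\<^sup>2"] assms)
  have "(\<Sum>\<^sub>\<infinity>s. (cmod (v s))\<^sup>2) \<le> C\<^sup>2"
    by (rule infsum_le_finite_sums[OF s[unfolded square_summable_def]]) (use assms in auto)
  then show "l2norm v \<le> C"
    unfolding l2norm_def using assms(1) real_le_lsqrt[of "\<Sum>\<^sub>\<infinity>s. (cmod (v s))\<^sup>2" C]
    by (metis real_sqrt_le_mono real_sqrt_abs abs_of_nonneg)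
qed

lemma l2norm_nonneg: "l2norm v \<ge> 0"
  unfolding l2norm_def by (simp add: infsum_nonneg)

lemma finite_sum_le_l2norm:
  assumes "square_summable v" "finite F"
  shows "(\<Sum>s\<in>F. (cmod (v s))\<^sup>2) \<le> (l2norm v)\<^sup>2"
proof -
  have "(\<Sum>s\<in>F. (cmod (v s))\<^sup>2) \<le> (\<Sum>\<^sub>\<infinity>s. (cmod (v s))\<^sup>2)"
    using assms unfolding square_summable_def by (intro finite_sum_le_infsum) auto
  also have "\<dots> = (l2norm v)\<^sup>2" unfolding l2norm_def by (simp add: infsum_nonneg)
  finally show ?thesis .
qed

lemma L2_set_le_l2norm:
  assumes "square_summable v" "finite F"
  shows "L2_set (\<lambda>s. cmod (v s)) F \<le> l2norm v"
  unfolding L2_set_def using finite_sum_le_l2norm[OF assms] l2norm_nonneg[of v]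
  by (metis real_sqrt_le_mono real_sqrt_abs abs_of_nonneg)

lemma cmod_le_l2norm: "square_summable v \<Longrightarrow> cmod (v s) \<le> l2norm v"
  using L2_set_le_l2norm[of v "{s}"] by simp

lemma square_summable_add:
  assumes "square_summable u" "square_summable v"
  shows "square_summable (\<lambda>s. u s + v s)" "l2norm (\<lambda>s. u s + v s) \<le> l2norm u + l2norm v"
proof -
  have "(\<Sum>s\<in>F. (cmod (u s + v s))\<^sup>2) \<le> (l2norm u + l2norm v)\<^sup>2" if F: "finite F" for F
  proof -
    have "L2_set (\<lambda>s. cmod (u s + v s)) F \<le> L2_set (\<lambda>s. cmod (u s) + cmod (v s)) F"
      by (rule L2_set_mono) (auto simp: norm_triangle_ineq)
    also have "\<dots> \<le> L2_set (\<lambda>s. cmod (u s)) F + L2_set (\<lambda>s. cmod (v s)) F"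
      by (rule L2_set_triangle_ineq)
    also have "\<dots> \<le> l2norm u + l2norm v" using assms F by (intro add_mono L2_set_le_l2norm)
    finally have le: "L2_set (\<lambda>s. cmod (u s + v s)) F \<le> l2norm u + l2norm v" .
    have "(\<Sum>s\<in>F. (cmod (u s + v s))\<^sup>2) = (L2_set (\<lambda>s. cmod (u s + v s)) F)\<^sup>2"
      unfolding L2_set_def by (simp add: sum_nonneg)
    also have "\<dots> \<le> (l2norm u + l2norm v)\<^sup>2" using le by (intro power_mono) (simp_all add: L2_set_def sum_nonneg)
    finally show ?thesis .
  qed
  then show "square_summable (\<lambda>s. u s + v s)" "l2norm (\<lambda>s. u s + v s) \<le> l2norm u + l2norm v"
    using square_summable_boundI[of "l2norm u + l2norm v" "\<lambda>s. u s + v s"] l2norm_nonneg[of u] l2norm_nonneg[of v] by simp_all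
qed

lemma square_summable_cmult: "square_summable v \<Longrightarrow> square_summable (\<lambda>s. a * v s)"
  unfolding square_summable_def norm_mult power_mult_distrib by (rule summable_on_cmult_right)

lemma square_summable_minus: "square_summable v \<Longrightarrow> square_summable (\<lambda>s. - v s)"
  unfolding square_summable_def by simp

lemma l2norm_minus: "l2norm (\<lambda>s. - v s) = l2norm v"
  unfolding l2norm_def by simp

lemma square_summable_diff:
  assumes "square_summable u" "square_summable v"
  shows "square_summable (\<lambda>s. u s - v s)"
  using square_summable_add(1)[OF assms(1) square_summable_minus[OF assms(2)]] by simp

lemma square_summable_0: "square_summable (\<lambda>s. 0)"
  unfolding square_summable_def by simp

lemma inner_summable:
  assumes "square_summable u" "square_summable v"
  shows "(\<lambda>s. u s * cnj (v s)) summable_on UNIV"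
proof -
  have "(\<lambda>s. norm (u s * cnj (v s))) summable_on UNIV"
  proof (rule summable_on_comparison_test)
    show "(\<lambda>s. (cmod (u s))\<^sup>2 + (cmod (v s))\<^sup>2) summable_on UNIV"
      using assms unfolding square_summable_def by (rule summable_on_add)
    show "norm (u s * cnj (v s)) \<le> (cmod (u s))\<^sup>2 + (cmod (v s))\<^sup>2" for s
    proof -
      have "2 * (cmod (u s) * cmod (v s)) \<le> (cmod (u s))\<^sup>2 + (cmod (v s))\<^sup>2"
        using sum_squares_bound[of "cmod (u s)" "cmod (v s)"] by simp
      moreover have "0 \<le> cmod (u s) * cmod (v s)" by (intro mult_nonneg_nonneg norm_ge_zero)
      ultimately have "cmod (u s) * cmod (v s) \<le> (cmod (u s))\<^sup>2 + (cmod (v s))\<^sup>2" by linarith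
      then show ?thesis by (simp add: norm_mult)
    qed
  qed auto
  then show ?thesis by (rule abs_summable_summable)
qed

definition ell2_carrier :: "'s set \<Rightarrow> ('s \<Rightarrow> complex) set" where
  "ell2_carrier S = {v. square_summable v \<and> (\<forall>s. s \<notin> S \<longrightarrow> v s = 0)}"

text \<open>The addition of the Hilbert space \<open>ell2 S\<close> treats functions that are not in the space as zero. Completeness is stated for the distance
\<open>hnorm (u \<ominus> v)\<close>, and a metric has to be symmetric on the whole type, also outside of the carrier. With this addition
\<open>u \<ominus> v\<close> is the difference of the parts of \<open>u\<close> and \<open>v\<close> for all functions.\<close>

definition ell2_part :: "'s set \<Rightarrow> ('s \<Rightarrow> complex) \<Rightarrow> 's \<Rightarrow> complex" where
  "ell2_part S v = (if v \<in> ell2_carrier S then v else (\<lambda>s. 0))"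

definition ell2 :: "'s set \<Rightarrow> ('s \<Rightarrow> complex) hilbert" where
  "ell2 S = \<lparr>carrier = ell2_carrier S,
     mult = (\<lambda>u v. u), one = (\<lambda>s. 0), zero = (\<lambda>s. 0),
     add = (\<lambda>u v s. ell2_part S u s + ell2_part S v s),
     smult = (\<lambda>a v s. a * v s), ip = (\<lambda>u v. \<Sum>\<^sub>\<infinity>s. u s * cnj (v s))\<rparr>"

lemma in_ell2: "v \<in> carrier (ell2 S) \<longleftrightarrow> square_summable v \<and> (\<forall>s. s \<notin> S \<longrightarrow> v s = 0)"
  by (simp add: ell2_def ell2_carrier_def)

lemma ell2_simps:
  "\<zero>\<^bsub>ell2 S\<^esub> = (\<lambda>s. 0)" "a \<odot>\<^bsub>ell2 S\<^esub> v = (\<lambda>s. a * v s)"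
  "ip (ell2 S) u v = (\<Sum>\<^sub>\<infinity>s. u s * cnj (v s))"
  by (simp_all add: ell2_def)

lemma ell2_add:
  "u \<in> carrier (ell2 S) \<Longrightarrow> v \<in> carrier (ell2 S) \<Longrightarrow> u \<oplus>\<^bsub>ell2 S\<^esub> v = (\<lambda>s. u s + v s)"
  by (simp add: ell2_def ell2_part_def)

lemma ell2_zero_closed: "(\<lambda>s. 0) \<in> carrier (ell2 S)"
  by (simp add: in_ell2 square_summable_0)

lemma ell2_add_closed:
  "u \<in> carrier (ell2 S) \<Longrightarrow> v \<in> carrier (ell2 S) \<Longrightarrow> (\<lambda>s. u s + v s) \<in> carrier (ell2 S)"
  by (simp add: in_ell2 square_summable_add)

lemma ell2_minus_closed: "v \<in> carrier (ell2 S) \<Longrightarrow> (\<lambda>s. - v s) \<in> carrier (ell2 S)"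
  by (simp add: in_ell2 square_summable_minus)

lemma ell2_cmult_closed: "v \<in> carrier (ell2 S) \<Longrightarrow> (\<lambda>s. a * v s) \<in> carrier (ell2 S)"
  by (simp add: in_ell2 square_summable_cmult)

lemmas ell2_closed = ell2_zero_closed ell2_add_closed ell2_minus_closed ell2_cmult_closed

lemma Re_ip_self:
  assumes "square_summable v"
  shows "Re (ip (ell2 S) v v) = (\<Sum>\<^sub>\<infinity>s. (cmod (v s))\<^sup>2)"
proof -
  have "Re (ip (ell2 S) v v) = (\<Sum>\<^sub>\<infinity>s. Re (v s * cnj (v s)))"
    unfolding ell2_simps by (rule infsum_Re[OF inner_summable[OF assms assms], symmetric])
  also have "\<dots> = (\<Sum>\<^sub>\<infinity>s. (cmod (v s))\<^sup>2)"
    by (rule infsum_cong) (simp only: complex_norm_square[symmetric] Re_complex_of_real)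
  finally show ?thesis .
qed

lemma hnorm_ell2: "square_summable v \<Longrightarrow> hnorm (ell2 S) v = l2norm v"
  unfolding hnorm_def l2norm_def by (simp add: Re_ip_self)

lemma l2norm_eq_0: "square_summable v \<Longrightarrow> l2norm v = 0 \<Longrightarrow> v = (\<lambda>s. 0)"
  using cmod_le_l2norm[of v] by auto

lemma cring_complex_field: "cring complex_field"
proof (rule cringI)
  show "abelian_group complex_field"
    by (rule abelian_groupI) (auto simp: complex_field_def algebra_simps intro: exI[of _ "- _"])
  show "Group.comm_monoid complex_field"
    by (rule comm_monoidI) (auto simp: complex_field_def)
qed (auto simp: complex_field_def algebra_simps)

lemma abelian_group_ell2: "abelian_group (ell2 S)"
proof (rule abelian_groupI)
  fix v assume v: "v \<in> carrier (ell2 S)"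
  then show "\<exists>u\<in>carrier (ell2 S). u \<oplus>\<^bsub>ell2 S\<^esub> v = \<zero>\<^bsub>ell2 S\<^esub>"
    by (intro bexI[of _ "\<lambda>s. - v s"]) (auto simp: ell2_simps ell2_add ell2_closed)
qed (auto simp: ell2_simps ell2_add ell2_closed add_ac)

lemma module_ell2: "module complex_field (ell2 S)"
  by (rule moduleI[OF cring_complex_field abelian_group_ell2])
    (auto simp: ell2_simps ell2_add ell2_closed complex_field_def algebra_simps)

lemma ell2_diff: "u \<ominus>\<^bsub>ell2 S\<^esub> v = (\<lambda>s. ell2_part S u s - ell2_part S v s)"
proof -
  interpret abelian_group "ell2 S" by (rule abelian_group_ell2)
  have part: "ell2_part S w \<in> carrier (ell2 S)" for w
    unfolding ell2_part_def using ell2_zero_closed by (auto simp: ell2_def)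
  have ps: "ell2_part S w = w" if "w \<in> carrier (ell2 S)" for w
    using that by (simp add: ell2_def ell2_part_def)
  have "\<ominus>\<^bsub>ell2 S\<^esub> v = (\<lambda>s. - ell2_part S v s)"
    unfolding a_inv_def m_inv_def
  proof (rule the_equality, goal_cases)
    case 1
    show ?case using ell2_minus_closed[OF part[of v]] ps[OF ell2_minus_closed[OF part[of v]]]
      by (auto simp: ell2_def)
  next
    case (2 y)
    then have y: "y \<in> carrier (ell2 S)" and "(\<lambda>s. ell2_part S v s + ell2_part S y s) = (\<lambda>s. 0)"
      by (auto simp: ell2_def)
    then have "ell2_part S v s + y s = 0" for s using ps[OF y] by metis
    then show ?case by (auto simp: fun_eq_iff eq_neg_iff_add_eq_0 add.commute)
  qed
  then show ?thesis
    using ps[OF ell2_minus_closed[OF part[of v]]] by (simp add: a_minus_def ell2_def)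
qed

text \<open>A Cauchy sequence converges pointwise, and the bounds on finite partial sums pass to the limit.\<close>

lemma ell2_complete:
  "Metric_space.mcomplete (carrier (ell2 S)) (\<lambda>u v. hnorm (ell2 S) (u \<ominus>\<^bsub>ell2 S\<^esub> v))"
proof -
  let ?d = "\<lambda>u v. hnorm (ell2 S) (u \<ominus>\<^bsub>ell2 S\<^esub> v)"
  have sq: "square_summable (\<lambda>s. u s - v s)" if "u \<in> carrier (ell2 S)" "v \<in> carrier (ell2 S)" for u v
    using that by (simp add: in_ell2 square_summable_diff)
  have d: "?d u v = l2norm (\<lambda>s. u s - v s)" if "u \<in> carrier (ell2 S)" "v \<in> carrier (ell2 S)" for u v
    using that sq[OF that] by (simp add: ell2_diff hnorm_ell2 ell2_part_def) (simp add: ell2_def)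
  interpret M: Metric_space "carrier (ell2 S)" ?d
  proof
    have part: "ell2_part S w \<in> carrier (ell2 S)" for w
      unfolding ell2_part_def using ell2_zero_closed by (auto simp: ell2_def)
    have d_part: "?d u v = l2norm (\<lambda>s. ell2_part S u s - ell2_part S v s)" for u v
      by (simp add: ell2_diff hnorm_ell2 sq[OF part part])
    show "0 \<le> ?d u v" for u v by (simp only: d_part l2norm_nonneg)
    show "?d u v = ?d v u" for u v
      unfolding d_part using l2norm_minus[of "\<lambda>s. ell2_part S u s - ell2_part S v s"] by simp
    fix u v w assume uv: "u \<in> carrier (ell2 S)" "v \<in> carrier (ell2 S)"
    show "?d u v = 0 \<longleftrightarrow> u = v"
    proof
      assume "?d u v = 0"
      then have "(\<lambda>s. u s - v s) = (\<lambda>s. 0)"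
        using l2norm_eq_0[OF sq[OF uv]] unfolding d[OF uv] by blast
      then show "u = v" by (metis eq_iff_diff_eq_0 ext)
    next
      assume "u = v"
      then show "?d u v = 0" unfolding d[OF uv] by (simp add: l2norm_def)
    qed
    assume w: "w \<in> carrier (ell2 S)"
    show "?d u w \<le> ?d u v + ?d v w"
      using square_summable_add(2)[OF sq[OF uv] sq[OF uv(2) w]] unfolding d[OF uv] d[OF uv(1) w] d[OF uv(2) w] by simp
  qed
  show ?thesis
    unfolding M.mcomplete_def
  proof (intro allI impI)
    fix \<sigma> assume \<sigma>: "M.MCauchy \<sigma>"
    have \<sigma>c: "\<sigma> n \<in> carrier (ell2 S)" for n using \<sigma> by (auto simp: M.MCauchy_def)
    have cau: "\<exists>N. \<forall>m n. N \<le> m \<longrightarrow> N \<le> n \<longrightarrow> l2norm (\<lambda>s. \<sigma> m s - \<sigma> n s) < e" if "e > 0" for e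
      using \<sigma> that unfolding M.MCauchy_def by (simp add: d \<sigma>c)
    have "convergent (\<lambda>n. \<sigma> n s)" for s
    proof (rule Cauchy_convergent, rule metric_CauchyI)
      fix e :: real assume "e > 0"
      then obtain N where N: "\<And>m n. N \<le> m \<Longrightarrow> N \<le> n \<Longrightarrow> l2norm (\<lambda>s. \<sigma> m s - \<sigma> n s) < e" using cau by blast
      show "\<exists>M. \<forall>m\<ge>M. \<forall>n\<ge>M. dist (\<sigma> m s) (\<sigma> n s) < e"
      proof (intro exI[of _ N] allI impI)
        fix m n assume "m \<ge> N" "n \<ge> N"
        have "dist (\<sigma> m s) (\<sigma> n s) \<le> l2norm (\<lambda>s. \<sigma> m s - \<sigma> n s)"
          unfolding dist_norm by (rule cmod_le_l2norm[OF sq[OF \<sigma>c \<sigma>c]])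
        also have "\<dots> < e" by (rule N) fact+
        finally show "dist (\<sigma> m s) (\<sigma> n s) < e" .
      qed
    qed
    then obtain w where w: "\<And>s. (\<lambda>n. \<sigma> n s) \<longlonglongrightarrow> w s" unfolding convergent_def by metis
    have close: "square_summable (\<lambda>s. \<sigma> n s - w s) \<and> l2norm (\<lambda>s. \<sigma> n s - w s) \<le> e"
      if e: "e \<ge> 0" and N: "\<And>m n. N \<le> m \<Longrightarrow> N \<le> n \<Longrightarrow> l2norm (\<lambda>s. \<sigma> m s - \<sigma> n s) < e" and n: "n \<ge> N" for N n e
    proof -
      have "(\<Sum>s\<in>F. (cmod (\<sigma> n s - w s))\<^sup>2) \<le> e\<^sup>2" if F: "finite F" for F
      proof (rule tendsto_upperbound)
        show "(\<lambda>m. \<Sum>s\<in>F. (cmod (\<sigma> n s - \<sigma> m s))\<^sup>2) \<longlonglongrightarrow> (\<Sum>s\<in>F. (cmod (\<sigma> n s - w s))\<^sup>2)"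
          by (intro tendsto_intros w)
        have "(\<Sum>s\<in>F. (cmod (\<sigma> n s - \<sigma> m s))\<^sup>2) \<le> e\<^sup>2" if "m \<ge> N" for m
        proof -
          have "(\<Sum>s\<in>F. (cmod (\<sigma> n s - \<sigma> m s))\<^sup>2) \<le> (l2norm (\<lambda>s. \<sigma> n s - \<sigma> m s))\<^sup>2"
            by (rule finite_sum_le_l2norm[OF sq[OF \<sigma>c \<sigma>c] F])
          also have "\<dots> \<le> e\<^sup>2" using N[OF n that] l2norm_nonneg by (intro power_mono) auto
          finally show ?thesis .
        qed
        then show "\<forall>\<^sub>F m in sequentially. (\<Sum>s\<in>F. (cmod (\<sigma> n s - \<sigma> m s))\<^sup>2) \<le> e\<^sup>2"
          by (auto simp: eventually_sequentially)
      qed simp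
      then show ?thesis using square_summable_boundI[of e "\<lambda>s. \<sigma> n s - w s"] e by blast
    qed
    obtain N1 where N1: "\<And>m n. N1 \<le> m \<Longrightarrow> N1 \<le> n \<Longrightarrow> l2norm (\<lambda>s. \<sigma> m s - \<sigma> n s) < 1" using cau[of 1] by auto
    have "square_summable (\<sigma> N1)" "square_summable (\<lambda>s. \<sigma> N1 s - w s)"
      using close[of 1 N1 N1] N1 \<sigma>c[of N1] by (simp_all add: in_ell2)
    from square_summable_diff[OF this] have "square_summable w" by simp
    moreover have "w s = 0" if "s \<notin> S" for s
      using w[of s] \<sigma>c that by (simp add: in_ell2 LIMSEQ_const_iff)
    ultimately have wc: "w \<in> carrier (ell2 S)" by (simp add: in_ell2)
    have "\<exists>N. \<forall>n\<ge>N. \<sigma> n \<in> carrier (ell2 S) \<and> ?d (\<sigma> n) w < e" if pos: "e > 0" for e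
    proof -
      obtain N where N: "\<And>m n. N \<le> m \<Longrightarrow> N \<le> n \<Longrightarrow> l2norm (\<lambda>s. \<sigma> m s - \<sigma> n s) < e/2"
        using cau[OF half_gt_zero[OF pos]] by blast
      show ?thesis
      proof (intro exI[of _ N] allI impI conjI \<sigma>c)
        fix n assume "n \<ge> N"
        then have "l2norm (\<lambda>s. \<sigma> n s - w s) \<le> e/2" using close[of "e/2" N n] N pos by simp
        then show "?d (\<sigma> n) w < e" using pos by (simp add: d \<sigma>c wc)
      qed
    qed
    then have "limitin M.mtopology \<sigma> w sequentially"
      using wc by (simp add: M.limit_metric_sequentially)
    then show "\<exists>w. limitin M.mtopology \<sigma> w sequentially" by blast
  qed
qed

lemma hilbert_space_ell2: "hilbert_space (ell2 S)"
proof (rule hilbert_space.intro[OF module_ell2], unfold_locales)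
  fix u v w assume "u \<in> carrier (ell2 S)" "v \<in> carrier (ell2 S)" "w \<in> carrier (ell2 S)"
  then show "ip (ell2 S) (u \<oplus>\<^bsub>ell2 S\<^esub> v) w = ip (ell2 S) u w + ip (ell2 S) v w"
    by (simp add: ell2_simps ell2_add in_ell2 ring_distribs infsum_add inner_summable)
next
  fix u v a assume "u \<in> carrier (ell2 S)" "v \<in> carrier (ell2 S)"
  then show "ip (ell2 S) (a \<odot>\<^bsub>ell2 S\<^esub> u) v = a * ip (ell2 S) u v"
    by (simp add: ell2_simps in_ell2 mult.assoc infsum_cmult_right inner_summable)
next
  fix u v show "ip (ell2 S) v u = cnj (ip (ell2 S) u v)"
    by (simp add: ell2_simps mult.commute flip: infsum_cnj)
next
  fix v assume v: "v \<in> carrier (ell2 S)" "v \<noteq> \<zero>\<^bsub>ell2 S\<^esub>"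
  then have "l2norm v \<noteq> 0" using l2norm_eq_0[of v] by (auto simp: ell2_simps in_ell2)
  then show "Re (ip (ell2 S) v v) > 0"
    using v(1) unfolding l2norm_def by (simp add: in_ell2 Re_ip_self infsum_nonneg less_le)
qed (rule ell2_complete)

text \<open>Composition with a bijection \<open>\<phi>\<close> from \<open>T\<close> to \<open>S\<close>, extended by zero.\<close>

definition transport :: "'t set \<Rightarrow> ('t \<Rightarrow> 's) \<Rightarrow> ('s \<Rightarrow> complex) \<Rightarrow> 't \<Rightarrow> complex" where
  "transport T \<phi> v = (\<lambda>t. if t \<in> T then v (\<phi> t) else 0)"

lemma infsum_transport:
  fixes f :: "'s \<Rightarrow> 'b::{comm_monoid_add,t2_space}"
  assumes "bij_betw \<phi> T S" "\<And>s. s \<notin> S \<Longrightarrow> f s = 0"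
  shows "(\<Sum>\<^sub>\<infinity>t. if t \<in> T then f (\<phi> t) else 0) = (\<Sum>\<^sub>\<infinity>s. f s)"
proof -
  have "(\<Sum>\<^sub>\<infinity>t. if t \<in> T then f (\<phi> t) else 0) = (\<Sum>\<^sub>\<infinity>t\<in>T. f (\<phi> t))"
    by (rule infsum_cong_neutral) auto
  also have "\<dots> = (\<Sum>\<^sub>\<infinity>s\<in>S. f s)" by (rule infsum_reindex_bij_betw[OF assms(1)])
  also have "\<dots> = (\<Sum>\<^sub>\<infinity>s. f s)" by (rule infsum_cong_neutral) (use assms(2) in auto)
  finally show ?thesis .
qed

lemma summable_on_transport:
  fixes f :: "'s \<Rightarrow> 'b::{comm_monoid_add,t2_space}"
  assumes "bij_betw \<phi> T S" "\<And>s. s \<notin> S \<Longrightarrow> f s = 0"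
  shows "(\<lambda>t. if t \<in> T then f (\<phi> t) else 0) summable_on UNIV \<longleftrightarrow> f summable_on UNIV"
proof -
  have "(\<lambda>t. if t \<in> T then f (\<phi> t) else 0) summable_on UNIV \<longleftrightarrow> (\<lambda>t. f (\<phi> t)) summable_on T"
    by (rule summable_on_cong_neutral) auto
  also have "\<dots> \<longleftrightarrow> f summable_on S" by (rule summable_on_reindex_bij_betw[OF assms(1)])
  also have "\<dots> \<longleftrightarrow> f summable_on UNIV" by (rule summable_on_cong_neutral) (use assms(2) in auto)
  finally show ?thesis .
qed

lemma transport_carrier:
  assumes \<phi>: "bij_betw \<phi> T S" and v: "v \<in> carrier (ell2 S)"
  shows "transport T \<phi> v \<in> carrier (ell2 T)"
proof -
  have "(\<lambda>t. (cmod (transport T \<phi> v t))\<^sup>2) = (\<lambda>t. if t \<in> T then (cmod (v (\<phi> t)))\<^sup>2 else 0)"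
    by (auto simp: transport_def fun_eq_iff)
  then show ?thesis
    using v summable_on_transport[OF \<phi>, of "\<lambda>s. (cmod (v s))\<^sup>2"]
    by (simp add: in_ell2 square_summable_def) (simp add: transport_def)
qed

lemma transport_id: "v \<in> carrier (ell2 S) \<Longrightarrow> (\<And>s. s \<in> S \<Longrightarrow> \<phi> s = s) \<Longrightarrow> transport S \<phi> v = v"
  by (auto simp: transport_def in_ell2 fun_eq_iff)

lemma transport_transport:
  assumes "\<And>t. t \<in> T \<Longrightarrow> \<phi> t \<in> S"
  shows "transport T \<phi> (transport S \<psi> v) = transport T (\<lambda>t. \<psi> (\<phi> t)) v"
  using assms by (auto simp: transport_def fun_eq_iff)

lemma unitary_transport:
  assumes \<phi>: "bij_betw \<phi> T S"
  shows "unitary_map (ell2 S) (ell2 T) (transport T \<phi>)"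
  unfolding unitary_map_def
proof (intro conjI ballI allI)
  define \<psi> where "\<psi> = inv_into T \<phi>"
  have \<psi>: "bij_betw \<psi> S T" "\<And>s. s \<in> S \<Longrightarrow> \<phi> (\<psi> s) = s" "\<And>t. t \<in> T \<Longrightarrow> \<psi> (\<phi> t) = t"
    using \<phi> bij_betw_inv_into[OF \<phi>] bij_betw_inv_into_right[OF \<phi>] bij_betw_inv_into_left[OF \<phi>]
    by (auto simp: \<psi>_def)
  have mem: "\<And>t. t \<in> T \<Longrightarrow> \<phi> t \<in> S" "\<And>s. s \<in> S \<Longrightarrow> \<psi> s \<in> T"
    using \<phi> \<psi>(1) by (auto simp: bij_betw_def)
  show "bij_betw (transport T \<phi>) (carrier (ell2 S)) (carrier (ell2 T))"
  proof (rule bij_betwI[where g = "transport S \<psi>"])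
    show "transport T \<phi> \<in> carrier (ell2 S) \<rightarrow> carrier (ell2 T)" using transport_carrier[OF \<phi>] by blast
    show "transport S \<psi> \<in> carrier (ell2 T) \<rightarrow> carrier (ell2 S)" using transport_carrier[OF \<psi>(1)] by blast
    show "transport S \<psi> (transport T \<phi> v) = v" if "v \<in> carrier (ell2 S)" for v
      using transport_transport[of S \<psi> T \<phi> v] mem(2) transport_id[OF that, of "\<lambda>s. \<phi> (\<psi> s)"] \<psi>(2) by simp
    show "transport T \<phi> (transport S \<psi> v) = v" if "v \<in> carrier (ell2 T)" for v
      using transport_transport[of T \<phi> S \<psi> v] mem(1) transport_id[OF that, of "\<lambda>t. \<psi> (\<phi> t)"] \<psi>(3) by simp
  qed
  fix u v assume uv: "u \<in> carrier (ell2 S)" "v \<in> carrier (ell2 S)"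
  have "ip (ell2 T) (transport T \<phi> u) (transport T \<phi> v) = (\<Sum>\<^sub>\<infinity>t. if t \<in> T then u (\<phi> t) * cnj (v (\<phi> t)) else 0)"
    unfolding ell2_simps by (rule infsum_cong) (simp add: transport_def)
  also have "\<dots> = ip (ell2 S) u v"
    unfolding ell2_simps by (rule infsum_transport[OF \<phi>]) (use uv in \<open>simp add: in_ell2\<close>)
  finally show "ip (ell2 T) (transport T \<phi> u) (transport T \<phi> v) = ip (ell2 S) u v" .
next
  fix u v assume uv: "u \<in> carrier (ell2 S)" "v \<in> carrier (ell2 S)"
  show "transport T \<phi> (u \<oplus>\<^bsub>ell2 S\<^esub> v) = transport T \<phi> u \<oplus>\<^bsub>ell2 T\<^esub> transport T \<phi> v"
    using uv transport_carrier[OF \<phi>] by (simp add: ell2_add) (simp add: transport_def fun_eq_iff)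
qed (auto simp: ell2_simps transport_def fun_eq_iff)

section \<open>The cocycle on pairs of branches\<close>

text \<open>The triple \<open>(b, C, C')\<close> is encoded as the list \<open>[{b}, C, C']\<close>, so that a homeomorphism acts on all its entries in the same way.\<close>

definition triples :: "'x topology \<Rightarrow> 'x set list set" where
  "triples X = {[{b}, cut_comp X b x, cut_comp X b y] | b x y.
     b \<in> topspace X \<and> x \<in> topspace X - {b} \<and> y \<in> topspace X - {b} \<and> cut_comp X b x \<noteq> cut_comp X b y}"

text \<open>Preimages rather than images, since functions on the triples are moved forward by composing them with the inverse map on triples.\<close>

definition pull :: "'x topology \<Rightarrow> ('x \<Rightarrow> 'y) \<Rightarrow> 'y set list \<Rightarrow> 'x set list" where
  "pull X h = map (\<lambda>C. {x \<in> topspace X. h x \<in> C})"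

lemma pull_pull:
  "(\<And>x. x \<in> topspace X \<Longrightarrow> h x \<in> topspace Y) \<Longrightarrow> pull X h (pull Y k s) = pull X (\<lambda>x. k (h x)) s"
  unfolding pull_def by (induction s) auto

lemma pull_cong: "(\<And>x. x \<in> topspace X \<Longrightarrow> h x = k x) \<Longrightarrow> pull X h s = pull X k s"
  unfolding pull_def by (induction s) auto

lemma triplesE:
  assumes "s \<in> triples X"
  obtains b x y where "s = [{b}, cut_comp X b x, cut_comp X b y]" "b \<in> topspace X"
    "x \<in> topspace X - {b}" "y \<in> topspace X - {b}" "cut_comp X b x \<noteq> cut_comp X b y"
  using assms unfolding triples_def by blast

lemma pull_id: "s \<in> triples X \<Longrightarrow> (\<And>x. x \<in> topspace X \<Longrightarrow> h x = x) \<Longrightarrow> pull X h s = s"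
proof (erule triplesE)
  fix b x y
  assume s: "s = [{b}, cut_comp X b x, cut_comp X b y]" "b \<in> topspace X" and h: "\<And>x. x \<in> topspace X \<Longrightarrow> h x = x"
  have "{u \<in> topspace X. h u \<in> C} = C" if "C \<subseteq> topspace X" for C
    using that h by auto
  then show "pull X h s = s"
    using s cut_comp_subset[of X b x] cut_comp_subset[of X b y] by (auto simp: pull_def)
qed

lemma bij_betw_pull:
  assumes h: "homeomorphic_map X Y h"
  shows "bij_betw (pull X h) (triples Y) (triples X)"
proof (rule bij_betwI[where g = "map (image h)"])
  have inj: "inj_on h (topspace X)" and im: "h ` topspace X = topspace Y"
    using h by (auto simp: homeomorphic_eq_everything_map)
  have hC: "{u \<in> topspace X. h u \<in> h ` C} = C" if "C \<subseteq> topspace X" for C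
    using that inj by (auto simp: inj_on_def)
  have push: "map (image h) s \<in> triples Y \<and> pull X h (map (image h) s) = s" if s: "s \<in> triples X" for s
  proof -
    obtain b x y where s: "s = [{b}, cut_comp X b x, cut_comp X b y]" "b \<in> topspace X"
      "x \<in> topspace X - {b}" "y \<in> topspace X - {b}" "cut_comp X b x \<noteq> cut_comp X b y"
      using s by (rule triplesE)
    have C: "cut_comp X b x \<subseteq> topspace X" "cut_comp X b y \<subseteq> topspace X" using cut_comp_subset[of X b] by blast+
    have e: "map (image h) s = [{h b}, cut_comp Y (h b) (h x), cut_comp Y (h b) (h y)]"
      using s homeomorphic_map_cut_comp[OF h _ s(2)] by simp
    have "cut_comp Y (h b) (h x) \<noteq> cut_comp Y (h b) (h y)"
      using s(3-5) C inj_on_image_eq_iff[OF inj C] homeomorphic_map_cut_comp[OF h _ s(2)] by (metis DiffD1)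
    moreover have "h x \<in> topspace Y - {h b}" "h y \<in> topspace Y - {h b}" "h b \<in> topspace Y"
      using s inj im by (auto simp: inj_on_eq_iff)
    ultimately have "map (image h) s \<in> triples Y" unfolding e triples_def by blast
    moreover have "pull X h (map (image h) s) = s"
      using s(1,2) hC[OF C(1)] hC[OF C(2)] hC[of "{b}"] by (simp add: pull_def)
    ultimately show ?thesis by blast
  qed
  have surj: "\<exists>t\<in>triples X. s = map (image h) t" if sY: "s \<in> triples Y" for s
  proof -
    obtain c x y where s: "s = [{c}, cut_comp Y c x, cut_comp Y c y]" "c \<in> topspace Y"
      "x \<in> topspace Y - {c}" "y \<in> topspace Y - {c}" "cut_comp Y c x \<noteq> cut_comp Y c y"
      using sY by (rule triplesE)
    obtain b u v where b: "b \<in> topspace X" "c = h b" "u \<in> topspace X" "x = h u" "v \<in> topspace X" "y = h v"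
      using s im by blast
    have hu: "h ` cut_comp X b u = cut_comp Y c x" "h ` cut_comp X b v = cut_comp Y c y"
      using homeomorphic_map_cut_comp[OF h _ b(1)] b by auto
    then have "cut_comp X b u \<noteq> cut_comp X b v" using s(5) by metis
    then have "[{b}, cut_comp X b u, cut_comp X b v] \<in> triples X"
      using b s unfolding triples_def by blast
    moreover have "s = map (image h) [{b}, cut_comp X b u, cut_comp X b v]" using s hu b by simp
    ultimately show ?thesis by blast
  qed
  show "pull X h \<in> triples Y \<rightarrow> triples X" using surj push by fastforce
  show "map (image h) \<in> triples X \<rightarrow> triples Y" using push by blast
  show "map (image h) (pull X h s) = s" if "s \<in> triples Y" for s using surj[OF that] push by auto
  show "pull X h (map (image h) s) = s" if "s \<in> triples X" for s using push[OF that] by blast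
qed

lemma pull_in_triples: "homeomorphic_map X Y h \<Longrightarrow> s \<in> triples Y \<Longrightarrow> pull X h s \<in> triples X"
  using bij_betw_pull bij_betwE by metis

definition crossing :: "'x set list \<Rightarrow> 'x \<Rightarrow> 'x \<Rightarrow> complex" where
  "crossing s x y = of_bool (x \<in> s ! 1 \<and> y \<in> s ! 2) - of_bool (x \<in> s ! 2 \<and> y \<in> s ! 1)"

definition branch_cocycle :: "'x topology \<Rightarrow> 'x \<Rightarrow> 'x \<Rightarrow> 'x \<Rightarrow> 'x set list \<Rightarrow> complex" where
  "branch_cocycle X x y z s = (if s \<in> triples X then crossing s y z - crossing s x z + crossing s x y else 0)"

lemma crossing_pull:
  assumes "s \<in> triples Y" "x \<in> topspace X" "y \<in> topspace X"
  shows "crossing (pull X h s) x y = crossing s (h x) (h y)"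
  using assms(1) by (rule triplesE) (simp add: crossing_def pull_def assms(2,3))

lemma transport_branch_cocycle:
  assumes h: "homeomorphic_map X Y h" and xyz: "x \<in> topspace X" "y \<in> topspace X" "z \<in> topspace X"
  shows "transport (triples Y) (pull X h) (branch_cocycle X x y z) = branch_cocycle Y (h x) (h y) (h z)"
  using pull_in_triples[OF h] by (auto simp: transport_def branch_cocycle_def fun_eq_iff crossing_pull xyz)

context cut_space
begin

lemma triple_disjoint: "s \<in> triples X \<Longrightarrow> s ! 1 \<inter> s ! 2 = {}"
proof (erule triplesE)
  fix b x y assume s: "s = [{b}, comp b x, comp b y]" and ne: "comp b x \<noteq> comp b y"
  have "u \<notin> comp b y" if "u \<in> comp b x" for u
    using that ne cut_comp_eq[of u X b x] cut_comp_eq[of u X b y] by metis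
  then show "s ! 1 \<inter> s ! 2 = {}" using s by auto
qed

text \<open>The point is unique by \<open>separating_point_unique\<close>, and it determines the components of \<open>u\<close> and \<open>v\<close>.\<close>

lemma triple_determined:
  assumes s: "s \<in> triples X" "u \<in> s ! 1" "v \<in> s ! 2" "w \<notin> s ! 1" "w \<notin> s ! 2"
    and t: "t \<in> triples X" "u \<in> t ! 1" "v \<in> t ! 2" "w \<notin> t ! 1" "w \<notin> t ! 2"
    and w: "w \<in> topspace X"
  shows "s = t"
proof -
  have *: "\<exists>b. b \<in> topspace X \<and> s = [{b}, comp b u, comp b v] \<and> u \<in> topspace X - {b} \<and> v \<in> topspace X - {b} \<and>
    comp b u \<noteq> comp b v" if s: "s \<in> triples X" "u \<in> s ! 1" "v \<in> s ! 2" for s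
  proof -
    obtain b x y where b: "s = [{b}, comp b x, comp b y]" "b \<in> topspace X" "comp b x \<noteq> comp b y"
      using s(1) by (rule triplesE)
    have uv: "u \<in> comp b x" "v \<in> comp b y" using s(2,3) b(1) by auto
    then have "comp b u = comp b x" "comp b v = comp b y" using cut_comp_eq by metis+
    then show ?thesis
      using b uv cut_comp_subset[of X b x] cut_comp_subset[of X b y] by (intro exI[of _ b]) auto
  qed
  obtain b where b: "b \<in> topspace X" "s = [{b}, comp b u, comp b v]" "u \<in> topspace X - {b}" "v \<in> topspace X - {b}"
    "comp b u \<noteq> comp b v" using *[OF s(1-3)] by blast
  obtain c where c: "c \<in> topspace X" "t = [{c}, comp c u, comp c v]" "u \<in> topspace X - {c}" "v \<in> topspace X - {c}"
    "comp c u \<noteq> comp c v" using *[OF t(1-3)] by blast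
  have "b = c"
    by (rule separating_point_unique[of b c u v w]) (use b c s t w in auto)
  then show ?thesis using b c by simp
qed

text \<open>The value at \<open>(b, C, C')\<close> is the determinant of the matrix with rows \<open>(1, 1, 1)\<close>, the indicator of \<open>C\<close> and the indicator of \<open>C'\<close> at
\<open>x\<close>, \<open>y\<close>, \<open>z\<close>. It vanishes unless the three points are distributed among \<open>C\<close>, \<open>C'\<close> and the rest; each of the six
distributions occurs for at most one triple.\<close>

lemma branch_cocycle_support:
  assumes "x \<in> topspace X" "y \<in> topspace X" "z \<in> topspace X"
  shows "finite {s. branch_cocycle X x y z s \<noteq> 0}" "card {s. branch_cocycle X x y z s \<noteq> 0} \<le> 6"
proof -
  define T where "T u v w = {s \<in> triples X. u \<in> s ! 1 \<and> v \<in> s ! 2 \<and> w \<notin> s ! 1 \<and> w \<notin> s ! 2}" for u v w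
  have T: "finite (T u v w) \<and> card (T u v w) \<le> 1" if w: "w \<in> topspace X" for u v w
  proof (cases "T u v w = {}")
    case False
    then obtain s where s: "s \<in> T u v w" by blast
    have "T u v w \<subseteq> {s}"
    proof
      fix t assume "t \<in> T u v w"
      then have "t = s" using s triple_determined[of t u v w s] w unfolding T_def by blast
      then show "t \<in> {s}" by simp
    qed
    then have "T u v w = {s}" using s by blast
    then show ?thesis by simp
  qed simp
  define \<T> where "\<T> = [T x y z, T y x z, T x z y, T z x y, T y z x, T z y x]"
  have sub: "{s. branch_cocycle X x y z s \<noteq> 0} \<subseteq> \<Union>(set \<T>)"
  proof
    fix s assume "s \<in> {s. branch_cocycle X x y z s \<noteq> 0}"
    then have s: "s \<in> triples X" and n: "crossing s y z - crossing s x z + crossing s x y \<noteq> 0"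
      by (auto simp: branch_cocycle_def split: if_splits)
    have d: "\<not> (u \<in> s ! 1 \<and> u \<in> s ! 2)" for u using triple_disjoint[OF s] by blast
    show "s \<in> \<Union>(set \<T>)"
      using n d[of x] d[of y] d[of z] s unfolding \<T>_def T_def crossing_def
      by (cases "x \<in> s ! 1"; cases "x \<in> s ! 2"; cases "y \<in> s ! 1"; cases "y \<in> s ! 2"; cases "z \<in> s ! 1"; cases "z \<in> s ! 2") simp_all
  qed
  have fin: "finite (\<Union>(set \<T>))" using T assms by (auto simp: \<T>_def)
  show "finite {s. branch_cocycle X x y z s \<noteq> 0}" using finite_subset[OF sub fin] .
  have "card (\<Union>(set \<T>)) \<le> (\<Sum>S\<in>set \<T>. card S)" by (rule card_Union_le_sum_card)
  also have "\<dots> \<le> (\<Sum>S\<in>set \<T>. 1)" by (rule sum_mono) (use T assms in \<open>auto simp: \<T>_def\<close>)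
  also have "\<dots> \<le> 6" using card_length[of \<T>] by (simp add: \<T>_def)
  finally show "card {s. branch_cocycle X x y z s \<noteq> 0} \<le> 6" using card_mono[OF fin sub] by simp
qed

lemma branch_cocycle_bounded:
  assumes "x \<in> topspace X" "y \<in> topspace X" "z \<in> topspace X"
  shows "branch_cocycle X x y z \<in> carrier (ell2 (triples X))" "l2norm (branch_cocycle X x y z) \<le> 8"
proof -
  let ?w = "branch_cocycle X x y z"
  have le: "cmod (crossing s u v) \<le> 1" if "s \<in> triples X" for s u v
    unfolding crossing_def by (auto simp: of_bool_def)
  have w3: "cmod (?w s) \<le> 3" for s
  proof (cases "s \<in> triples X")
    case True
    have "cmod (crossing s y z - crossing s x z + crossing s x y) \<le> cmod (crossing s y z) + cmod (crossing s x z) + cmod (crossing s x y)"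
      by (meson add_mono_thms_linordered_semiring(3) norm_triangle_ineq4 norm_triangle_le)
    then show ?thesis using le[OF True, of y z] le[OF True, of x z] le[OF True, of x y] True
      by (simp add: branch_cocycle_def)
  qed (simp add: branch_cocycle_def)
  have "(\<Sum>s\<in>F. (cmod (?w s))\<^sup>2) \<le> 8\<^sup>2" if F: "finite F" for F
  proof -
    have "(\<Sum>s\<in>F. (cmod (?w s))\<^sup>2) = (\<Sum>s\<in>F \<inter> {s. ?w s \<noteq> 0}. (cmod (?w s))\<^sup>2)"
      using F by (intro sum.mono_neutral_right) auto
    also have "\<dots> \<le> (\<Sum>s\<in>F \<inter> {s. ?w s \<noteq> 0}. 3\<^sup>2)"
      using w3 by (intro sum_mono power_mono) auto
    also have "\<dots> = 9 * card (F \<inter> {s. ?w s \<noteq> 0})" by simp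
    also have "\<dots> \<le> 9 * card {s. ?w s \<noteq> 0}"
      using branch_cocycle_support(1)[OF assms] by (simp add: card_mono)
    also have "\<dots> \<le> 9 * 6" using branch_cocycle_support(2)[OF assms] by simp
    finally show ?thesis by simp
  qed
  then show "l2norm ?w \<le> 8" "?w \<in> carrier (ell2 (triples X))"
    using square_summable_boundI[of 8 ?w] by (auto simp: in_ell2 branch_cocycle_def)
qed

end

section \<open>The representation and its bounded cohomology class\<close>

definition rep_space :: "('g, 'x) action \<Rightarrow> ('x set list \<Rightarrow> complex) hilbert" where
  "rep_space A = ell2 (triples (act_space A))"

definition carry :: "'x topology \<Rightarrow> 'y topology \<Rightarrow> ('x \<Rightarrow> 'y) \<Rightarrow> ('x set list \<Rightarrow> complex) \<Rightarrow> 'y set list \<Rightarrow> complex" where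
  "carry X Y h = transport (triples Y) (pull X h)"

text \<open>The restriction to the carrier makes the maps extensional, as required of elements of a group of bijections.\<close>

definition rep :: "('g, 'x) action \<Rightarrow> 'g \<Rightarrow> ('x set list \<Rightarrow> complex) \<Rightarrow> 'x set list \<Rightarrow> complex" where
  "rep A g = (\<lambda>v\<in>carrier (rep_space A). carry (act_space A) (act_space A) (act_map A g) v)"

lemma unitary_carry:
  "homeomorphic_map X Y h \<Longrightarrow> unitary_map (ell2 (triples X)) (ell2 (triples Y)) (carry X Y h)"
  unfolding carry_def by (intro unitary_transport bij_betw_pull)

lemma carry_closed:
  "homeomorphic_map X Y h \<Longrightarrow> v \<in> carrier (ell2 (triples X)) \<Longrightarrow> carry X Y h v \<in> carrier (ell2 (triples Y))"
  unfolding carry_def by (rule transport_carrier[OF bij_betw_pull])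

lemma carry_carry:
  assumes "homeomorphic_map X Y h" "homeomorphic_map Y Z k"
  shows "carry Y Z k (carry X Y h v) = carry X Z (\<lambda>x. k (h x)) v"
proof -
  have hX: "h x \<in> topspace Y" if "x \<in> topspace X" for x
    using assms(1) that by (auto simp: homeomorphic_eq_everything_map)
  show ?thesis
    unfolding carry_def using pull_in_triples[OF assms(2)] by (simp add: transport_transport pull_pull[where Y = Y, OF hX])
qed

lemma carry_cong:
  assumes "\<And>x. x \<in> topspace X \<Longrightarrow> h x = k x"
  shows "carry X Y h v = carry X Y k v"
proof -
  have "pull X h = pull X k" using pull_cong[of X h k] assms by (intro ext) blast
  then show ?thesis by (simp add: carry_def)
qed

lemma carry_id:
  assumes "v \<in> carrier (ell2 (triples X))" "\<And>x. x \<in> topspace X \<Longrightarrow> h x = x"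
  shows "carry X X h v = v"
  unfolding carry_def using assms(1) by (rule transport_id) (rule pull_id[OF _ assms(2)])

lemma carry_add:
  "carry X Y h (\<lambda>s. u s + v s) = (\<lambda>s. carry X Y h u s + carry X Y h v s)"
  "carry X Y h (\<lambda>s. u s - v s) = (\<lambda>s. carry X Y h u s - carry X Y h v s)"
  by (auto simp: carry_def transport_def fun_eq_iff)

lemma carry_branch_cocycle:
  "homeomorphic_map X Y h \<Longrightarrow> x \<in> topspace X \<Longrightarrow> y \<in> topspace X \<Longrightarrow> z \<in> topspace X \<Longrightarrow>
    carry X Y h (branch_cocycle X x y z) = branch_cocycle Y (h x) (h y) (h z)"
  unfolding carry_def by (rule transport_branch_cocycle)

lemma l2norm_carry:
  assumes h: "homeomorphic_map X Y h" and v: "v \<in> carrier (ell2 (triples X))"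
  shows "l2norm (carry X Y h v) = l2norm v"
proof -
  have "hnorm (ell2 (triples Y)) (carry X Y h v) = hnorm (ell2 (triples X)) v"
    using unitary_carry[OF h] v unfolding unitary_map_def hnorm_def by simp
  then show ?thesis using v carry_closed[OF h v] by (simp add: hnorm_ell2 in_ell2)
qed

lemma finsum_ell2:
  assumes "finite I" "\<And>i. i \<in> I \<Longrightarrow> f i \<in> carrier (ell2 S)"
  shows "finsum (ell2 S) f I = (\<lambda>s. \<Sum>i\<in>I. f i s) \<and> (\<lambda>s. \<Sum>i\<in>I. f i s) \<in> carrier (ell2 S)"
  using assms
proof (induction I rule: finite_induct)
  case empty
  interpret abelian_group "ell2 S" by (rule abelian_group_ell2)
  show ?case by (simp add: ell2_simps ell2_zero_closed)
next
  case (insert i I)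
  interpret abelian_group "ell2 S" by (rule abelian_group_ell2)
  have "finsum (ell2 S) f (insert i I) = f i \<oplus>\<^bsub>ell2 S\<^esub> finsum (ell2 S) f I"
    using insert by (intro finsum_insert) auto
  then show ?case using insert by (simp add: ell2_add ell2_add_closed)
qed

lemma bdelta_ell2:
  assumes f: "\<And>gs. gs \<in> tuples G n \<Longrightarrow> f gs \<in> carrier (ell2 S)" and gs: "gs \<in> tuples G (Suc n)"
  shows "bdelta G (ell2 S) n f gs = (\<lambda>s. \<Sum>i\<le>Suc n. (-1) ^ i * f (take i gs @ drop (Suc i) gs) s)"
proof -
  have "take i gs @ drop (Suc i) gs \<in> tuples G n" if "i \<le> Suc n" for i
    using gs that set_take_subset[of i gs] set_drop_subset[of "Suc i" gs] by (auto simp: tuples_def)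
  then have "finsum (ell2 S) (\<lambda>i. (-1) ^ i \<odot>\<^bsub>ell2 S\<^esub> f (take i gs @ drop (Suc i) gs)) {..Suc n} =
      (\<lambda>s. \<Sum>i\<le>Suc n. ((-1) ^ i \<odot>\<^bsub>ell2 S\<^esub> f (take i gs @ drop (Suc i) gs)) s)"
    using f by (intro conjunct1[OF finsum_ell2]) (auto simp: ell2_simps ell2_cmult_closed)
  then show ?thesis using gs by (simp add: bdelta_def ell2_simps)
qed

lemma tuples_1: "gs \<in> tuples G (Suc 0) \<longleftrightarrow> (\<exists>a\<in>carrier G. \<exists>b\<in>carrier G. gs = [a, b])"
  by (auto simp: tuples_def length_Suc_conv)

lemma tuples_2: "gs \<in> tuples G 2 \<longleftrightarrow> (\<exists>a\<in>carrier G. \<exists>b\<in>carrier G. \<exists>c\<in>carrier G. gs = [a, b, c])"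
  by (auto simp: tuples_def length_Suc_conv numeral_2_eq_2)

lemma tuples_3: "gs \<in> tuples G 3 \<longleftrightarrow>
    (\<exists>a\<in>carrier G. \<exists>b\<in>carrier G. \<exists>c\<in>carrier G. \<exists>d\<in>carrier G. gs = [a, b, c, d])"
proof -
  have *: "tuples G 3 = {gs. length gs = Suc (Suc (Suc (Suc 0))) \<and> set gs \<subseteq> carrier G}"
    by (simp only: tuples_def numeral_3_eq_3)
  show ?thesis unfolding * mem_Collect_eq length_Suc_conv by auto
qed

lemma bdelta_1:
  assumes f: "\<And>gs. gs \<in> tuples G 1 \<Longrightarrow> f gs \<in> carrier (ell2 S)" and "a \<in> carrier G" "b \<in> carrier G" "c \<in> carrier G"
  shows "bdelta G (ell2 S) 1 f [a, b, c] = (\<lambda>s. f [b, c] s - f [a, c] s + f [a, b] s)"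
  using bdelta_ell2[of G 1 f S "[a, b, c]", OF f] assms(2-4) by (simp add: tuples_def numeral_2_eq_2)

lemma bdelta_2:
  assumes f: "\<And>gs. gs \<in> tuples G 2 \<Longrightarrow> f gs \<in> carrier (ell2 S)"
    and "a \<in> carrier G" "b \<in> carrier G" "c \<in> carrier G" "d \<in> carrier G"
  shows "bdelta G (ell2 S) 2 f [a, b, c, d] = (\<lambda>s. f [b, c, d] s - f [a, c, d] s + f [a, b, d] s - f [a, b, c] s)"
  using bdelta_ell2[of G 2 f S "[a, b, c, d]", OF f] assms(2-5)
  by (simp add: tuples_def numeral_2_eq_2)

locale dendrite_action =
  fixes A :: "('g, 'x) action"
  assumes nonelementary: "nonelementary_dendrite_action A"
begin

abbreviation X where "X \<equiv> act_space A"
abbreviation G where "G \<equiv> act_group A"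
abbreviation act where "act \<equiv> act_map A"
abbreviation V where "V \<equiv> rep_space A"

sublocale cut_action X G act
proof (intro cut_action.intro cut_action_axioms.intro)
  show "cut_space X" using nonelementary by (simp add: nonelementary_dendrite_action_def dendrite_cut_space)
qed (use nonelementary in \<open>auto simp: nonelementary_dendrite_action_def action_by_homeos_def dendrite_def continuum_def\<close>)

lemma rep_eq: "v \<in> carrier V \<Longrightarrow> rep A g v = carry X X (act g) v"
  by (simp add: rep_def)

lemma rep_closed: "g \<in> carrier G \<Longrightarrow> v \<in> carrier V \<Longrightarrow> rep A g v \<in> carrier V"
  using carry_closed[OF homeo] by (simp add: rep_eq) (simp add: rep_space_def)

lemma unitary_rep_rep: "unitary_rep G V (rep A)"
  unfolding unitary_rep_def
proof (intro conjI ballI)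
  show "hilbert_space V" unfolding rep_space_def by (rule hilbert_space_ell2)
  show uni: "unitary_map V V (rep A g)" if "g \<in> carrier G" for g
  proof -
    have V: "module complex_field V" unfolding rep_space_def by (rule module_ell2)
    interpret module complex_field V by (rule V)
    have u: "unitary_map V V (carry X X (act g))"
      unfolding rep_space_def by (rule unitary_carry[OF homeo[OF that]])
    moreover have "bij_betw (rep A g) (carrier V) (carrier V) \<longleftrightarrow> bij_betw (carry X X (act g)) (carrier V) (carrier V)"
      by (rule bij_betw_cong) (rule rep_eq)
    moreover have "a \<odot>\<^bsub>V\<^esub> v \<in> carrier V" if "v \<in> carrier V" for a v
      using that by (simp add: rep_space_def ell2_simps ell2_cmult_closed)
    ultimately show ?thesis unfolding unitary_map_def by (simp add: rep_eq)
  qed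
  have bij: "rep A g \<in> Bij (carrier V)" if "g \<in> carrier G" for g
    using uni[OF that] unfolding Bij_def unitary_map_def by (simp add: rep_def)
  have mult: "rep A (g \<otimes>\<^bsub>G\<^esub> h) = compose (carrier V) (rep A g) (rep A h)"
    if gh: "g \<in> carrier G" "h \<in> carrier G" for g h
  proof
    fix v show "rep A (g \<otimes>\<^bsub>G\<^esub> h) v = compose (carrier V) (rep A g) (rep A h) v"
    proof (cases "v \<in> carrier V")
      case True
      have "rep A g (rep A h v) = carry X X (\<lambda>x. act g (act h x)) v"
        using carry_carry[OF homeo[OF gh(2)] homeo[OF gh(1)]] rep_closed[OF gh(2) True] True by (simp add: rep_eq)
      also have "\<dots> = rep A (g \<otimes>\<^bsub>G\<^esub> h) v"
        using act_mult[OF gh] by (simp add: rep_eq[OF True] carry_cong[of X "act (g \<otimes>\<^bsub>G\<^esub> h)" "\<lambda>x. act g (act h x)"])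
      finally show ?thesis using True by (simp add: compose_def)
    qed (simp add: rep_def compose_def)
  qed
  show "group_action G (carrier V) (rep A)"
    unfolding group_action_def group_hom_def group_hom_axioms_def
    using group_G group_BijGroup bij mult by (auto simp: hom_def BijGroup_def)
qed

text \<open>The bounded equivariant cochains of degree 1, as functions of two arguments.\<close>

definition bounded_equivariant :: "('g \<Rightarrow> 'g \<Rightarrow> 'x set list \<Rightarrow> complex) \<Rightarrow> bool" where
  "bounded_equivariant F \<longleftrightarrow> (\<forall>a\<in>carrier G. \<forall>b\<in>carrier G. F a b \<in> carrier V) \<and>
     (\<exists>C. \<forall>a\<in>carrier G. \<forall>b\<in>carrier G. l2norm (F a b) \<le> C) \<and>
     (\<forall>g\<in>carrier G. \<forall>a\<in>carrier G. \<forall>b\<in>carrier G. F (g \<otimes>\<^bsub>G\<^esub> a) (g \<otimes>\<^bsub>G\<^esub> b) = carry X X (act g) (F a b))"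

lemma hnorm_V: "v \<in> carrier V \<Longrightarrow> hnorm V v = l2norm v"
  by (simp add: rep_space_def hnorm_ell2 in_ell2)

lemma bounded_equivariant_cochain:
  assumes "bounded_equivariant F"
  shows "(\<lambda>gs\<in>tuples G 1. F (gs ! 0) (gs ! 1)) \<in> carrier (bcochains G V (rep A) 1)"
proof -
  obtain C where C: "\<And>a b. a \<in> carrier G \<Longrightarrow> b \<in> carrier G \<Longrightarrow> l2norm (F a b) \<le> C"
    using assms unfolding bounded_equivariant_def by blast
  have F: "\<And>a b. a \<in> carrier G \<Longrightarrow> b \<in> carrier G \<Longrightarrow> F a b \<in> carrier V"
    and eq: "\<And>g a b. g \<in> carrier G \<Longrightarrow> a \<in> carrier G \<Longrightarrow> b \<in> carrier G \<Longrightarrow>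
      F (g \<otimes>\<^bsub>G\<^esub> a) (g \<otimes>\<^bsub>G\<^esub> b) = carry X X (act g) (F a b)"
    using assms unfolding bounded_equivariant_def by blast+
  let ?f = "\<lambda>gs\<in>tuples G 1. F (gs ! 0) (gs ! 1)"
  have "?f \<in> tuples G 1 \<rightarrow>\<^sub>E carrier V" using F by (auto simp: tuples_1)
  moreover have "\<forall>gs\<in>tuples G 1. hnorm V (?f gs) \<le> C" using F C by (auto simp: tuples_1 hnorm_V)
  moreover have "?f (map (\<lambda>x. g \<otimes>\<^bsub>G\<^esub> x) gs) = rep A g (?f gs)" if g: "g \<in> carrier G" and gs: "gs \<in> tuples G 1" for g gs
  proof -
    obtain a b where ab: "a \<in> carrier G" "b \<in> carrier G" "gs = [a, b]" using gs by (auto simp: tuples_1)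
    then have "map (\<lambda>x. g \<otimes>\<^bsub>G\<^esub> x) gs \<in> tuples G 1" using g mult_closed by (simp add: tuples_1)
    then show ?thesis using gs ab F eq[OF g ab(1,2)] by (simp add: rep_eq)
  qed
  ultimately show ?thesis unfolding bcochains_def by auto
qed

lemma cochain_bounded_equivariant:
  assumes f: "f \<in> carrier (bcochains G V (rep A) 1)"
  shows "bounded_equivariant (\<lambda>a b. f [a, b])"
proof -
  have F: "f \<in> tuples G 1 \<rightarrow>\<^sub>E carrier V" and b: "\<exists>C. \<forall>gs\<in>tuples G 1. hnorm V (f gs) \<le> C"
    and e: "\<And>g gs. g \<in> carrier G \<Longrightarrow> gs \<in> tuples G 1 \<Longrightarrow> f (map (\<lambda>x. g \<otimes>\<^bsub>G\<^esub> x) gs) = rep A g (f gs)"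
    using f unfolding bcochains_def by simp_all
  have t: "[a, b] \<in> tuples G 1" if "a \<in> carrier G" "b \<in> carrier G" for a b using that by (simp add: tuples_1)
  have V: "f [a, b] \<in> carrier V" if "a \<in> carrier G" "b \<in> carrier G" for a b using F t[OF that] by blast
  obtain C where C: "\<And>gs. gs \<in> tuples G 1 \<Longrightarrow> hnorm V (f gs) \<le> C" using b by blast
  have "l2norm (f [a, b]) \<le> C" if "a \<in> carrier G" "b \<in> carrier G" for a b
    using C[OF t[OF that]] hnorm_V[OF V[OF that]] by simp
  moreover have "f [g \<otimes>\<^bsub>G\<^esub> a, g \<otimes>\<^bsub>G\<^esub> b] = carry X X (act g) (f [a, b])"
    if "g \<in> carrier G" "a \<in> carrier G" "b \<in> carrier G" for g a b
    using e[OF that(1) t[OF that(2,3)]] rep_eq[OF V[OF that(2,3)]] by simp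
  ultimately show ?thesis unfolding bounded_equivariant_def using V by blast
qed

abbreviation bc where "bc x a b c \<equiv> branch_cocycle X (act a x) (act b x) (act c x)"

definition omega :: "'x \<Rightarrow> 'g list \<Rightarrow> 'x set list \<Rightarrow> complex" where
  "omega x = (\<lambda>gs\<in>tuples G 2. bc x (gs ! 0) (gs ! 1) (gs ! 2))"

lemma bc_closed:
  "x \<in> topspace X \<Longrightarrow> y \<in> topspace X \<Longrightarrow> z \<in> topspace X \<Longrightarrow> branch_cocycle X x y z \<in> carrier V"
  unfolding rep_space_def by (rule branch_cocycle_bounded)

lemma omega_cocycle:
  assumes x: "x \<in> topspace X"
  shows "omega x \<in> bcocycles G V (rep A) 2"
proof -
  have mem: "omega x \<in> tuples G 2 \<rightarrow>\<^sub>E carrier V"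
    using x by (auto simp: omega_def tuples_2 bc_closed act_closed)
  moreover have "\<forall>gs\<in>tuples G 2. hnorm V (omega x gs) \<le> 8"
    using x by (auto simp: omega_def tuples_2 hnorm_V bc_closed act_closed branch_cocycle_bounded)
  moreover have "omega x (map (\<lambda>y. g \<otimes>\<^bsub>G\<^esub> y) gs) = rep A g (omega x gs)"
    if g: "g \<in> carrier G" and gs: "gs \<in> tuples G 2" for g gs
  proof -
    obtain a b c where abc: "a \<in> carrier G" "b \<in> carrier G" "c \<in> carrier G" "gs = [a, b, c]"
      using gs by (auto simp: tuples_2)
    then have t: "map (\<lambda>y. g \<otimes>\<^bsub>G\<^esub> y) gs \<in> tuples G 2" using g mult_closed by (simp add: tuples_2)
    show ?thesis
      using t gs abc x g by (simp add: omega_def rep_eq bc_closed act_closed carry_branch_cocycle[OF homeo] act_mult)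
  qed
  ultimately have "omega x \<in> carrier (bcochains G V (rep A) 2)" unfolding bcochains_def by auto
  moreover have "bdelta G V 2 (omega x) = \<one>\<^bsub>bcochains G V (rep A) (Suc 2)\<^esub>"
  proof
    fix gs
    show "bdelta G V 2 (omega x) gs = \<one>\<^bsub>bcochains G V (rep A) (Suc 2)\<^esub> gs"
    proof (cases "gs \<in> tuples G (Suc 2)")
      case True
      then obtain a b c d where abcd: "a \<in> carrier G" "b \<in> carrier G" "c \<in> carrier G" "d \<in> carrier G" "gs = [a, b, c, d]"
        by (auto simp: tuples_3)
      have om: "omega x [a, b, c] = bc x a b c" if "a \<in> carrier G" "b \<in> carrier G" "c \<in> carrier G" for a b c
        using that by (simp add: omega_def tuples_2)
      have "bdelta G V 2 (omega x) gs = (\<lambda>s. omega x [b, c, d] s - omega x [a, c, d] s + omega x [a, b, d] s - omega x [a, b, c] s)"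
        unfolding abcd(5) rep_space_def using mem abcd(1-4) by (intro bdelta_2) (auto simp: rep_space_def)
      also have "\<dots> = (\<lambda>s. 0)"
        using abcd om by (auto simp: branch_cocycle_def fun_eq_iff)
      finally show ?thesis using True by (simp add: bcochains_def rep_space_def ell2_simps)
    qed (simp add: bdelta_def bcochains_def)
  qed
  ultimately show ?thesis unfolding bcocycles_def kernel_def by simp
qed

definition dF :: "('g \<Rightarrow> 'g \<Rightarrow> 'x set list \<Rightarrow> complex) \<Rightarrow> 'g \<Rightarrow> 'g \<Rightarrow> 'g \<Rightarrow> 'x set list \<Rightarrow> complex" where
  "dF F a b c s = F b c s - F a c s + F a b s"

lemma coboundaries_eq:
  "bcoboundaries G V (rep A) 2 = {\<lambda>gs\<in>tuples G 2. dF F (gs ! 0) (gs ! 1) (gs ! 2) | F. bounded_equivariant F}"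
proof -
  have b2: "bcoboundaries G V (rep A) 2 = bdelta G V 1 ` carrier (bcochains G V (rep A) 1)"
    by (simp add: bcoboundaries_def numeral_2_eq_2)
  have d: "bdelta G V 1 f = (\<lambda>gs\<in>tuples G 2. dF (\<lambda>a b. f [a, b]) (gs ! 0) (gs ! 1) (gs ! 2))"
    if f: "\<And>gs. gs \<in> tuples G 1 \<Longrightarrow> f gs \<in> carrier V" for f
  proof
    fix gs
    show "bdelta G V 1 f gs = (\<lambda>gs\<in>tuples G 2. dF (\<lambda>a b. f [a, b]) (gs ! 0) (gs ! 1) (gs ! 2)) gs"
    proof (cases "gs \<in> tuples G 2")
      case True
      then obtain a b c where "a \<in> carrier G" "b \<in> carrier G" "c \<in> carrier G" "gs = [a, b, c]"
        by (auto simp: tuples_2)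
      then show ?thesis
        using bdelta_1[of G f "triples X" a b c] f True unfolding rep_space_def by (simp add: dF_def fun_eq_iff)
    next
      case False
      then show ?thesis by (simp add: bdelta_def numeral_2_eq_2)
    qed
  qed
  have cf: "f gs \<in> carrier V" if "f \<in> carrier (bcochains G V (rep A) 1)" "gs \<in> tuples G 1" for f gs
    using that unfolding bcochains_def by auto
  show ?thesis
  proof (intro equalityI subsetI)
    fix u assume "u \<in> bcoboundaries G V (rep A) 2"
    then obtain f where f: "f \<in> carrier (bcochains G V (rep A) 1)" "u = bdelta G V 1 f" unfolding b2 by blast
    then show "u \<in> {\<lambda>gs\<in>tuples G 2. dF F (gs ! 0) (gs ! 1) (gs ! 2) | F. bounded_equivariant F}"
      using d[of f, OF cf[OF f(1)]] cochain_bounded_equivariant[OF f(1)] by blast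
  next
    fix u assume "u \<in> {\<lambda>gs\<in>tuples G 2. dF F (gs ! 0) (gs ! 1) (gs ! 2) | F. bounded_equivariant F}"
    then obtain F where F: "bounded_equivariant F" "u = (\<lambda>gs\<in>tuples G 2. dF F (gs ! 0) (gs ! 1) (gs ! 2))" by blast
    define f where "f = (\<lambda>gs\<in>tuples G 1. F (gs ! 0) (gs ! 1))"
    have f: "f \<in> carrier (bcochains G V (rep A) 1)" unfolding f_def by (rule bounded_equivariant_cochain[OF F(1)])
    have "bdelta G V 1 f = (\<lambda>gs\<in>tuples G 2. dF (\<lambda>a b. f [a, b]) (gs ! 0) (gs ! 1) (gs ! 2))"
      by (rule d[of f, OF cf[OF f]])
    also have "\<dots> = u"
      unfolding F(2) by (rule restrict_ext) (auto simp: tuples_2 dF_def f_def tuples_1)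
    finally show "u \<in> bcoboundaries G V (rep A) 2" unfolding b2 using f by blast
  qed
qed

definition branch_class :: "'x \<Rightarrow> ('g list \<Rightarrow> 'x set list \<Rightarrow> complex) set" where
  "branch_class x = {\<lambda>gs\<in>tuples G 2. \<lambda>s. dF F (gs ! 0) (gs ! 1) (gs ! 2) s + bc x (gs ! 0) (gs ! 1) (gs ! 2) s
     | F. bounded_equivariant F}"

lemma bounded_equivariant_V: "bounded_equivariant F \<Longrightarrow> a \<in> carrier G \<Longrightarrow> b \<in> carrier G \<Longrightarrow> F a b \<in> carrier V"
  unfolding bounded_equivariant_def by blast

lemma V_closed:
  "u \<in> carrier V \<Longrightarrow> v \<in> carrier V \<Longrightarrow> (\<lambda>s. u s + v s) \<in> carrier V"
  "u \<in> carrier V \<Longrightarrow> v \<in> carrier V \<Longrightarrow> (\<lambda>s. u s - v s) \<in> carrier V"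
  unfolding rep_space_def using ell2_add_closed ell2_minus_closed ell2_add_closed[OF _ ell2_minus_closed] by auto

lemma coset_eq_branch_class:
  assumes x: "x \<in> topspace X"
  shows "bcoboundaries G V (rep A) 2 #>\<^bsub>(bcochains G V (rep A) 2)\<lparr>carrier := bcocycles G V (rep A) 2\<rparr>\<^esub> omega x = branch_class x"
proof -
  have "mult (bcochains G V (rep A) 2) (\<lambda>gs\<in>tuples G 2. dF F (gs ! 0) (gs ! 1) (gs ! 2)) (omega x) =
     (\<lambda>gs\<in>tuples G 2. \<lambda>s. dF F (gs ! 0) (gs ! 1) (gs ! 2) s + bc x (gs ! 0) (gs ! 1) (gs ! 2) s)"
    if F: "bounded_equivariant F" for F
  proof -
    have "dF F a b c \<in> carrier V" if "a \<in> carrier G" "b \<in> carrier G" "c \<in> carrier G" for a b c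
      unfolding dF_def using V_closed bounded_equivariant_V[OF F] that by simp
    then have "dF F a b c \<oplus>\<^bsub>V\<^esub> bc x a b c = (\<lambda>s. dF F a b c s + bc x a b c s)"
      if "a \<in> carrier G" "b \<in> carrier G" "c \<in> carrier G" for a b c
      using that x bc_closed act_closed unfolding rep_space_def by (intro ell2_add) auto
    then show ?thesis unfolding bcochains_def
      by (auto simp: tuples_2 omega_def intro!: restrict_ext)
  qed
  then show ?thesis unfolding r_coset_def coboundaries_eq branch_class_def by auto
qed

text \<open>Write \<open>\<eta>(a)\<close> for the crossing number of \<open>(a x, a y)\<close>, which may be unbounded. The crossing numbers of \<open>(a y, b y)\<close> and
\<open>(a x, b x)\<close> differ by \<open>\<eta>(b) - \<eta>(a)\<close> and by the values of the cocycle on \<open>(a x, a y, b y)\<close> and \<open>(a x, b x, b y)\<close>. The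
former is a cocycle, the latter are bounded.\<close>

lemma branch_class_change_base:
  assumes x: "x \<in> topspace X" and y: "y \<in> topspace X"
  shows "branch_class y \<subseteq> branch_class x"
proof
  fix u assume "u \<in> branch_class y"
  then obtain F where F: "bounded_equivariant F"
    and u: "u = (\<lambda>gs\<in>tuples G 2. \<lambda>s. dF F (gs ! 0) (gs ! 1) (gs ! 2) s + bc y (gs ! 0) (gs ! 1) (gs ! 2) s)"
    unfolding branch_class_def by blast
  define p q where "p a b = branch_cocycle X (act a x) (act a y) (act b y)"
    and "q a b = branch_cocycle X (act a x) (act b x) (act b y)" for a b
  define F' where "F' a b s = (F a b s + p a b s) - q a b s" for a b s
  have pq: "p a b \<in> carrier V" "q a b \<in> carrier V" "l2norm (p a b) \<le> 8" "l2norm (q a b) \<le> 8"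
    if "a \<in> carrier G" "b \<in> carrier G" for a b
    using that x y by (simp_all add: p_def q_def bc_closed branch_cocycle_bounded act_closed)
  have pqe: "p (g \<otimes>\<^bsub>G\<^esub> a) (g \<otimes>\<^bsub>G\<^esub> b) = carry X X (act g) (p a b)" "q (g \<otimes>\<^bsub>G\<^esub> a) (g \<otimes>\<^bsub>G\<^esub> b) = carry X X (act g) (q a b)"
    if "g \<in> carrier G" "a \<in> carrier G" "b \<in> carrier G" for g a b
    using that x y by (simp_all add: p_def q_def carry_branch_cocycle[OF homeo] act_closed act_mult)
  obtain C where C: "\<And>a b. a \<in> carrier G \<Longrightarrow> b \<in> carrier G \<Longrightarrow> l2norm (F a b) \<le> C"
    using F unfolding bounded_equivariant_def by blast
  have sq: "square_summable v" if "v \<in> carrier V" for v using that by (simp add: rep_space_def in_ell2)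
  have "bounded_equivariant F'"
    unfolding bounded_equivariant_def
  proof (intro conjI ballI exI[of _ "C + 8 + 8"])
    fix a b assume ab: "a \<in> carrier G" "b \<in> carrier G"
    note FV = bounded_equivariant_V[OF F ab]
    show "F' a b \<in> carrier V" unfolding F'_def using V_closed pq[OF ab] FV by simp
    have "l2norm (F' a b) \<le> l2norm (\<lambda>s. F a b s + p a b s) + l2norm (\<lambda>s. - q a b s)"
      using square_summable_add(2)[of "\<lambda>s. F a b s + p a b s" "\<lambda>s. - q a b s"]
        sq[OF V_closed(1)[OF FV pq(1)[OF ab]]] square_summable_minus[OF sq[OF pq(2)[OF ab]]]
      by (simp add: F'_def[abs_def])
    also have "\<dots> \<le> (l2norm (F a b) + l2norm (p a b)) + l2norm (q a b)"
      using square_summable_add(2)[OF sq[OF FV] sq[OF pq(1)[OF ab]]] by (simp add: l2norm_minus)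
    also have "\<dots> \<le> C + 8 + 8" using pq[OF ab] C[OF ab] by linarith
    finally show "l2norm (F' a b) \<le> C + 8 + 8" .
    fix g assume g: "g \<in> carrier G"
    have "F (g \<otimes>\<^bsub>G\<^esub> a) (g \<otimes>\<^bsub>G\<^esub> b) = carry X X (act g) (F a b)"
      using F g ab unfolding bounded_equivariant_def by blast
    then show "F' (g \<otimes>\<^bsub>G\<^esub> a) (g \<otimes>\<^bsub>G\<^esub> b) = carry X X (act g) (F' a b)"
      using pqe[OF g ab] by (simp add: F'_def[abs_def] carry_add)
  qed
  moreover have "u = (\<lambda>gs\<in>tuples G 2. \<lambda>s. dF F' (gs ! 0) (gs ! 1) (gs ! 2) s + bc x (gs ! 0) (gs ! 1) (gs ! 2) s)"
    unfolding u
  proof (rule restrict_ext, rule ext)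
    fix gs s
    show "dF F (gs ! 0) (gs ! 1) (gs ! 2) s + bc y (gs ! 0) (gs ! 1) (gs ! 2) s =
      dF F' (gs ! 0) (gs ! 1) (gs ! 2) s + bc x (gs ! 0) (gs ! 1) (gs ! 2) s"
      by (simp add: dF_def F'_def p_def q_def branch_cocycle_def)
  qed
  ultimately show "u \<in> branch_class x" unfolding branch_class_def by blast
qed

lemma branch_class_eq: "x \<in> topspace X \<Longrightarrow> y \<in> topspace X \<Longrightarrow> branch_class x = branch_class y"
  using branch_class_change_base by blast

lemma omega_in_branch_class: "omega x \<in> branch_class x"
proof -
  have "bounded_equivariant (\<lambda>a b s. 0)"
    unfolding bounded_equivariant_def
    by (auto simp: rep_space_def ell2_zero_closed carry_def transport_def fun_eq_iff intro!: exI[of _ "l2norm (\<lambda>s. 0)"])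
  moreover have "omega x = (\<lambda>gs\<in>tuples G 2. \<lambda>s. dF (\<lambda>a b s. 0) (gs ! 0) (gs ! 1) (gs ! 2) s + bc x (gs ! 0) (gs ! 1) (gs ! 2) s)"
    unfolding omega_def by (rule restrict_ext) (simp add: dF_def)
  ultimately show ?thesis unfolding branch_class_def by blast
qed

end

section \<open>Invariant vectors and words\<close>

context dendrite_action
begin

lemma ping_pong_exists:
  obtains b c1 c2 c3 P Q D D' where "plays_ping_pong b c1 c2 c3 P Q D D'"
proof -
  have X: "dendrite X" and nel: "\<not> elementary A"
    using nonelementary by (simp_all add: nonelementary_dendrite_action_def)
  have "topspace X \<noteq> {}" using X by (simp add: dendrite_def continuum_def)
  then obtain K where K: "minimal K" using ex_minimal by blast
  have n1: "\<not> (\<exists>x\<in>topspace X. \<forall>g\<in>carrier G. act g x = x)"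
    and n2: "\<not> (\<exists>x\<in>topspace X. \<exists>y\<in>topspace X. x \<noteq> y \<and> (\<forall>g\<in>carrier G. act g ` {x, y} = {x, y}))"
    using nel unfolding elementary_def by simp_all
  obtain b x1 x2 x3 where b: "b \<in> K" and x: "x1 \<in> K - {b}" "x2 \<in> K - {b}" "x3 \<in> K - {b}"
    and ne: "comp b x1 \<noteq> comp b x2" "comp b x1 \<noteq> comp b x3" "comp b x2 \<noteq> comp b x3"
    using ex_branching[OF K dendrite_median[OF X] n1 n2] .
  show thesis
    by (rule ping_pong[OF K b x ne]) (rule that)
qed

text \<open>Being injective, \<open>g\<close> permutes the finite set \<open>F - C\<close>, but its image is in \<open>C'\<close>.\<close>

lemma finite_invariant_subset:
  assumes F: "finite F" "F \<subseteq> topspace X" "\<And>x. x \<in> F \<Longrightarrow> act g x \<in> F" and g: "g \<in> carrier G"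
    and C: "\<And>x. x \<in> topspace X - C \<Longrightarrow> act g x \<in> C'" "C \<inter> C' = {}"
  shows "F \<subseteq> C \<union> C'"
proof -
  have sub: "act g ` (F - C) \<subseteq> F - C" using F C by blast
  have "inj_on (act g) (F - C)" by (rule inj_on_subset[OF inj_prop[OF g]]) (use F(2) in blast)
  then have "card (act g ` (F - C)) = card (F - C)" by (rule card_image)
  then have "act g ` (F - C) = F - C" using sub F(1) by (intro card_subset_eq) auto
  moreover have "act g ` (F - C) \<subseteq> C'" using F(2) C(1) by blast
  ultimately have "F - C \<subseteq> C'" by simp
  then show ?thesis by blast
qed

lemma no_finite_invariant_set:
  assumes F: "finite F" "F \<subseteq> topspace X" and inv: "\<And>g x. g \<in> carrier G \<Longrightarrow> x \<in> F \<Longrightarrow> act g x \<in> F"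
  shows "F = {}"
proof -
  obtain b c1 c2 c3 P Q D D' where pp: "plays_ping_pong b c1 c2 c3 P Q D D'"
    by (rule ping_pong_exists, rule that)
  have ne: "comp b c1 \<noteq> comp b c2" "comp b c1 \<noteq> comp b c3" "comp b c2 \<noteq> comp b c3"
    and G: "P \<in> carrier G" "Q \<in> carrier G"
    and P: "\<And>x. x \<in> topspace X - comp b c1 \<Longrightarrow> act P x \<in> comp b c3"
    and Q: "\<And>x. x \<in> topspace X - D \<Longrightarrow> act Q x \<in> D'"
    and D: "D \<subseteq> comp b c2" "D' \<subseteq> comp b c2" "D \<inter> D' = {}"
    using pp unfolding plays_ping_pong_def by blast+
  have dis: "comp b c1 \<inter> comp b c3 = {}" "comp b c1 \<inter> comp b c2 = {}" "comp b c3 \<inter> comp b c2 = {}"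
    using ne comp_disjoint by blast+
  have "F \<subseteq> comp b c1 \<union> comp b c3"
    by (rule finite_invariant_subset[OF F inv[OF G(1)] G(1) P dis(1)])
  moreover have "F \<subseteq> D \<union> D'"
    by (rule finite_invariant_subset[OF F inv[OF G(2)] G(2) Q D(3)])
  ultimately show ?thesis using dis D by blast
qed

text \<open>A non-zero value is taken only finitely often by a square-summable function, and the triples where an invariant one takes
it are permuted by the group.\<close>

lemma invariant_vectors_trivial: "invariant_vectors G V (rep A) = {\<zero>\<^bsub>V\<^esub>}"
proof (intro equalityI subsetI)
  fix v assume "v \<in> {\<zero>\<^bsub>V\<^esub>}"
  then have "v = (\<lambda>s. 0)" by (simp add: rep_space_def ell2_simps)
  then show "v \<in> invariant_vectors G V (rep A)"
    by (simp add: invariant_vectors_def rep_def rep_space_def ell2_zero_closed carry_def transport_def)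
next
  fix v assume v: "v \<in> invariant_vectors G V (rep A)"
  then have vV: "v \<in> carrier V" and vi: "\<And>g. g \<in> carrier G \<Longrightarrow> carry X X (act g) v = v"
    by (auto simp: invariant_vectors_def rep_eq)
  have vT: "square_summable v" "\<And>s. s \<notin> triples X \<Longrightarrow> v s = 0" using vV by (simp_all add: rep_space_def in_ell2)
  have "v s = 0" for s
  proof (rule ccontr)
    assume n: "v s \<noteq> 0"
    define T where "T = {t \<in> triples X. v t = v s}"
    have "card S \<le> nat \<lceil>(l2norm v)\<^sup>2 / (cmod (v s))\<^sup>2\<rceil>" if S: "finite S" "S \<subseteq> T" for S
    proof -
      have "card S * (cmod (v s))\<^sup>2 = (\<Sum>t\<in>S. (cmod (v t))\<^sup>2)"
        using S(2) by (subst sum.cong[of S S _ "\<lambda>_. (cmod (v s))\<^sup>2"]) (auto simp: T_def)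
      also have "\<dots> \<le> (l2norm v)\<^sup>2" by (rule finite_sum_le_l2norm[OF vT(1) S(1)])
      finally have "real (card S) \<le> (l2norm v)\<^sup>2 / (cmod (v s))\<^sup>2" using n by (simp add: field_simps)
      then show ?thesis by linarith
    qed
    then have finT: "finite T" using finite_if_finite_subsets_card_bdd by metis
    define F where "F = {b \<in> topspace X. \<exists>t\<in>T. t ! 0 = {b}}"
    have "F \<subseteq> (\<lambda>t. the_elem (t ! 0)) ` T"
    proof
      fix b assume "b \<in> F"
      then obtain t where "t \<in> T" "t ! 0 = {b}" by (auto simp: F_def)
      then show "b \<in> (\<lambda>t. the_elem (t ! 0)) ` T" by (intro image_eqI[of _ _ t]) simp_all
    qed
    then have "finite F" using finT finite_surj by blast
    moreover have "F \<subseteq> topspace X" by (auto simp: F_def)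
    moreover have "act g b \<in> F" if g: "g \<in> carrier G" and b: "b \<in> F" for g b
    proof -
      obtain t where t: "t \<in> T" "t ! 0 = {b}" and bX: "b \<in> topspace X" using b by (auto simp: F_def)
      have "t \<in> triples X" using t(1) by (simp add: T_def)
      then obtain t' where t': "t' \<in> triples X" "pull X (act g) t' = t"
        using bij_betw_pull[OF homeo[OF g]] by (metis bij_betw_imp_surj_on imageE)
      have "v t' = carry X X (act g) v t'" using vi[OF g] by simp
      also have "\<dots> = v t" using t' by (simp add: carry_def transport_def)
      finally have "t' \<in> T" using t t' by (simp add: T_def)
      moreover have "t' ! 0 = {act g b}"
      proof -
        obtain c y z where c: "t' = [{c}, comp c y, comp c z]" using t'(1) by (rule triplesE)
        have "pull X (act g) t' ! 0 = {x \<in> topspace X. act g x \<in> {c}}" unfolding c by (simp add: pull_def)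
        then have "b \<in> {x \<in> topspace X. act g x \<in> {c}}" unfolding t'(2) t(2) by blast
        then show ?thesis using c by simp
      qed
      ultimately show ?thesis using act_closed[OF g bX] by (auto simp: F_def)
    qed
    ultimately have "F = {}" by (rule no_finite_invariant_set)
    moreover have "s \<in> triples X" using vT(2) n by blast
    then obtain b y z where "s = [{b}, comp b y, comp b z]" "b \<in> topspace X" by (rule triplesE)
    then have "b \<in> F" using \<open>s \<in> triples X\<close> by (auto simp: F_def T_def)
    ultimately show False by blast
  qed
  then show "v \<in> {\<zero>\<^bsub>V\<^esub>}" by (auto simp: rep_space_def ell2_simps)
qed

end

lemma bij_betw_split_word:
  "bij_betw (\<lambda>(u, v, y, z). u @ y # z # v)
     ({u. length u = m} \<times> {v. length v = n} \<times> UNIV \<times> UNIV) {w. length w = m + n + 2}"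
  (is "bij_betw ?f ?A ?B")
  unfolding bij_betw_def
proof
  show "inj_on ?f ?A" by (auto simp: inj_on_def)
  show "?f ` ?A = ?B"
  proof (intro equalityI subsetI)
    fix w assume "w \<in> ?B"
    then have w: "length w = m + n + 2" by simp
    then have "drop m w = w ! m # w ! (m + 1) # drop (m + 2) w" by (simp add: Cons_nth_drop_Suc)
    then have "w = ?f (take m w, drop (m + 2) w, w ! m, w ! (m + 1))"
      using append_take_drop_id[of m w] by simp
    then show "w \<in> ?f ` ?A" by (rule image_eqI) (use w in auto)
  qed auto
qed

lemma card_bool_lists: "finite {w :: bool list. length w = n}" "card {w :: bool list. length w = n} = 2 ^ n"
  using finite_lists_length_eq[of "UNIV :: bool set" n] card_lists_length_eq[of "UNIV :: bool set" n] by simp_all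

text \<open>Double counting of the pairs that consist of a word and a place to cut it, with each \<open>2 \<times> 2\<close> block of words that differ at most in the two letters
next to the cut contributing at least \<open>c\<close>.\<close>

lemma prefix_sums_unbounded:
  fixes f :: "bool list \<Rightarrow> bool list \<Rightarrow> real"
  assumes pos: "\<And>u v. f u v \<ge> 0"
    and up: "\<And>w. (\<Sum>i\<le>length w. f (take i w) (drop i w)) \<le> C"
    and low: "\<And>u v. f (u @ [True]) (True # v) + f (u @ [True]) (False # v) + f (u @ [False]) (True # v) + f (u @ [False]) (False # v) \<ge> c"
    and c: "c > 0"
  shows False
proof -
  have le: "real (n + 1) * c \<le> 4 * C" for n
  proof -
    have "real (n + 1) * (2 ^ n * c) = (\<Sum>m\<le>n. 2 ^ n * c)" by simp
    also have "\<dots> \<le> (\<Sum>m\<le>n. \<Sum>w | length w = n + 2. f (take (m + 1) w) (drop (m + 1) w))"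
    proof (rule sum_mono)
      fix m assume "m \<in> {..n}"
      then have mn: "n + 2 = m + (n - m) + 2" by simp
      let ?S = "{u :: bool list. length u = m} \<times> {v :: bool list. length v = n - m}"
      have "(\<Sum>w | length w = n + 2. f (take (m + 1) w) (drop (m + 1) w)) =
          (\<Sum>(u, v, y, z)\<in>{u. length u = m} \<times> {v. length v = n - m} \<times> UNIV \<times> UNIV. f (u @ [y]) (z # v))"
        unfolding mn
        by (subst sum.reindex_bij_betw[OF bij_betw_split_word, symmetric]) (auto intro!: sum.cong)
      also have "\<dots> = (\<Sum>(u, v)\<in>?S. \<Sum>y\<in>UNIV. \<Sum>z\<in>UNIV. f (u @ [y]) (z # v))"
        by (simp add: sum.cartesian_product' card_bool_lists del: UNIV_Times_UNIV)
      also have "\<dots> \<ge> (\<Sum>(u, v)\<in>?S. c)"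
        using low by (intro sum_mono) (auto simp: UNIV_bool add_ac)
      also have "(\<Sum>(u, v)\<in>?S. c) = 2 ^ n * c"
        using mn by (simp add: case_prod_unfold card_cartesian_product card_bool_lists flip: power_add)
      finally show "2 ^ n * c \<le> (\<Sum>w | length w = n + 2. f (take (m + 1) w) (drop (m + 1) w))" .
    qed
    also have "\<dots> = (\<Sum>w | length w = n + 2. \<Sum>m\<le>n. f (take (m + 1) w) (drop (m + 1) w))"
      by (rule sum.swap)
    also have "\<dots> \<le> (\<Sum>w | length (w :: bool list) = n + 2. C)"
    proof (rule sum_mono)
      fix w :: "bool list" assume "w \<in> {w. length w = n + 2}"
      then have w: "length w = n + 2" by simp
      have "(\<Sum>m\<le>n. f (take (m + 1) w) (drop (m + 1) w)) = (\<Sum>i\<in>Suc ` {..n}. f (take i w) (drop i w))"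
        by (simp add: sum.reindex)
      also have "\<dots> \<le> (\<Sum>i\<le>length w. f (take i w) (drop i w))"
        using pos w by (intro sum_mono2) auto
      also have "\<dots> \<le> C" by (rule up)
      finally show "(\<Sum>m\<le>n. f (take (m + 1) w) (drop (m + 1) w)) \<le> C" .
    qed
    also have "\<dots> = 2 ^ n * (4 * C)" by (simp add: card_bool_lists)
    finally have "2 ^ n * (real (n + 1) * c) \<le> 2 ^ n * (4 * C)" by (simp only: mult_ac)
    then show ?thesis by (subst (asm) mult_le_cancel_left_pos) simp_all
  qed
  obtain n where "4 * C / c < real n" using reals_Archimedean2 by blast
  then have "4 * C < real (n + 1) * c" using c by (simp add: field_simps)
  then show False using le[of n] by simp
qed

section \<open>Non-triviality of the class\<close>

context dendrite_action
begin

text \<open>Equivariance turns the values of \<open>F\<close> at one triple into values of a single vector at several triples.\<close>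

lemma bounded_equivariant_translate:
  assumes F: "bounded_equivariant F" and G: "u \<in> carrier G" "v \<in> carrier G" and s: "s \<in> triples X"
  shows "F (inv\<^bsub>G\<^esub> u) v s = F \<one>\<^bsub>G\<^esub> (u \<otimes>\<^bsub>G\<^esub> v) (pull X (act (inv\<^bsub>G\<^esub> u)) s)"
proof -
  interpret group G by (rule group_G)
  have "F (inv\<^bsub>G\<^esub> u \<otimes>\<^bsub>G\<^esub> \<one>\<^bsub>G\<^esub>) (inv\<^bsub>G\<^esub> u \<otimes>\<^bsub>G\<^esub> (u \<otimes>\<^bsub>G\<^esub> v)) =
      carry X X (act (inv\<^bsub>G\<^esub> u)) (F \<one>\<^bsub>G\<^esub> (u \<otimes>\<^bsub>G\<^esub> v))"
    using F inv_closed[OF G(1)] one_closed m_closed[OF G] unfolding bounded_equivariant_def by blast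
  moreover have "inv\<^bsub>G\<^esub> u \<otimes>\<^bsub>G\<^esub> (u \<otimes>\<^bsub>G\<^esub> v) = v" using G by (simp add: m_assoc[symmetric])
  ultimately show ?thesis using G s by (simp add: carry_def transport_def)
qed

text \<open>The numbers \<open>f u v\<close> are the squared values that are summed over all cuts of a word. The ping-pong sets
locate the points \<open>p b\<close> and \<open>v b\<close>, which gives the crossing numbers; they also show that different prefixes of a word move \<open>b\<close>
to different points.\<close>

lemma ping_pong_not_coboundary:
  assumes F: "bounded_equivariant F"
    and pp: "plays_ping_pong b c1 c2 c3 P Q D D'"
    and eq: "\<And>x y z. x \<in> carrier G \<Longrightarrow> y \<in> carrier G \<Longrightarrow> z \<in> carrier G \<Longrightarrow> dF F x y z = bc b x y z"
  shows False
proof -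
  interpret G: group G by (rule group_G)
  have b: "b \<in> topspace X" "c1 \<in> topspace X - {b}" "c2 \<in> topspace X - {b}" "c3 \<in> topspace X - {b}"
    and ne: "comp b c1 \<noteq> comp b c2" "comp b c1 \<noteq> comp b c3" "comp b c2 \<noteq> comp b c3"
    and G: "P \<in> carrier G" "Q \<in> carrier G"
    and P: "\<And>x. x \<in> topspace X - comp b c1 \<Longrightarrow> act P x \<in> comp b c3"
    and Q: "\<And>x. x \<in> topspace X - D \<Longrightarrow> act Q x \<in> D'"
    and D: "D \<subseteq> comp b c2" "D' \<subseteq> comp b c2" "D \<inter> D' = {}"
    using pp unfolding plays_ping_pong_def by blast+
  let ?C1 = "comp b c1" and ?C2 = "comp b c2" and ?C3 = "comp b c3"
  have dis: "?C1 \<inter> ?C3 = {}" "?C1 \<inter> ?C2 = {}" "?C3 \<inter> ?C2 = {}" using ne comp_disjoint by blast+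
  have CX: "?C1 \<subseteq> topspace X" "?C2 \<subseteq> topspace X" "?C3 \<subseteq> topspace X"
    and bC: "b \<notin> ?C1" "b \<notin> ?C2" "b \<notin> ?C3" using cut_comp_subset[of X b] by blast+
  define letter where "letter z = (if z then P else Q)" for z
  have letter: "letter z \<in> carrier G" for z using G by (simp add: letter_def)
  define word where "word zs = foldr (\<lambda>z g. letter z \<otimes>\<^bsub>G\<^esub> g) zs \<one>\<^bsub>G\<^esub>" for zs
  have word_simps: "word [] = \<one>\<^bsub>G\<^esub>" "word (z # zs) = letter z \<otimes>\<^bsub>G\<^esub> word zs" for z zs by (simp_all add: word_def)
  have wordG: "word zs \<in> carrier G" for zs by (induction zs) (simp_all add: word_simps letter)
  have word_append: "word (us @ vs) = word us \<otimes>\<^bsub>G\<^esub> word vs" for us vs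
    by (induction us) (simp_all add: word_simps letter wordG G.m_assoc)
  \<comment> \<open>a set stable under \<open>P\<close> and \<open>Q\<close>, to which words bring \<open>b\<close>\<close>
  define Sp where "Sp = insert b (?C3 \<union> D')"
  have SpX: "Sp \<subseteq> topspace X" using b CX D by (auto simp: Sp_def)
  have Sp1: "Sp \<inter> ?C1 = {}" "Sp \<inter> D = {}" using bC dis D by (auto simp: Sp_def)
  have SpP: "act P x \<in> ?C3" if "x \<in> Sp" for x using P[of x] that Sp1 SpX by blast
  have SpQ: "act Q x \<in> D'" if "x \<in> Sp" for x using Q[of x] that Sp1 SpX by blast
  have Sp_step: "act (letter z) x \<in> Sp" if "x \<in> Sp" for z x
    using SpP[OF that] SpQ[OF that] by (cases z) (simp_all add: letter_def Sp_def)
  have wordSp: "act (word zs) b \<in> Sp" for zs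
  proof (induction zs)
    case Nil
    then show ?case using b by (simp add: word_simps act_one Sp_def)
  next
    case (Cons z zs)
    then show ?case unfolding word_simps act_mult[OF letter wordG b(1)] by (rule Sp_step)
  qed
  have front: "act (word (True # v)) b \<in> ?C3" "act (word (False # v)) b \<in> D'" for v
    using SpP[OF wordSp] SpQ[OF wordSp] act_mult[OF letter wordG b(1)] by (simp_all add: word_simps) (simp_all add: letter_def)
  \<comment> \<open>a set stable under the inverses of \<open>P\<close> and \<open>Q\<close>, to which inverses of words bring \<open>b\<close>\<close>
  define Sm where "Sm = insert b (?C1 \<union> D)"
  have SmX: "Sm \<subseteq> topspace X" using b CX D by (auto simp: Sm_def)
  have Sm1: "Sm \<inter> ?C3 = {}" "Sm \<inter> D' = {}" using bC dis D by (auto simp: Sm_def)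
  have SmP: "act (inv\<^bsub>G\<^esub> P) x \<in> ?C1" if x: "x \<in> Sm" for x
  proof (rule ccontr)
    assume "act (inv\<^bsub>G\<^esub> P) x \<notin> ?C1"
    then have "act P (act (inv\<^bsub>G\<^esub> P) x) \<in> ?C3" using P act_closed[OF inv_closed[OF G(1)]] x SmX by blast
    moreover have "act P (act (inv\<^bsub>G\<^esub> P) x) = x" using act_inv'[OF G(1)] x SmX by blast
    ultimately show False using x Sm1 by auto
  qed
  have SmQ: "act (inv\<^bsub>G\<^esub> Q) x \<in> D" if x: "x \<in> Sm" for x
  proof (rule ccontr)
    assume "act (inv\<^bsub>G\<^esub> Q) x \<notin> D"
    then have "act Q (act (inv\<^bsub>G\<^esub> Q) x) \<in> D'" using Q act_closed[OF inv_closed[OF G(2)]] x SmX by blast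
    moreover have "act Q (act (inv\<^bsub>G\<^esub> Q) x) = x" using act_inv'[OF G(2)] x SmX by blast
    ultimately show False using x Sm1 by auto
  qed
  have inv_snoc: "act (inv\<^bsub>G\<^esub> (word (u @ [z]))) b = act (inv\<^bsub>G\<^esub> (letter z)) (act (inv\<^bsub>G\<^esub> (word u)) b)" for u z
  proof -
    have "word (u @ [z]) = word u \<otimes>\<^bsub>G\<^esub> letter z" by (simp add: word_append word_simps letter)
    then have "inv\<^bsub>G\<^esub> (word (u @ [z])) = inv\<^bsub>G\<^esub> (letter z) \<otimes>\<^bsub>G\<^esub> inv\<^bsub>G\<^esub> (word u)"
      by (simp add: G.inv_mult_group letter wordG)
    then show ?thesis by (simp add: act_mult letter wordG b)
  qed
  have wordSm: "act (inv\<^bsub>G\<^esub> (word us)) b \<in> Sm" for us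
  proof (induction us rule: rev_induct)
    case Nil
    then show ?case using b by (simp add: word_simps act_one Sm_def)
  next
    case (snoc z us)
    then show ?case using SmP SmQ by (simp add: inv_snoc letter_def Sm_def)
  qed
  have rear: "act (inv\<^bsub>G\<^esub> (word (u @ [True]))) b \<in> ?C1" "act (inv\<^bsub>G\<^esub> (word (u @ [False]))) b \<in> D" for u
    using SmP[OF wordSm] SmQ[OF wordSm] by (simp_all add: inv_snoc letter_def)
  define s where "s = [{b}, ?C1, ?C3]"
  have s: "s \<in> triples X" unfolding s_def triples_def using b ne by blast
  have crossing_s: "crossing s x y = of_bool (x \<in> ?C1 \<and> y \<in> ?C3) - of_bool (x \<in> ?C3 \<and> y \<in> ?C1)" for x y
    by (simp add: crossing_def s_def)
  define \<kappa> where "\<kappa> x y = crossing s (act x b) (act y b) - F x y s" for x y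
  have \<kappa>: "\<kappa> y z - \<kappa> x z + \<kappa> x y = 0" if "x \<in> carrier G" "y \<in> carrier G" "z \<in> carrier G" for x y z
    using fun_cong[OF eq[OF that], of s] s by (simp add: dF_def branch_cocycle_def \<kappa>_def algebra_simps)
  define f where "f u v = (cmod (F (inv\<^bsub>G\<^esub> (word u)) (word v) s))\<^sup>2" for u v
  obtain C where C: "\<And>x y. x \<in> carrier G \<Longrightarrow> y \<in> carrier G \<Longrightarrow> l2norm (F x y) \<le> C"
    using F unfolding bounded_equivariant_def by blast
  show False
  proof (rule prefix_sums_unbounded[of f "C\<^sup>2" "1/4"])
    show "f u v \<ge> 0" for u v by (simp add: f_def)
    fix u v
    let ?p1 = "inv\<^bsub>G\<^esub> (word (u @ [True]))" and ?p2 = "inv\<^bsub>G\<^esub> (word (u @ [False]))"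
    let ?v1 = "word (True # v)" and ?v2 = "word (False # v)"
    have pv: "?p1 \<in> carrier G" "?p2 \<in> carrier G" "?v1 \<in> carrier G" "?v2 \<in> carrier G" using wordG by simp_all
    have loc: "act ?p1 b \<in> ?C1" "act ?p2 b \<in> ?C2" "act ?v1 b \<in> ?C3" "act ?v2 b \<in> ?C2"
      using rear[of u] front[of v] D by auto
    have "crossing s (act ?p1 b) (act ?v1 b) = 1" "crossing s (act ?p1 b) (act ?v2 b) = 0"
      "crossing s (act ?p2 b) (act ?v1 b) = 0" "crossing s (act ?p2 b) (act ?v2 b) = 0"
      using loc dis unfolding crossing_s by (auto simp: of_bool_def)
    then have vals: "F ?p1 ?v1 s = 1 - \<kappa> ?p1 ?v1" "F ?p1 ?v2 s = - \<kappa> ?p1 ?v2"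
      "F ?p2 ?v1 s = - \<kappa> ?p2 ?v1" "F ?p2 ?v2 s = - \<kappa> ?p2 ?v2"
      unfolding \<kappa>_def by simp_all
    have kk: "\<kappa> ?p2 ?v1 - \<kappa> ?p1 ?v1 = \<kappa> ?p2 ?v2 - \<kappa> ?p1 ?v2"
      using \<kappa>[OF pv(1,2,3)] \<kappa>[OF pv(1,2,4)] by (metis add_right_imp_eq)
    have "F ?p1 ?v1 s - F ?p2 ?v1 s - F ?p1 ?v2 s + F ?p2 ?v2 s =
        1 + (\<kappa> ?p2 ?v1 - \<kappa> ?p1 ?v1) - (\<kappa> ?p2 ?v2 - \<kappa> ?p1 ?v2)"
      unfolding vals by simp
    then have "F ?p1 ?v1 s - F ?p2 ?v1 s - F ?p1 ?v2 s + F ?p2 ?v2 s = 1"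
      unfolding kk by simp
    then have "1 \<le> cmod (F ?p1 ?v1 s) + cmod (F ?p2 ?v1 s) + cmod (F ?p1 ?v2 s) + cmod (F ?p2 ?v2 s)"
      using norm_triangle_ineq[of "F ?p1 ?v1 s - F ?p2 ?v1 s - F ?p1 ?v2 s" "F ?p2 ?v2 s"]
        norm_triangle_ineq4[of "F ?p1 ?v1 s - F ?p2 ?v1 s" "F ?p1 ?v2 s"]
        norm_triangle_ineq4[of "F ?p1 ?v1 s" "F ?p2 ?v1 s"] by simp
    moreover have "(w + x + y + z)\<^sup>2 \<le> 4 * (w\<^sup>2 + x\<^sup>2 + y\<^sup>2 + z\<^sup>2)" for w x y z :: real
    proof -
      have "0 \<le> (w - x)\<^sup>2 + (w - y)\<^sup>2 + (w - z)\<^sup>2 + (x - y)\<^sup>2 + (x - z)\<^sup>2 + (y - z)\<^sup>2" by simp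
      then show ?thesis by (simp add: power2_eq_square algebra_simps)
    qed
    ultimately have "1 \<le> 4 * (f (u @ [True]) (True # v) + f (u @ [False]) (True # v) + f (u @ [True]) (False # v) + f (u @ [False]) (False # v))"
      unfolding f_def by (meson one_le_power order_trans)
    then show "1/4 \<le> f (u @ [True]) (True # v) + f (u @ [True]) (False # v) + f (u @ [False]) (True # v) + f (u @ [False]) (False # v)"
      by simp
  next
    fix w :: "bool list"
    define t where "t i = pull X (act (inv\<^bsub>G\<^esub> (word (take i w)))) s" for i
    have ft: "f (take i w) (drop i w) = (cmod (F \<one>\<^bsub>G\<^esub> (word w) (t i)))\<^sup>2" for i
      unfolding f_def t_def using bounded_equivariant_translate[OF F wordG wordG s, of "take i w" "drop i w"]
      by (simp add: word_append[symmetric])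
    have t0: "t i ! 0 = {act (word (take i w)) b}" for i
    proof -
      let ?g = "word (take i w)"
      have "t i ! 0 = {x \<in> topspace X. act (inv\<^bsub>G\<^esub> ?g) x = b}" by (simp add: t_def pull_def s_def)
      also have "\<dots> = {act ?g b}"
      proof (intro equalityI subsetI)
        fix x assume "x \<in> {x \<in> topspace X. act (inv\<^bsub>G\<^esub> ?g) x = b}"
        then show "x \<in> {act ?g b}" using act_inv'[OF wordG, of x] by auto
      qed (use act_inv[OF wordG b(1)] act_closed[OF wordG b(1)] in simp)
      finally show ?thesis .
    qed
    \<comment> \<open>the letters between two cuts form a non-empty word, which moves \<open>b\<close> off itself\<close>
    have dist: "t i \<noteq> t j" if ij: "i < j" "j \<le> length w" for i j
    proof
      assume "t i = t j"
      then have e: "act (word (take i w)) b = act (word (take j w)) b" using t0[of i] t0[of j] by simp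
      define m where "m = drop i (take j w)"
      have "take j w = take i w @ m" using ij append_take_drop_id[of i "take j w"] by (simp add: m_def min_def)
      then have "act (word (take i w)) b = act (word (take i w)) (act (word m) b)"
        using e by (simp add: word_append act_mult wordG b)
      then have fixb: "act (word m) b = b" using act_inj[OF wordG b(1) act_closed[OF wordG b(1)]] by simp
      have "m \<noteq> []" using ij by (simp add: m_def)
      then obtain z v where "m = z # v" by (cases m) auto
      then show False using fixb front[of v] bC D by (cases z) auto
    qed
    have inj: "inj_on t {..length w}"
      unfolding inj_on_def by (metis atMost_iff dist linorder_neqE_nat)
    have V: "F \<one>\<^bsub>G\<^esub> (word w) \<in> carrier V" by (rule bounded_equivariant_V[OF F _ wordG]) simp
    have "(\<Sum>i\<le>length w. f (take i w) (drop i w)) = (\<Sum>u\<in>t ` {..length w}. (cmod (F \<one>\<^bsub>G\<^esub> (word w) u))\<^sup>2)"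
      by (simp add: sum.reindex[OF inj] ft)
    also have "\<dots> \<le> (l2norm (F \<one>\<^bsub>G\<^esub> (word w)))\<^sup>2"
      using V by (intro finite_sum_le_l2norm) (auto simp: rep_space_def in_ell2)
    also have "\<dots> \<le> C\<^sup>2" using C[OF _ wordG] l2norm_nonneg by (intro power_mono) auto
    finally show "(\<Sum>i\<le>length w. f (take i w) (drop i w)) \<le> C\<^sup>2" .
  qed simp
qed

end

section \<open>Functoriality\<close>

lemma iso_inverse:
  assumes G: "group G" and \<alpha>: "\<alpha> \<in> iso G H"
  obtains \<iota> where "\<iota> \<in> iso H G" "\<And>a. a \<in> carrier G \<Longrightarrow> \<iota> (\<alpha> a) = a"
    "\<And>b. b \<in> carrier H \<Longrightarrow> \<alpha> (\<iota> b) = b" "\<And>b. b \<in> carrier H \<Longrightarrow> \<iota> b \<in> carrier G"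
proof -
  have bij: "bij_betw \<alpha> (carrier G) (carrier H)" using \<alpha> by (simp add: iso_def)
  show thesis
  proof (rule that[of "inv_into (carrier G) \<alpha>"])
    show "inv_into (carrier G) \<alpha> \<in> iso H G" by (rule group.iso_set_sym[OF G \<alpha>])
  qed (use bij_betw_inv_into_left[OF bij] bij_betw_inv_into_right[OF bij] bij_betwE[OF bij_betw_inv_into[OF bij]] in auto)
qed

lemma action_iso_sym:
  fixes A B :: "('g, 'x) action"
  assumes A: "dendrite_action A" and B: "dendrite_action B" and iso: "action_iso A B \<alpha> h"
  obtains \<iota> k where "action_iso B A \<iota> k" "\<And>a. a \<in> carrier (act_group A) \<Longrightarrow> \<iota> (\<alpha> a) = a"
    "\<And>y. y \<in> topspace (act_space B) \<Longrightarrow> h (k y) = y"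
proof -
  interpret A: dendrite_action A by (rule A)
  interpret B: dendrite_action B by (rule B)
  have \<alpha>: "\<alpha> \<in> iso A.G B.G" and h: "homeomorphic_map A.X B.X h"
    and eq: "\<And>g x. g \<in> carrier A.G \<Longrightarrow> x \<in> topspace A.X \<Longrightarrow> h (A.act g x) = B.act (\<alpha> g) (h x)"
    using iso unfolding action_iso_def by blast+
  obtain \<iota> where \<iota>: "\<iota> \<in> iso B.G A.G" and \<iota>\<alpha>: "\<And>a. a \<in> carrier A.G \<Longrightarrow> \<iota> (\<alpha> a) = a"
    and \<alpha>\<iota>: "\<And>b. b \<in> carrier B.G \<Longrightarrow> \<alpha> (\<iota> b) = b" "\<And>b. b \<in> carrier B.G \<Longrightarrow> \<iota> b \<in> carrier A.G"
    by (rule iso_inverse[OF A.group_G \<alpha>], rule that)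
  obtain k where k: "homeomorphic_maps A.X B.X h k" using h homeomorphic_map_maps by blast
  then have kh: "\<And>x. x \<in> topspace A.X \<Longrightarrow> k (h x) = x" and hk: "\<And>y. y \<in> topspace B.X \<Longrightarrow> h (k y) = y"
    and kX: "\<And>y. y \<in> topspace B.X \<Longrightarrow> k y \<in> topspace A.X"
    by (auto simp: homeomorphic_maps_def continuous_map_def)
  have "homeomorphic_map B.X A.X k" using k homeomorphic_maps_sym homeomorphic_map_maps by metis
  moreover have "k (B.act g y) = A.act (\<iota> g) (k y)" if g: "g \<in> carrier B.G" and y: "y \<in> topspace B.X" for g y
  proof -
    have "h (A.act (\<iota> g) (k y)) = B.act g y" using eq[OF \<alpha>\<iota>(2)[OF g] kX[OF y]] \<alpha>\<iota>(1)[OF g] hk[OF y] by simp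
    then show ?thesis using kh[OF A.act_closed[OF \<alpha>\<iota>(2)[OF g] kX[OF y]]] by simp
  qed
  ultimately have "action_iso B A \<iota> k" using \<iota> by (simp add: action_iso_def)
  then show thesis using that \<iota>\<alpha> hk by blast
qed

lemma bounded_equivariant_push:
  fixes A B :: "('g, 'x) action"
  assumes A: "dendrite_action A" and B: "dendrite_action B" and iso: "action_iso A B \<alpha> h"
    and F: "dendrite_action.bounded_equivariant A F"
  obtains F' where "dendrite_action.bounded_equivariant B F'"
    "\<And>a b. a \<in> carrier (act_group A) \<Longrightarrow> b \<in> carrier (act_group A) \<Longrightarrow>
      F' (\<alpha> a) (\<alpha> b) = carry (act_space A) (act_space B) h (F a b)"
proof -
  interpret A: dendrite_action A by (rule A)
  interpret B: dendrite_action B by (rule B)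
  have \<alpha>: "\<alpha> \<in> iso A.G B.G" and h: "homeomorphic_map A.X B.X h"
    and eq: "\<And>g x. g \<in> carrier A.G \<Longrightarrow> x \<in> topspace A.X \<Longrightarrow> h (A.act g x) = B.act (\<alpha> g) (h x)"
    using iso unfolding action_iso_def by blast+
  obtain \<iota> where \<iota>: "\<iota> \<in> iso B.G A.G" and \<iota>\<alpha>: "\<And>a. a \<in> carrier A.G \<Longrightarrow> \<iota> (\<alpha> a) = a"
    and \<alpha>\<iota>: "\<And>b. b \<in> carrier B.G \<Longrightarrow> \<alpha> (\<iota> b) = b" "\<And>b. b \<in> carrier B.G \<Longrightarrow> \<iota> b \<in> carrier A.G"
    by (rule iso_inverse[OF A.group_G \<alpha>], rule that)
  have \<iota>_mult: "\<iota> (a \<otimes>\<^bsub>B.G\<^esub> b) = \<iota> a \<otimes>\<^bsub>A.G\<^esub> \<iota> b" if "a \<in> carrier B.G" "b \<in> carrier B.G" for a b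
    using \<iota> that by (simp add: iso_def hom_mult)
  define F' where "F' a b = carry A.X B.X h (F (\<iota> a) (\<iota> b))" for a b
  obtain C where C: "\<And>a b. a \<in> carrier A.G \<Longrightarrow> b \<in> carrier A.G \<Longrightarrow> l2norm (F a b) \<le> C"
    using F unfolding A.bounded_equivariant_def by blast
  have FV: "F a b \<in> carrier (ell2 (triples A.X))" if "a \<in> carrier A.G" "b \<in> carrier A.G" for a b
    using A.bounded_equivariant_V[OF F that] by (simp add: rep_space_def)
  have "B.bounded_equivariant F'"
    unfolding B.bounded_equivariant_def
  proof (intro conjI ballI exI[of _ C])
    fix a b assume ab: "a \<in> carrier B.G" "b \<in> carrier B.G"
    note FV' = FV[OF \<alpha>\<iota>(2)[OF ab(1)] \<alpha>\<iota>(2)[OF ab(2)]]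
    show "F' a b \<in> carrier B.V" unfolding F'_def rep_space_def by (rule carry_closed[OF h FV'])
    show "l2norm (F' a b) \<le> C" unfolding F'_def l2norm_carry[OF h FV'] using C \<alpha>\<iota>(2) ab by blast
    fix g assume g: "g \<in> carrier B.G"
    have "F (\<iota> g \<otimes>\<^bsub>A.G\<^esub> \<iota> a) (\<iota> g \<otimes>\<^bsub>A.G\<^esub> \<iota> b) = carry A.X A.X (A.act (\<iota> g)) (F (\<iota> a) (\<iota> b))"
      using F \<alpha>\<iota>(2)[OF g] \<alpha>\<iota>(2)[OF ab(1)] \<alpha>\<iota>(2)[OF ab(2)] unfolding A.bounded_equivariant_def by blast
    then have "F' (g \<otimes>\<^bsub>B.G\<^esub> a) (g \<otimes>\<^bsub>B.G\<^esub> b) = carry A.X B.X h (carry A.X A.X (A.act (\<iota> g)) (F (\<iota> a) (\<iota> b)))"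
      using g ab by (simp add: F'_def \<iota>_mult)
    also have "\<dots> = carry A.X B.X (\<lambda>x. h (A.act (\<iota> g) x)) (F (\<iota> a) (\<iota> b))"
      by (rule carry_carry[OF A.homeo[OF \<alpha>\<iota>(2)[OF g]] h])
    also have "\<dots> = carry A.X B.X (\<lambda>x. B.act g (h x)) (F (\<iota> a) (\<iota> b))"
      using eq[OF \<alpha>\<iota>(2)[OF g]] \<alpha>\<iota>(1)[OF g] by (intro carry_cong) simp
    also have "\<dots> = carry B.X B.X (B.act g) (F' a b)"
      unfolding F'_def by (rule carry_carry[OF h B.homeo[OF g], symmetric])
    finally show "F' (g \<otimes>\<^bsub>B.G\<^esub> a) (g \<otimes>\<^bsub>B.G\<^esub> b) = carry B.X B.X (B.act g) (F' a b)" .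
  qed
  moreover have "F' (\<alpha> a) (\<alpha> b) = carry A.X B.X h (F a b)" if "a \<in> carrier A.G" "b \<in> carrier A.G" for a b
    using that by (simp add: F'_def \<iota>\<alpha>)
  ultimately show thesis using that by blast
qed

lemma bounded_equivariant_pull:
  fixes A B :: "('g, 'x) action"
  assumes A: "dendrite_action A" and B: "dendrite_action B" and iso: "action_iso A B \<alpha> h"
    and F': "dendrite_action.bounded_equivariant B F'"
  obtains F where "dendrite_action.bounded_equivariant A F"
    "\<And>a b. a \<in> carrier (act_group A) \<Longrightarrow> b \<in> carrier (act_group A) \<Longrightarrow>
      F' (\<alpha> a) (\<alpha> b) = carry (act_space A) (act_space B) h (F a b)"
proof -
  interpret A: dendrite_action A by (rule A)
  interpret B: dendrite_action B by (rule B)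
  obtain \<iota> k where k: "action_iso B A \<iota> k" and \<iota>\<alpha>: "\<And>a. a \<in> carrier A.G \<Longrightarrow> \<iota> (\<alpha> a) = a"
    and hk: "\<And>y. y \<in> topspace B.X \<Longrightarrow> h (k y) = y"
    by (rule action_iso_sym[OF A B iso], rule that)
  have h: "homeomorphic_map A.X B.X h" and kh: "homeomorphic_map B.X A.X k" and \<alpha>: "\<alpha> \<in> iso A.G B.G"
    using iso k by (simp_all add: action_iso_def)
  have \<alpha>G: "\<alpha> a \<in> carrier B.G" if "a \<in> carrier A.G" for a
    using \<alpha> that hom_in_carrier[of \<alpha> A.G B.G a] by (simp add: iso_def)
  obtain F where F: "A.bounded_equivariant F"
    "\<And>a b. a \<in> carrier B.G \<Longrightarrow> b \<in> carrier B.G \<Longrightarrow> F (\<iota> a) (\<iota> b) = carry B.X A.X k (F' a b)"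
    by (rule bounded_equivariant_push[OF B A k F']) blast
  have "F' (\<alpha> a) (\<alpha> b) = carry A.X B.X h (F a b)" if ab: "a \<in> carrier A.G" "b \<in> carrier A.G" for a b
  proof -
    have V: "F' (\<alpha> a) (\<alpha> b) \<in> carrier (ell2 (triples B.X))"
      using B.bounded_equivariant_V[OF F' \<alpha>G[OF ab(1)] \<alpha>G[OF ab(2)]] by (simp add: rep_space_def)
    have "F a b = carry B.X A.X k (F' (\<alpha> a) (\<alpha> b))"
      using F(2)[OF \<alpha>G[OF ab(1)] \<alpha>G[OF ab(2)]] \<iota>\<alpha> ab by simp
    then show ?thesis using carry_carry[OF kh h] carry_id[OF V hk] by simp
  qed
  then show thesis using that F(1) by blast
qed

definition action_class :: "('g, 'x) action \<Rightarrow> ('g list \<Rightarrow> 'x set list \<Rightarrow> complex) set" where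
  "action_class A = dendrite_action.branch_class A (SOME x. x \<in> topspace (act_space A))"

lemma (in dendrite_action) action_class_eq:
  assumes x: "x \<in> topspace X"
  shows "action_class A = branch_class x"
  unfolding action_class_def by (rule branch_class_eq[OF someI x]) (rule x)

lemma (in dendrite_action) nonempty: "\<exists>x. x \<in> topspace X"
proof -
  have "topspace X \<noteq> {}"
    using nonelementary by (simp add: nonelementary_dendrite_action_def dendrite_def continuum_def)
  then show ?thesis by blast
qed

text \<open>The cochains of degree 1 on both sides correspond to each other, and the isomorphism carries the cocycle with base point
\<open>x\<close> to the one with base point \<open>h x\<close>.\<close>

lemma action_class_correspond:
  fixes A B :: "('g, 'x) action"
  assumes A: "dendrite_action A" and B: "dendrite_action B" and iso: "action_iso A B \<alpha> h"
  shows "classes_correspond (act_group A) 2 \<alpha> (carry (act_space A) (act_space B) h) (action_class A) (action_class B)"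
proof -
  interpret A: dendrite_action A by (rule A)
  interpret B: dendrite_action B by (rule B)
  have \<alpha>: "\<alpha> \<in> iso A.G B.G" and h: "homeomorphic_map A.X B.X h"
    and eq: "\<And>g x. g \<in> carrier A.G \<Longrightarrow> x \<in> topspace A.X \<Longrightarrow> h (A.act g x) = B.act (\<alpha> g) (h x)"
    using iso unfolding action_iso_def by blast+
  have \<alpha>G: "\<alpha> a \<in> carrier B.G" if "a \<in> carrier A.G" for a
    using \<alpha> that hom_in_carrier[of \<alpha> A.G B.G a] by (simp add: iso_def)
  obtain x where x: "x \<in> topspace A.X" using A.nonempty by blast
  have hx: "h x \<in> topspace B.X" using h x by (auto simp: homeomorphic_eq_everything_map)
  let ?U = "\<lambda>f. \<lambda>gs\<in>tuples A.G 2. carry A.X B.X h (f gs)"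
  let ?R = "\<lambda>f. \<lambda>gs\<in>tuples A.G 2. f (map \<alpha> gs)"
  let ?a = "\<lambda>F. \<lambda>gs\<in>tuples A.G 2. \<lambda>s. A.dF F (gs ! 0) (gs ! 1) (gs ! 2) s + A.bc x (gs ! 0) (gs ! 1) (gs ! 2) s"
  let ?b = "\<lambda>F. \<lambda>gs\<in>tuples B.G 2. \<lambda>s. B.dF F (gs ! 0) (gs ! 1) (gs ! 2) s + B.bc (h x) (gs ! 0) (gs ! 1) (gs ! 2) s"
  have match: "?U (?a F) = ?R (?b F')"
    if FF': "\<And>a b. a \<in> carrier A.G \<Longrightarrow> b \<in> carrier A.G \<Longrightarrow> F' (\<alpha> a) (\<alpha> b) = carry A.X B.X h (F a b)" for F F'
  proof (rule restrict_ext)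
    fix gs assume gs: "gs \<in> tuples A.G 2"
    then obtain a b c where abc: "a \<in> carrier A.G" "b \<in> carrier A.G" "c \<in> carrier A.G" "gs = [a, b, c]"
      by (auto simp: tuples_2)
    have mgs: "map \<alpha> gs \<in> tuples B.G 2" using abc \<alpha>G by (simp add: tuples_2)
    have "carry A.X B.X h (\<lambda>s. A.dF F a b c s + A.bc x a b c s) =
        (\<lambda>s. carry A.X B.X h (F b c) s - carry A.X B.X h (F a c) s + carry A.X B.X h (F a b) s + carry A.X B.X h (A.bc x a b c) s)"
      by (simp add: A.dF_def carry_add)
    also have "carry A.X B.X h (A.bc x a b c) = B.bc (h x) (\<alpha> a) (\<alpha> b) (\<alpha> c)"
      using abc x eq A.act_closed by (simp add: carry_branch_cocycle[OF h])
    finally show "carry A.X B.X h (?a F gs) = ?b F' (map \<alpha> gs)"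
      using gs mgs abc FF' by (simp add: B.dF_def)
  qed
  have cA: "action_class A = {?a F | F. A.bounded_equivariant F}"
    unfolding A.action_class_eq[OF x] A.branch_class_def ..
  have cB: "action_class B = {?b F | F. B.bounded_equivariant F}"
    unfolding B.action_class_eq[OF hx] B.branch_class_def ..
  show ?thesis
    unfolding classes_correspond_def
  proof (intro equalityI subsetI)
    fix w assume "w \<in> ?U ` action_class A"
    then obtain F where F: "A.bounded_equivariant F" "w = ?U (?a F)" unfolding cA by blast
    obtain F' where F': "B.bounded_equivariant F'"
      "\<And>a b. a \<in> carrier A.G \<Longrightarrow> b \<in> carrier A.G \<Longrightarrow> F' (\<alpha> a) (\<alpha> b) = carry A.X B.X h (F a b)"
      by (rule bounded_equivariant_push[OF A B iso F(1)]) blast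
    have "w = ?R (?b F')" unfolding F(2) by (rule match, rule F'(2))
    then show "w \<in> ?R ` action_class B" unfolding cB using F'(1) by blast
  next
    fix w assume "w \<in> ?R ` action_class B"
    then obtain F' where F': "B.bounded_equivariant F'" "w = ?R (?b F')" unfolding cB by blast
    obtain F where F: "A.bounded_equivariant F"
      "\<And>a b. a \<in> carrier A.G \<Longrightarrow> b \<in> carrier A.G \<Longrightarrow> F' (\<alpha> a) (\<alpha> b) = carry A.X B.X h (F a b)"
      by (rule bounded_equivariant_pull[OF A B iso F'(1)]) blast
    have "w = ?U (?a F)" unfolding F'(2) by (rule match[symmetric], rule F(2))
    then show "w \<in> ?U ` action_class A" unfolding cA using F(1) by blast
  qed
qed

context dendrite_action
begin

lemma action_class_in_cohomology: "action_class A \<in> carrier (bounded_cohomology G V (rep A) 2)"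
proof -
  obtain x where x: "x \<in> topspace X" using nonempty by blast
  show ?thesis
    unfolding action_class_eq[OF x] coset_eq_branch_class[OF x, symmetric] bounded_cohomology_def FactGroup_def RCOSETS_def
    using omega_cocycle[OF x] by auto
qed

lemma action_class_nontrivial: "action_class A \<noteq> \<one>\<^bsub>bounded_cohomology G V (rep A) 2\<^esub>"
proof
  assume "action_class A = \<one>\<^bsub>bounded_cohomology G V (rep A) 2\<^esub>"
  then have cob: "action_class A = bcoboundaries G V (rep A) 2"
    by (simp add: bounded_cohomology_def FactGroup_def)
  obtain b c1 c2 c3 P Q D D' where pp: "plays_ping_pong b c1 c2 c3 P Q D D'"
    by (rule ping_pong_exists, rule that)
  then have b: "b \<in> topspace X" by (simp add: plays_ping_pong_def)
  have "omega b \<in> bcoboundaries G V (rep A) 2"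
    using omega_in_branch_class[of b] unfolding action_class_eq[OF b, symmetric] cob .
  then obtain F where F: "bounded_equivariant F"
    "omega b = (\<lambda>gs\<in>tuples G 2. dF F (gs ! 0) (gs ! 1) (gs ! 2))"
    unfolding coboundaries_eq by blast
  have dF_eq: "dF F x y z = bc b x y z" if "x \<in> carrier G" "y \<in> carrier G" "z \<in> carrier G" for x y z
    using fun_cong[OF F(2), of "[x, y, z]"] that by (simp add: omega_def tuples_2)
  show False by (rule ping_pong_not_coboundary[OF F(1) pp dF_eq])
qed

end

theorem theorem1p3:
  shows "\<exists>(V :: ('g, 'x) action \<Rightarrow> ('x set list \<Rightarrow> complex) hilbert) \<pi> c.
    canonical V \<pi> c \<and>
    (\<forall>A :: ('g, 'x) action. nonelementary_dendrite_action A \<longrightarrow>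
       unitary_rep (act_group A) (V A) (\<pi> A) \<and>
       invariant_vectors (act_group A) (V A) (\<pi> A) = {\<zero>\<^bsub>V A\<^esub>} \<and>
       c A \<in> carrier (bounded_cohomology (act_group A) (V A) (\<pi> A) 2) \<and>
       c A \<noteq> \<one>\<^bsub>bounded_cohomology (act_group A) (V A) (\<pi> A) 2\<^esub>)"
proof (intro exI conjI allI impI)
  show "canonical rep_space rep (action_class :: ('g, 'x) action \<Rightarrow> _)"
    unfolding canonical_def
  proof (intro exI[of _ "\<lambda>A B \<alpha> h. carry (act_space A) (act_space B) h"] conjI allI impI ballI)
    fix A B :: "('g, 'x) action" and \<alpha> h
    assume *: "nonelementary_dendrite_action A \<and> nonelementary_dendrite_action B \<and> action_iso A B \<alpha> h"
    interpret A: dendrite_action A using * by unfold_locales simp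
    interpret B: dendrite_action B using * by unfold_locales simp
    have \<alpha>: "\<alpha> \<in> iso A.G B.G" and h: "homeomorphic_map A.X B.X h"
      and eq: "\<And>g x. g \<in> carrier A.G \<Longrightarrow> x \<in> topspace A.X \<Longrightarrow> h (A.act g x) = B.act (\<alpha> g) (h x)"
      using * unfolding action_iso_def by blast+
    show "unitary_map A.V B.V (carry A.X B.X h)" unfolding rep_space_def by (rule unitary_carry[OF h])
    show "classes_correspond A.G 2 \<alpha> (carry A.X B.X h) (action_class A) (action_class B)"
      using * by (intro action_class_correspond A.dendrite_action_axioms B.dendrite_action_axioms) simp
    fix g v assume g: "g \<in> carrier A.G" and v: "v \<in> carrier A.V"
    have \<alpha>g: "\<alpha> g \<in> carrier B.G" using \<alpha> g hom_in_carrier[of \<alpha> A.G B.G g] by (simp add: iso_def)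
    have "carry A.X B.X h v \<in> carrier B.V" using carry_closed[OF h] v by (simp add: rep_space_def)
    then have "rep B (\<alpha> g) (carry A.X B.X h v) = carry A.X B.X (\<lambda>x. B.act (\<alpha> g) (h x)) v"
      using carry_carry[OF h B.homeo[OF \<alpha>g]] by (simp add: B.rep_eq)
    also have "\<dots> = carry A.X B.X (\<lambda>x. h (A.act g x)) v" using eq[OF g] by (intro carry_cong) simp
    also have "\<dots> = carry A.X B.X h (rep A g v)"
      using carry_carry[OF A.homeo[OF g] h] by (simp add: A.rep_eq[OF v])
    finally show "carry A.X B.X h (rep A g v) = rep B (\<alpha> g) (carry A.X B.X h v)" ..
  next
    fix A :: "('g, 'x) action" and \<alpha> h v
    assume "nonelementary_dendrite_action A \<and> action_iso A A \<alpha> h \<and> (\<forall>g\<in>carrier (act_group A). \<alpha> g = g) \<and>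
      (\<forall>x\<in>topspace (act_space A). h x = x)" and "v \<in> carrier (rep_space A)"
    then show "carry (act_space A) (act_space A) h v = v" by (intro carry_id) (simp_all add: rep_space_def)
  next
    fix A B C :: "('g, 'x) action" and \<alpha> h \<beta> k \<gamma> l v
    assume *: "nonelementary_dendrite_action A \<and> nonelementary_dendrite_action B \<and> nonelementary_dendrite_action C \<and>
      action_iso A B \<alpha> h \<and> action_iso B C \<beta> k \<and> action_iso A C \<gamma> l \<and>
      (\<forall>g\<in>carrier (act_group A). \<gamma> g = \<beta> (\<alpha> g)) \<and> (\<forall>x\<in>topspace (act_space A). l x = k (h x))"
    have "carry (act_space B) (act_space C) k (carry (act_space A) (act_space B) h v) =
        carry (act_space A) (act_space C) (\<lambda>x. k (h x)) v"
      using * by (intro carry_carry) (simp_all add: action_iso_def)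
    also have "\<dots> = carry (act_space A) (act_space C) l v" using * by (intro carry_cong) simp
    finally show "carry (act_space A) (act_space C) l v =
      carry (act_space B) (act_space C) k (carry (act_space A) (act_space B) h v)" ..
  qed
next
  fix A :: "('g, 'x) action"
  assume "nonelementary_dendrite_action A"
  then interpret dendrite_action A by unfold_locales
  show "unitary_rep G V (rep A)" by (rule unitary_rep_rep)
  show "invariant_vectors G V (rep A) = {\<zero>\<^bsub>V\<^esub>}" by (rule invariant_vectors_trivial)
  show "action_class A \<in> carrier (bounded_cohomology G V (rep A) 2)" by (rule action_class_in_cohomology)
  show "action_class A \<noteq> \<one>\<^bsub>bounded_cohomology G V (rep A) 2\<^esub>" by (rule action_class_nontrivial)
qed

end
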